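(* Given 2-functors $F\colon\mathfrak A\to\mathfrak B$ and $G\colon\mathfrak C\to\mathfrak B$, the lax comma category $F/G$, with its projections $\mathrm{src}\colon F/G\to\mathfrak A$, $\mathrm{tgt}\colon F/G\to\mathfrak C$ and canonical lax natural transformation $\lambda\colon F\circ\mathrm{src}\Rightarrow G\circ\mathrm{tgt}$, is 1-, 2- and 3-dimensionally universal in the following sense. (1) Given 2-functors $H\colon\mathfrak D\to\mathfrak A$ and $K\colon\mathfrak D\to\mathfrak C$ and any lax natural transformation $\theta\colon FH\Rightarrow GK$, there is a unique 2-functor $U\colon\mathfrak D\to F/G$ (with $\mathrm{src}\,U=H$ and $\mathrm{tgt}\,U=K$) such that $\theta=\lambda\ast U$. (2) Given 2-functors $U,V\colon\mathfrak D\to F/G$ and lax natural transformations $\xi\colon\mathrm{tgt}\,U\Rightarrow\mathrm{tgt}\,V$ and $\zeta\colon\mathrm{src}\,U\Rightarrow\mathrm{src}\,V$ together with a modification $m\colon(G\ast\xi)(\lambda\ast U)\Rrightarrow(\lambda\ast V)(F\ast\zeta)$, there is a lax natural transformation $\omega\colon U\Rightarrow V$ such that the equations $\mathrm{tgt}\ast\omega=\xi$ and $\mathrm{src}\ast\omega=\zeta$ each hold. (3) Given lax natural transformations $\omega\colon U\Rightarrow V$ and $\chi\colon U\Rightarrow V$ between 2-functors $U,V\colon\mathfrak D\to F/G$, with modifications $m\colon\mathrm{src}\ast\omega\Rrightarrow\mathrm{src}\ast\chi$ and $n\colon\mathrm{tgt}\ast\omega\Rrightarrow\mathrm{tgt}\ast\chi$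 satisfying $$(\lambda\ast V)Fm=Gn(\lambda\ast U),$$ there is a unique modification $l\colon\omega\Rrightarrow\chi$ satisfying $\mathrm{tgt}\ast l=n$ and $\mathrm{src}\ast l=m$. These properties characterize $F/G$ up to isomorphism in $\mathbf{Lax}$.
   Context: 2-categories and 2-functors are strict. A lax natural transformation $\alpha\colon F\Rightarrow G$ of 2-functors $F,G\colon\mathfrak K\to\mathfrak L$ consists of arrows $\alpha_A\colon FA\to GA$ and, for each $f\colon A\to B$, a distinguished 2-cell $\alpha_f\colon Gf\,\alpha_A\Rightarrow\alpha_B\,Ff$, satisfying two compatibility conditions: $\alpha_{gf}=(\alpha_g\ast Ff)(Gg\ast\alpha_f)$ for composable $f,g$; and $(\alpha_B\ast F\theta)\alpha_f=\alpha_g(G\theta\ast\alpha_A)$ for each 2-cell $\theta\colon f\Rightarrow g$. Composites are $(\beta\alpha)_A=\beta_A\alpha_A$ with 2-cell at $f$ the pasting of $\alpha_f$ and $\beta_f$. A modification $m\colon\alpha\Rrightarrow\gamma$ is a family of 2-cells $m_A\colon\alpha_A\Rightarrow\gamma_A$ with $(m_B\ast Ff)\alpha_f=\gamma_f(Gf\ast m_A)$. $\mathbf{Lax}$ is the structure whose objects are 2-categories, whose 1-cells are 2-functors, whose 2-cells are lax natural transformations and whose 3-cells are modifications (a category enriched in 2-categories and normalized lax functors). The lax comma category $F/G$ is the 2-category with: objects triples $(A,f,C)$ with $f\colon FA\to GC$ in $\mathfrak B$; arrows $(A,f,C)\to(B,g,D)$ triples $(h,k,\alpha)$ with $h\colon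 A\to B$, $k\colon C\to D$ and a 2-cell $\alpha\colon Gk\,f\Rightarrow g\,Fh$ of $\mathfrak B$; 2-cells $(h,k,\alpha)\Rightarrow(m,n,\beta)$ pairs $(\gamma\colon h\Rightarrow m,\ \delta\colon k\Rightarrow n)$ with $(g\ast F\gamma)\alpha=\beta(G\delta\ast f)$. Arrows compose by pasting; 2-cells compose componentwise. The projection $\mathrm{src}$ sends $(A,f,C)\mapsto A$, $(h,k,\alpha)\mapsto h$, $(\gamma,\delta)\mapsto\gamma$, and $\mathrm{tgt}$ sends $(A,f,C)\mapsto C$, $(h,k,\alpha)\mapsto k$, $(\gamma,\delta)\mapsto\delta$. The lax natural transformation $\lambda$ has component $f$ at $(A,f,C)$ and 2-cell $\alpha$ at $(h,k,\alpha)$. The symbol $\ast$ and juxtaposition denote whiskering; $Fm$ and $Gn$ are the modifications with components $Fm_D$ and $Gn_D$ for objects $D$ of $\mathfrak D$.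
   Formalization: Lax natural transformations are also required to have identity 2-cells at identity arrows (otherwise (1) fails), and the equation in (3), ill-typed as written, is read as an equation of pastings with the 2-cells of λ at the components of ω and χ. *)

theory Defs
  imports "HOL-Library.FuncSet"
begin

section \<open>Strict 2-categories\<close>

text \<open>
  Arrows and 2-cells carry their endpoints.  Only the values of the operations on the
  carriers \<open>obj\<close>, \<open>arr\<close>, \<open>cell\<close> are meaningful.  Composites are written in applicative
  order: \<open>g \<cdot> f\<close> is first \<open>f\<close> then \<open>g\<close>; \<open>\<bullet>\<close> is the vertical and \<open>\<star>\<close> the horizontal
  composition of 2-cells.
\<close>

record ('o, 'm, 'c) two_cat =
  obj :: "'o set"
  arr :: "'m set"
  dom1 :: "'m \<Rightarrow> 'o"
  cod1 :: "'m \<Rightarrow> 'o"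
  id1 :: "'o \<Rightarrow> 'm"
  comp1 :: "'m \<Rightarrow> 'm \<Rightarrow> 'm"  (infixl "\<cdot>\<index>" 75)
  cell :: "'c set"
  dom2 :: "'c \<Rightarrow> 'm"
  cod2 :: "'c \<Rightarrow> 'm"
  id2 :: "'m \<Rightarrow> 'c"
  vcomp :: "'c \<Rightarrow> 'c \<Rightarrow> 'c"  (infixl "\<bullet>\<index>" 65)
  hcomp :: "'c \<Rightarrow> 'c \<Rightarrow> 'c"  (infixl "\<star>\<index>" 70)

definition hom1 :: "('o, 'm, 'c) two_cat \<Rightarrow> 'o \<Rightarrow> 'o \<Rightarrow> 'm set" where
  "hom1 K x y = {f \<in> arr K. dom1 K f = x \<and> cod1 K f = y}"

definition hom2 :: "('o, 'm, 'c) two_cat \<Rightarrow> 'm \<Rightarrow> 'm \<Rightarrow> 'c set" where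
  "hom2 K f g = {\<alpha> \<in> cell K. dom2 K \<alpha> = f \<and> cod2 K \<alpha> = g}"

abbreviation whisker_left :: "('o, 'm, 'c) two_cat \<Rightarrow> 'm \<Rightarrow> 'c \<Rightarrow> 'c" where
  "whisker_left K g \<alpha> \<equiv> id2 K g \<star>\<^bsub>K\<^esub> \<alpha>"

abbreviation whisker_right :: "('o, 'm, 'c) two_cat \<Rightarrow> 'c \<Rightarrow> 'm \<Rightarrow> 'c" where
  "whisker_right K \<alpha> f \<equiv> \<alpha> \<star>\<^bsub>K\<^esub> id2 K f"

locale two_category =
  fixes K :: "('o, 'm, 'c) two_cat" (structure)
  assumes dom1_obj: "f \<in> arr K \<Longrightarrow> dom1 K f \<in> obj K"
    and cod1_obj: "f \<in> arr K \<Longrightarrow> cod1 K f \<in> obj K"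
    and id1_hom: "x \<in> obj K \<Longrightarrow> id1 K x \<in> hom1 K x x"
    and comp1_hom: "\<lbrakk>f \<in> hom1 K x y; g \<in> hom1 K y z\<rbrakk> \<Longrightarrow> g \<cdot> f \<in> hom1 K x z"
    and comp1_id_left: "f \<in> hom1 K x y \<Longrightarrow> id1 K y \<cdot> f = f"
    and comp1_id_right: "f \<in> hom1 K x y \<Longrightarrow> f \<cdot> id1 K x = f"
    and comp1_assoc:
      "\<lbrakk>f \<in> hom1 K x y; g \<in> hom1 K y z; h \<in> hom1 K z w\<rbrakk> \<Longrightarrow> h \<cdot> (g \<cdot> f) = (h \<cdot> g) \<cdot> f"
    and dom2_arr: "\<alpha> \<in> cell K \<Longrightarrow> dom2 K \<alpha> \<in> arr K"
    and cod2_arr: "\<alpha> \<in> cell K \<Longrightarrow> cod2 K \<alpha> \<in> arr K"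
    and dom1_parallel: "\<alpha> \<in> cell K \<Longrightarrow> dom1 K (dom2 K \<alpha>) = dom1 K (cod2 K \<alpha>)"
    and cod1_parallel: "\<alpha> \<in> cell K \<Longrightarrow> cod1 K (dom2 K \<alpha>) = cod1 K (cod2 K \<alpha>)"
    and id2_hom: "f \<in> arr K \<Longrightarrow> id2 K f \<in> hom2 K f f"
    and vcomp_hom: "\<lbrakk>\<alpha> \<in> hom2 K f g; \<beta> \<in> hom2 K g h\<rbrakk> \<Longrightarrow> \<beta> \<bullet> \<alpha> \<in> hom2 K f h"
    and vcomp_id_left: "\<alpha> \<in> hom2 K f g \<Longrightarrow> id2 K g \<bullet> \<alpha> = \<alpha>"
    and vcomp_id_right: "\<alpha> \<in> hom2 K f g \<Longrightarrow> \<alpha> \<bullet> id2 K f = \<alpha>"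
    and vcomp_assoc:
      "\<lbrakk>\<alpha> \<in> hom2 K f g; \<beta> \<in> hom2 K g h; \<gamma> \<in> hom2 K h k\<rbrakk> \<Longrightarrow> \<gamma> \<bullet> (\<beta> \<bullet> \<alpha>) = (\<gamma> \<bullet> \<beta>) \<bullet> \<alpha>"
    and hcomp_hom:
      "\<lbrakk>\<alpha> \<in> hom2 K f f'; \<beta> \<in> hom2 K g g'; cod1 K f = dom1 K g\<rbrakk>
        \<Longrightarrow> \<beta> \<star> \<alpha> \<in> hom2 K (g \<cdot> f) (g' \<cdot> f')"
    and hcomp_id_left: "\<lbrakk>\<alpha> \<in> hom2 K f f'; f \<in> hom1 K x y\<rbrakk> \<Longrightarrow> id2 K (id1 K y) \<star> \<alpha> = \<alpha>"
    and hcomp_id_right: "\<lbrakk>\<alpha> \<in> hom2 K f f'; f \<in> hom1 K x y\<rbrakk> \<Longrightarrow> \<alpha> \<star> id2 K (id1 K x) = \<alpha>"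
    and hcomp_assoc:
      "\<lbrakk>\<alpha> \<in> hom2 K f f'; \<beta> \<in> hom2 K g g'; \<gamma> \<in> hom2 K h h';
        cod1 K f = dom1 K g; cod1 K g = dom1 K h\<rbrakk> \<Longrightarrow> \<gamma> \<star> (\<beta> \<star> \<alpha>) = (\<gamma> \<star> \<beta>) \<star> \<alpha>"
    and hcomp_id2: "\<lbrakk>f \<in> hom1 K x y; g \<in> hom1 K y z\<rbrakk> \<Longrightarrow> id2 K g \<star> id2 K f = id2 K (g \<cdot> f)"
    and interchange:
      "\<lbrakk>\<alpha> \<in> hom2 K f f'; \<alpha>' \<in> hom2 K f' f''; \<beta> \<in> hom2 K g g'; \<beta>' \<in> hom2 K g' g'';
        cod1 K f = dom1 K g\<rbrakk> \<Longrightarrow> (\<beta>' \<bullet> \<beta>) \<star> (\<alpha>' \<bullet> \<alpha>) = (\<beta>' \<star> \<alpha>') \<bullet> (\<beta> \<star> \<alpha>)"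

section \<open>2-functors\<close>

text \<open>
  The maps underlying 2-functors, lax transformations and modifications are required to be
  extensional (\<open>undefined\<close> off the carriers), so that HOL equality is equality of 2-functors,
  of lax transformations and of modifications, and uniqueness is expressed by \<open>\<exists>!\<close>.
\<close>

record ('o, 'm, 'c, 'p, 'n, 'd) two_fun =
  fun0 :: "'o \<Rightarrow> 'p"
  fun1 :: "'m \<Rightarrow> 'n"
  fun2 :: "'c \<Rightarrow> 'd"

locale two_functor = source: two_category K + target: two_category L
  for K :: "('o, 'm, 'c) two_cat" and L :: "('p, 'n, 'd) two_cat" +
  fixes F :: "('o, 'm, 'c, 'p, 'n, 'd) two_fun"
  assumes fun0_maps: "fun0 F \<in> obj K \<rightarrow>\<^sub>E obj L"
    and fun1_maps: "fun1 F \<in> arr K \<rightarrow>\<^sub>E arr L"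
    and fun2_maps: "fun2 F \<in> cell K \<rightarrow>\<^sub>E cell L"
    and fun1_hom: "f \<in> hom1 K x y \<Longrightarrow> fun1 F f \<in> hom1 L (fun0 F x) (fun0 F y)"
    and fun2_hom: "\<alpha> \<in> hom2 K f g \<Longrightarrow> fun2 F \<alpha> \<in> hom2 L (fun1 F f) (fun1 F g)"
    and fun_id1: "x \<in> obj K \<Longrightarrow> fun1 F (id1 K x) = id1 L (fun0 F x)"
    and fun_comp1: "\<lbrakk>f \<in> hom1 K x y; g \<in> hom1 K y z\<rbrakk>
      \<Longrightarrow> fun1 F (g \<cdot>\<^bsub>K\<^esub> f) = fun1 F g \<cdot>\<^bsub>L\<^esub> fun1 F f"
    and fun_id2: "f \<in> arr K \<Longrightarrow> fun2 F (id2 K f) = id2 L (fun1 F f)"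
    and fun_vcomp: "\<lbrakk>\<alpha> \<in> hom2 K f g; \<beta> \<in> hom2 K g h\<rbrakk>
      \<Longrightarrow> fun2 F (\<beta> \<bullet>\<^bsub>K\<^esub> \<alpha>) = fun2 F \<beta> \<bullet>\<^bsub>L\<^esub> fun2 F \<alpha>"
    and fun_hcomp: "\<lbrakk>\<alpha> \<in> hom2 K f f'; \<beta> \<in> hom2 K g g'; cod1 K f = dom1 K g\<rbrakk>
      \<Longrightarrow> fun2 F (\<beta> \<star>\<^bsub>K\<^esub> \<alpha>) = fun2 F \<beta> \<star>\<^bsub>L\<^esub> fun2 F \<alpha>"

definition fun_id :: "('o, 'm, 'c) two_cat \<Rightarrow> ('o, 'm, 'c, 'o, 'm, 'c) two_fun" where
  "fun_id K = \<lparr>fun0 = (\<lambda>x\<in>obj K. x), fun1 = (\<lambda>f\<in>arr K. f), fun2 = (\<lambda>\<alpha>\<in>cell K. \<alpha>)\<rparr>"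

text \<open>\<open>fun_comp D G F\<close> is \<open>G \<circ> F\<close>, where \<open>D\<close> is the domain of \<open>F\<close>; the first argument of the
  operations below is likewise the common domain of the 2-functors involved.\<close>

definition fun_comp ::
  "('o, 'm, 'c) two_cat \<Rightarrow> ('p, 'n, 'd, 'q, 'r, 'e) two_fun \<Rightarrow> ('o, 'm, 'c, 'p, 'n, 'd) two_fun
    \<Rightarrow> ('o, 'm, 'c, 'q, 'r, 'e) two_fun" where
  "fun_comp D G F =
    \<lparr>fun0 = compose (obj D) (fun0 G) (fun0 F),
     fun1 = compose (arr D) (fun1 G) (fun1 F),
     fun2 = compose (cell D) (fun2 G) (fun2 F)\<rparr>"

text \<open>An isomorphism between two objects of \<open>Lax\<close> is an invertible 1-cell, i.e. an invertible
  2-functor.\<close>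

definition Lax_isomorphism ::
  "('o, 'm, 'c) two_cat \<Rightarrow> ('p, 'n, 'd) two_cat \<Rightarrow> ('o, 'm, 'c, 'p, 'n, 'd) two_fun \<Rightarrow> bool" where
  "Lax_isomorphism K L \<Phi> \<longleftrightarrow> two_functor K L \<Phi> \<and>
    (\<exists>\<Psi>. two_functor L K \<Psi> \<and> fun_comp K \<Psi> \<Phi> = fun_id K \<and> fun_comp L \<Phi> \<Psi> = fun_id L)"

section \<open>Lax natural transformations\<close>

record ('o, 'm, 'n, 'd) lax_trans =
  component :: "'o \<Rightarrow> 'n"
  laxity :: "'m \<Rightarrow> 'd"

text \<open>The functoriality condition on \<open>laxity\<close> includes the nullary case \<open>laxity_id1\<close>:
  it is not a consequence of the binary case, which only makes the 2-cells at identities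
  idempotent.\<close>

locale lax_transformation = F: two_functor D L F + G: two_functor D L G
  for D :: "('o, 'm, 'c) two_cat" and L :: "('p, 'n, 'd) two_cat" (structure)
    and F G :: "('o, 'm, 'c, 'p, 'n, 'd) two_fun" +
  fixes \<alpha> :: "('o, 'm, 'n, 'd) lax_trans"
  assumes component_ext: "component \<alpha> \<in> extensional (obj D)"
    and laxity_ext: "laxity \<alpha> \<in> extensional (arr D)"
    and component_hom: "x \<in> obj D \<Longrightarrow> component \<alpha> x \<in> hom1 L (fun0 F x) (fun0 G x)"
    and laxity_hom: "f \<in> hom1 D x y \<Longrightarrow>
      laxity \<alpha> f \<in> hom2 L (fun1 G f \<cdot> component \<alpha> x) (component \<alpha> y \<cdot> fun1 F f)"
    and laxity_id1: "x \<in> obj D \<Longrightarrow> laxity \<alpha> (id1 D x) = id2 L (component \<alpha> x)"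
    and laxity_comp1: "\<lbrakk>f \<in> hom1 D x y; g \<in> hom1 D y z\<rbrakk> \<Longrightarrow>
      laxity \<alpha> (g \<cdot>\<^bsub>D\<^esub> f) =
        whisker_right L (laxity \<alpha> g) (fun1 F f) \<bullet> whisker_left L (fun1 G g) (laxity \<alpha> f)"
    and laxity_natural: "\<lbrakk>f \<in> hom1 D x y; \<theta> \<in> hom2 D f g\<rbrakk> \<Longrightarrow>
      whisker_left L (component \<alpha> y) (fun2 F \<theta>) \<bullet> laxity \<alpha> f =
        laxity \<alpha> g \<bullet> whisker_right L (fun2 G \<theta>) (component \<alpha> x)"

text \<open>\<open>lax_comp D L \<beta> \<alpha>\<close> is the composite \<open>\<beta>\<alpha>\<close> of \<open>\<alpha>: F \<Rightarrow> G\<close> and \<open>\<beta>: G \<Rightarrow> H\<close>, for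
  \<open>F, G, H: D \<rightarrow> L\<close>.\<close>

definition lax_comp ::
  "('o, 'm, 'c) two_cat \<Rightarrow> ('p, 'n, 'd) two_cat \<Rightarrow> ('o, 'm, 'n, 'd) lax_trans
    \<Rightarrow> ('o, 'm, 'n, 'd) lax_trans \<Rightarrow> ('o, 'm, 'n, 'd) lax_trans" where
  "lax_comp D L \<beta> \<alpha> =
    \<lparr>component = (\<lambda>x\<in>obj D. component \<beta> x \<cdot>\<^bsub>L\<^esub> component \<alpha> x),
     laxity = (\<lambda>f\<in>arr D.
       whisker_left L (component \<beta> (cod1 D f)) (laxity \<alpha> f)
         \<bullet>\<^bsub>L\<^esub> whisker_right L (laxity \<beta> f) (component \<alpha> (dom1 D f)))\<rparr>"

text \<open>\<open>fun_lax D H \<alpha>\<close> is \<open>H \<ast> \<alpha>\<close> and \<open>lax_fun D \<alpha> U\<close> is \<open>\<alpha> \<ast> U\<close>.\<close>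

definition fun_lax ::
  "('o, 'm, 'c) two_cat \<Rightarrow> ('p, 'n, 'd, 'q, 'r, 'e) two_fun \<Rightarrow> ('o, 'm, 'n, 'd) lax_trans
    \<Rightarrow> ('o, 'm, 'r, 'e) lax_trans" where
  "fun_lax D H \<alpha> =
    \<lparr>component = compose (obj D) (fun1 H) (component \<alpha>),
     laxity = compose (arr D) (fun2 H) (laxity \<alpha>)\<rparr>"

definition lax_fun ::
  "('o, 'm, 'c) two_cat \<Rightarrow> ('p, 'n, 'r, 'e) lax_trans \<Rightarrow> ('o, 'm, 'c, 'p, 'n, 'd) two_fun
    \<Rightarrow> ('o, 'm, 'r, 'e) lax_trans" where
  "lax_fun D \<alpha> U =
    \<lparr>component = compose (obj D) (component \<alpha>) (fun0 U),
     laxity = compose (arr D) (laxity \<alpha>) (fun1 U)\<rparr>"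

section \<open>Modifications\<close>

locale modification = \<alpha>: lax_transformation D L F G \<alpha> + \<gamma>: lax_transformation D L F G \<gamma>
  for D :: "('o, 'm, 'c) two_cat" and L :: "('p, 'n, 'd) two_cat" (structure)
    and F G :: "('o, 'm, 'c, 'p, 'n, 'd) two_fun" and \<alpha> \<gamma> :: "('o, 'm, 'n, 'd) lax_trans" +
  fixes m :: "'o \<Rightarrow> 'd"
  assumes modification_ext: "m \<in> extensional (obj D)"
    and modification_hom: "x \<in> obj D \<Longrightarrow> m x \<in> hom2 L (component \<alpha> x) (component \<gamma> x)"
    and modification_natural: "f \<in> hom1 D x y \<Longrightarrow>
      whisker_right L (m y) (fun1 F f) \<bullet> laxity \<alpha> f =
        laxity \<gamma> f \<bullet> whisker_left L (fun1 G f) (m x)"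

definition mod_comp ::
  "('o, 'm, 'c) two_cat \<Rightarrow> ('p, 'n, 'd) two_cat \<Rightarrow> ('o \<Rightarrow> 'd) \<Rightarrow> ('o \<Rightarrow> 'd) \<Rightarrow> 'o \<Rightarrow> 'd" where
  "mod_comp D L n m = (\<lambda>x\<in>obj D. n x \<bullet>\<^bsub>L\<^esub> m x)"

definition fun_mod ::
  "('o, 'm, 'c) two_cat \<Rightarrow> ('p, 'n, 'd, 'q, 'r, 'e) two_fun \<Rightarrow> ('o \<Rightarrow> 'd) \<Rightarrow> 'o \<Rightarrow> 'e" where
  "fun_mod D H m = compose (obj D) (fun2 H) m"

definition lax_mod ::
  "('o, 'm, 'c) two_cat \<Rightarrow> ('p, 'n, 'd) two_cat \<Rightarrow> ('o, 'm, 'n, 'd) lax_trans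
    \<Rightarrow> ('o \<Rightarrow> 'd) \<Rightarrow> 'o \<Rightarrow> 'd" where
  "lax_mod D L \<beta> m = (\<lambda>x\<in>obj D. whisker_left L (component \<beta> x) (m x))"

definition mod_lax ::
  "('o, 'm, 'c) two_cat \<Rightarrow> ('p, 'n, 'd) two_cat \<Rightarrow> ('o \<Rightarrow> 'd) \<Rightarrow> ('o, 'm, 'n, 'd) lax_trans
    \<Rightarrow> 'o \<Rightarrow> 'd" where
  "mod_lax D L m \<alpha> = (\<lambda>x\<in>obj D. whisker_right L (m x) (component \<alpha> x))"

text \<open>
  For \<open>\<mu>: S \<Rightarrow> T\<close> between 2-functors \<open>P \<rightarrow> B\<close> and \<open>\<omega>: U \<Rightarrow> V\<close> between 2-functors \<open>D \<rightarrow> P\<close>,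
  the canonical modification \<open>(T \<ast> \<omega>)(\<mu> \<ast> U) \<Rrightarrow> (\<mu> \<ast> V)(S \<ast> \<omega>)\<close> (the interchange comparison
  3-cell of \<open>Lax\<close>), given at \<open>x\<close> by the 2-cell of \<open>\<mu>\<close> at the arrow \<open>\<omega>\<^sub>x\<close>.
\<close>

definition lax_interchange ::
  "('o, 'm, 'c) two_cat \<Rightarrow> ('p, 'n, 'r, 'e) lax_trans \<Rightarrow> ('o, 'm, 'n, 'd) lax_trans
    \<Rightarrow> 'o \<Rightarrow> 'e" where
  "lax_interchange D \<mu> \<omega> = compose (obj D) (laxity \<mu>) (component \<omega>)"

section \<open>The lax comma category\<close>

text \<open>Arrows are stored together with their end objects and 2-cells together with their end
  arrows, since the triple \<open>(h, k, \<alpha>)\<close> and the pair \<open>(\<gamma>, \<delta>)\<close> do not determine these.\<close>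

type_synonym ('a0, 'b1, 'c0) comma_obj = "'a0 \<times> 'b1 \<times> 'c0"

type_synonym ('a0, 'a1, 'b1, 'b2, 'c0, 'c1) comma_arr =
  "('a0, 'b1, 'c0) comma_obj \<times> ('a1 \<times> 'c1 \<times> 'b2) \<times> ('a0, 'b1, 'c0) comma_obj"

type_synonym ('a0, 'a1, 'a2, 'b1, 'b2, 'c0, 'c1, 'c2) comma_cell =
  "('a0, 'a1, 'b1, 'b2, 'c0, 'c1) comma_arr \<times> ('a2 \<times> 'c2)
    \<times> ('a0, 'a1, 'b1, 'b2, 'c0, 'c1) comma_arr"

definition comma_objects ::
  "('a0, 'a1, 'a2) two_cat \<Rightarrow> ('b0, 'b1, 'b2) two_cat \<Rightarrow> ('c0, 'c1, 'c2) two_cat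
    \<Rightarrow> ('a0, 'a1, 'a2, 'b0, 'b1, 'b2) two_fun \<Rightarrow> ('c0, 'c1, 'c2, 'b0, 'b1, 'b2) two_fun
    \<Rightarrow> ('a0, 'b1, 'c0) comma_obj set" where
  "comma_objects A B C F G =
    {(a, f, c). a \<in> obj A \<and> c \<in> obj C \<and> f \<in> hom1 B (fun0 F a) (fun0 G c)}"

definition comma_arrows ::
  "('a0, 'a1, 'a2) two_cat \<Rightarrow> ('b0, 'b1, 'b2) two_cat \<Rightarrow> ('c0, 'c1, 'c2) two_cat
    \<Rightarrow> ('a0, 'a1, 'a2, 'b0, 'b1, 'b2) two_fun \<Rightarrow> ('c0, 'c1, 'c2, 'b0, 'b1, 'b2) two_fun
    \<Rightarrow> ('a0, 'a1, 'b1, 'b2, 'c0, 'c1) comma_arr set" where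
  "comma_arrows A B C F G =
    {((a, f, c), (h, k, \<alpha>), (b, g, d)).
      (a, f, c) \<in> comma_objects A B C F G \<and> (b, g, d) \<in> comma_objects A B C F G \<and>
      h \<in> hom1 A a b \<and> k \<in> hom1 C c d \<and>
      \<alpha> \<in> hom2 B (fun1 G k \<cdot>\<^bsub>B\<^esub> f) (g \<cdot>\<^bsub>B\<^esub> fun1 F h)}"

definition comma_cells ::
  "('a0, 'a1, 'a2) two_cat \<Rightarrow> ('b0, 'b1, 'b2) two_cat \<Rightarrow> ('c0, 'c1, 'c2) two_cat
    \<Rightarrow> ('a0, 'a1, 'a2, 'b0, 'b1, 'b2) two_fun \<Rightarrow> ('c0, 'c1, 'c2, 'b0, 'b1, 'b2) two_fun
    \<Rightarrow> ('a0, 'a1, 'a2, 'b1, 'b2, 'c0, 'c1, 'c2) comma_cell set" where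
  "comma_cells A B C F G =
    {(((a, f, c), (h, k, \<alpha>), (b, g, d)), (\<gamma>, \<delta>), ((a', f', c'), (m, n, \<beta>), (b', g', d'))).
      ((a, f, c), (h, k, \<alpha>), (b, g, d)) \<in> comma_arrows A B C F G \<and>
      ((a', f', c'), (m, n, \<beta>), (b', g', d')) \<in> comma_arrows A B C F G \<and>
      (a', f', c') = (a, f, c) \<and> (b', g', d') = (b, g, d) \<and>
      \<gamma> \<in> hom2 A h m \<and> \<delta> \<in> hom2 C k n \<and>
      whisker_left B g (fun2 F \<gamma>) \<bullet>\<^bsub>B\<^esub> \<alpha> = \<beta> \<bullet>\<^bsub>B\<^esub> whisker_right B (fun2 G \<delta>) f}"

definition comma_comp ::
  "('a0, 'a1, 'a2) two_cat \<Rightarrow> ('b0, 'b1, 'b2) two_cat \<Rightarrow> ('c0, 'c1, 'c2) two_cat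
    \<Rightarrow> ('a0, 'a1, 'a2, 'b0, 'b1, 'b2) two_fun \<Rightarrow> ('c0, 'c1, 'c2, 'b0, 'b1, 'b2) two_fun
    \<Rightarrow> ('a0, 'a1, 'b1, 'b2, 'c0, 'c1) comma_arr \<Rightarrow> ('a0, 'a1, 'b1, 'b2, 'c0, 'c1) comma_arr
    \<Rightarrow> ('a0, 'a1, 'b1, 'b2, 'c0, 'c1) comma_arr" where
  "comma_comp A B C F G =
    (\<lambda>(_, (h', k', \<beta>), Z) (X, (h, k, \<alpha>), _).
      (X, (h' \<cdot>\<^bsub>A\<^esub> h, k' \<cdot>\<^bsub>C\<^esub> k,
           whisker_right B \<beta> (fun1 F h) \<bullet>\<^bsub>B\<^esub> whisker_left B (fun1 G k') \<alpha>), Z))"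

definition lax_comma ::
  "('a0, 'a1, 'a2) two_cat \<Rightarrow> ('b0, 'b1, 'b2) two_cat \<Rightarrow> ('c0, 'c1, 'c2) two_cat
    \<Rightarrow> ('a0, 'a1, 'a2, 'b0, 'b1, 'b2) two_fun \<Rightarrow> ('c0, 'c1, 'c2, 'b0, 'b1, 'b2) two_fun
    \<Rightarrow> (('a0, 'b1, 'c0) comma_obj, ('a0, 'a1, 'b1, 'b2, 'c0, 'c1) comma_arr,
        ('a0, 'a1, 'a2, 'b1, 'b2, 'c0, 'c1, 'c2) comma_cell) two_cat" where
  "lax_comma A B C F G =
    \<lparr>obj = comma_objects A B C F G,
     arr = comma_arrows A B C F G,
     dom1 = (\<lambda>(X, _, _). X),
     cod1 = (\<lambda>(_, _, Y). Y),
     id1 = (\<lambda>(a, f, c). ((a, f, c), (id1 A a, id1 C c, id2 B f), (a, f, c))),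
     comp1 = comma_comp A B C F G,
     cell = comma_cells A B C F G,
     dom2 = (\<lambda>(p, _, _). p),
     cod2 = (\<lambda>(_, _, q). q),
     id2 = (\<lambda>(X, (h, k, \<alpha>), Y). ((X, (h, k, \<alpha>), Y), (id2 A h, id2 C k), (X, (h, k, \<alpha>), Y))),
     vcomp = (\<lambda>(_, (\<gamma>', \<delta>'), q) (p, (\<gamma>, \<delta>), _). (p, (\<gamma>' \<bullet>\<^bsub>A\<^esub> \<gamma>, \<delta>' \<bullet>\<^bsub>C\<^esub> \<delta>), q)),
     hcomp = (\<lambda>(p', (\<gamma>', \<delta>'), q') (p, (\<gamma>, \<delta>), q).
       (comma_comp A B C F G p' p, (\<gamma>' \<star>\<^bsub>A\<^esub> \<gamma>, \<delta>' \<star>\<^bsub>C\<^esub> \<delta>), comma_comp A B C F G q' q))\<rparr>"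

definition comma_src ::
  "('a0, 'a1, 'a2) two_cat \<Rightarrow> ('b0, 'b1, 'b2) two_cat \<Rightarrow> ('c0, 'c1, 'c2) two_cat
    \<Rightarrow> ('a0, 'a1, 'a2, 'b0, 'b1, 'b2) two_fun \<Rightarrow> ('c0, 'c1, 'c2, 'b0, 'b1, 'b2) two_fun
    \<Rightarrow> (('a0, 'b1, 'c0) comma_obj, ('a0, 'a1, 'b1, 'b2, 'c0, 'c1) comma_arr,
        ('a0, 'a1, 'a2, 'b1, 'b2, 'c0, 'c1, 'c2) comma_cell, 'a0, 'a1, 'a2) two_fun" where
  "comma_src A B C F G =
    \<lparr>fun0 = (\<lambda>(a, f, c)\<in>comma_objects A B C F G. a),
     fun1 = (\<lambda>(X, (h, k, \<alpha>), Y)\<in>comma_arrows A B C F G. h),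
     fun2 = (\<lambda>(p, (\<gamma>, \<delta>), q)\<in>comma_cells A B C F G. \<gamma>)\<rparr>"

definition comma_tgt ::
  "('a0, 'a1, 'a2) two_cat \<Rightarrow> ('b0, 'b1, 'b2) two_cat \<Rightarrow> ('c0, 'c1, 'c2) two_cat
    \<Rightarrow> ('a0, 'a1, 'a2, 'b0, 'b1, 'b2) two_fun \<Rightarrow> ('c0, 'c1, 'c2, 'b0, 'b1, 'b2) two_fun
    \<Rightarrow> (('a0, 'b1, 'c0) comma_obj, ('a0, 'a1, 'b1, 'b2, 'c0, 'c1) comma_arr,
        ('a0, 'a1, 'a2, 'b1, 'b2, 'c0, 'c1, 'c2) comma_cell, 'c0, 'c1, 'c2) two_fun" where
  "comma_tgt A B C F G =
    \<lparr>fun0 = (\<lambda>(a, f, c)\<in>comma_objects A B C F G. c),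
     fun1 = (\<lambda>(X, (h, k, \<alpha>), Y)\<in>comma_arrows A B C F G. k),
     fun2 = (\<lambda>(p, (\<gamma>, \<delta>), q)\<in>comma_cells A B C F G. \<delta>)\<rparr>"

definition comma_lambda ::
  "('a0, 'a1, 'a2) two_cat \<Rightarrow> ('b0, 'b1, 'b2) two_cat \<Rightarrow> ('c0, 'c1, 'c2) two_cat
    \<Rightarrow> ('a0, 'a1, 'a2, 'b0, 'b1, 'b2) two_fun \<Rightarrow> ('c0, 'c1, 'c2, 'b0, 'b1, 'b2) two_fun
    \<Rightarrow> (('a0, 'b1, 'c0) comma_obj, ('a0, 'a1, 'b1, 'b2, 'c0, 'c1) comma_arr, 'b1, 'b2) lax_trans"
  where
  "comma_lambda A B C F G =
    \<lparr>component = (\<lambda>(a, f, c)\<in>comma_objects A B C F G. f),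
     laxity = (\<lambda>(X, (h, k, \<alpha>), Y)\<in>comma_arrows A B C F G. \<alpha>)\<rparr>"

section \<open>The universal properties\<close>

text \<open>A lax square \<open>(P, s, t, \<mu>)\<close> over \<open>F: A \<rightarrow> B\<close> and \<open>G: C \<rightarrow> B\<close>: the kind of data whose
  universality is asserted below.\<close>

definition lax_square ::
  "('a0, 'a1, 'a2) two_cat \<Rightarrow> ('b0, 'b1, 'b2) two_cat \<Rightarrow> ('c0, 'c1, 'c2) two_cat
    \<Rightarrow> ('a0, 'a1, 'a2, 'b0, 'b1, 'b2) two_fun \<Rightarrow> ('c0, 'c1, 'c2, 'b0, 'b1, 'b2) two_fun
    \<Rightarrow> ('p0, 'p1, 'p2) two_cat \<Rightarrow> ('p0, 'p1, 'p2, 'a0, 'a1, 'a2) two_fun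
    \<Rightarrow> ('p0, 'p1, 'p2, 'c0, 'c1, 'c2) two_fun \<Rightarrow> ('p0, 'p1, 'b1, 'b2) lax_trans \<Rightarrow> bool" where
  "lax_square A B C F G P s t \<mu> \<longleftrightarrow>
    two_functor P A s \<and> two_functor P C t \<and>
    lax_transformation P B (fun_comp P F s) (fun_comp P G t) \<mu>"

text \<open>The three universal properties of \<open>(P, s, t, \<mu>)\<close>, relative to a test 2-category \<open>D\<close>.\<close>

definition universal_1 ::
  "('a0, 'a1, 'a2) two_cat \<Rightarrow> ('b0, 'b1, 'b2) two_cat \<Rightarrow> ('c0, 'c1, 'c2) two_cat
    \<Rightarrow> ('a0, 'a1, 'a2, 'b0, 'b1, 'b2) two_fun \<Rightarrow> ('c0, 'c1, 'c2, 'b0, 'b1, 'b2) two_fun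
    \<Rightarrow> ('p0, 'p1, 'p2) two_cat \<Rightarrow> ('p0, 'p1, 'p2, 'a0, 'a1, 'a2) two_fun
    \<Rightarrow> ('p0, 'p1, 'p2, 'c0, 'c1, 'c2) two_fun \<Rightarrow> ('p0, 'p1, 'b1, 'b2) lax_trans
    \<Rightarrow> ('d0, 'd1, 'd2) two_cat \<Rightarrow> bool" where
  "universal_1 A B C F G P s t \<mu> D \<longleftrightarrow>
    (\<forall>H K \<theta>. two_functor D A H \<longrightarrow> two_functor D C K \<longrightarrow>
      lax_transformation D B (fun_comp D F H) (fun_comp D G K) \<theta> \<longrightarrow>
      (\<exists>!U. two_functor D P U \<and> fun_comp D s U = H \<and> fun_comp D t U = K \<and>
        \<theta> = lax_fun D \<mu> U))"

definition universal_2 ::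
  "('a0, 'a1, 'a2) two_cat \<Rightarrow> ('b0, 'b1, 'b2) two_cat \<Rightarrow> ('c0, 'c1, 'c2) two_cat
    \<Rightarrow> ('a0, 'a1, 'a2, 'b0, 'b1, 'b2) two_fun \<Rightarrow> ('c0, 'c1, 'c2, 'b0, 'b1, 'b2) two_fun
    \<Rightarrow> ('p0, 'p1, 'p2) two_cat \<Rightarrow> ('p0, 'p1, 'p2, 'a0, 'a1, 'a2) two_fun
    \<Rightarrow> ('p0, 'p1, 'p2, 'c0, 'c1, 'c2) two_fun \<Rightarrow> ('p0, 'p1, 'b1, 'b2) lax_trans
    \<Rightarrow> ('d0, 'd1, 'd2) two_cat \<Rightarrow> bool" where
  "universal_2 A B C F G P s t \<mu> D \<longleftrightarrow>
    (\<forall>U V \<xi> \<zeta> m. two_functor D P U \<longrightarrow> two_functor D P V \<longrightarrow>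
      lax_transformation D C (fun_comp D t U) (fun_comp D t V) \<xi> \<longrightarrow>
      lax_transformation D A (fun_comp D s U) (fun_comp D s V) \<zeta> \<longrightarrow>
      modification D B (fun_comp D F (fun_comp D s U)) (fun_comp D G (fun_comp D t V))
        (lax_comp D B (fun_lax D G \<xi>) (lax_fun D \<mu> U))
        (lax_comp D B (lax_fun D \<mu> V) (fun_lax D F \<zeta>)) m \<longrightarrow>
      (\<exists>\<omega>. lax_transformation D P U V \<omega> \<and> fun_lax D t \<omega> = \<xi> \<and> fun_lax D s \<omega> = \<zeta>))"

text \<open>
  In the third property, \<open>Gn(\<mu> \<ast> U)\<close> and \<open>(\<mu> \<ast> V)Fm\<close> have different domains,
  \<open>(Gt \<ast> \<omega>)(\<mu> \<ast> U)\<close> and \<open>(\<mu> \<ast> V)(Fs \<ast> \<omega>)\<close>, and different codomains.  The equation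
  \<open>(\<mu> \<ast> V)Fm = Gn(\<mu> \<ast> U)\<close> is an equation of pastings in \<open>Lax\<close>: it is to be read modulo the
  interchange modifications of \<open>\<mu>\<close> at \<open>\<omega>\<close> and at \<open>\<chi>\<close>.
\<close>

definition universal_3 ::
  "('a0, 'a1, 'a2) two_cat \<Rightarrow> ('b0, 'b1, 'b2) two_cat \<Rightarrow> ('c0, 'c1, 'c2) two_cat
    \<Rightarrow> ('a0, 'a1, 'a2, 'b0, 'b1, 'b2) two_fun \<Rightarrow> ('c0, 'c1, 'c2, 'b0, 'b1, 'b2) two_fun
    \<Rightarrow> ('p0, 'p1, 'p2) two_cat \<Rightarrow> ('p0, 'p1, 'p2, 'a0, 'a1, 'a2) two_fun
    \<Rightarrow> ('p0, 'p1, 'p2, 'c0, 'c1, 'c2) two_fun \<Rightarrow> ('p0, 'p1, 'b1, 'b2) lax_trans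
    \<Rightarrow> ('d0, 'd1, 'd2) two_cat \<Rightarrow> bool" where
  "universal_3 A B C F G P s t \<mu> D \<longleftrightarrow>
    (\<forall>U V \<omega> \<chi> m n. lax_transformation D P U V \<omega> \<longrightarrow> lax_transformation D P U V \<chi> \<longrightarrow>
      modification D A (fun_comp D s U) (fun_comp D s V) (fun_lax D s \<omega>) (fun_lax D s \<chi>) m \<longrightarrow>
      modification D C (fun_comp D t U) (fun_comp D t V) (fun_lax D t \<omega>) (fun_lax D t \<chi>) n \<longrightarrow>
      mod_comp D B (lax_mod D B (lax_fun D \<mu> V) (fun_mod D F m)) (lax_interchange D \<mu> \<omega>) =
        mod_comp D B (lax_interchange D \<mu> \<chi>) (mod_lax D B (fun_mod D G n) (lax_fun D \<mu> U)) \<longrightarrow>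
      (\<exists>!l. modification D P U V \<omega> \<chi> l \<and> fun_mod D t l = n \<and> fun_mod D s l = m))"

end

theory Submission
  imports Defs
begin

text \<open>
  An object, an arrow and a 2-cell of the lax comma 2-category are determined by their endpoints
  and their images under the two projections and \<open>\<lambda>\<close>, and any compatible data for these occur.
  Read pointwise, the data of a lax transformation \<open>FH \<Rightarrow> GK\<close> are therefore the values of a 2-functor
  into the comma, the functoriality and naturality of its 2-cells being the preservation of
  composites and the condition on 2-cells; likewise the naturality of the modification \<open>m\<close>
  in (2) and the equation in (3) say exactly that pairs of 2-cells of the two factors are 2-cells of
  the comma.  The characterization up to isomorphism uses only (1), by the usual argument on
  representing objects.
\<close>

section \<open>Pasting in a 2-category\<close>

text \<open>Arrows of the comma compose by pasting, so its axioms raise equations between pasted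
  2-cells of \<open>B\<close>. These are separated off and settled in an arbitrary 2-category; what
  they yield is closure of the hom-sets of the comma and the associativity and unit laws for its
  arrows. After that \<open>B\<close> drops out at the level of 2-cells: beyond its end arrows a
  2-cell of the comma consists of a 2-cell of \<open>A\<close> and one of \<open>C\<close>, subject
  to a condition but with no further data, so equations between parallel 2-cells are checked in the
  two factors. The cost falls on endpoints. Arrows and 2-cells store theirs, so before two of them
  are compared they must be shown to lie in one and the same hom-set, and composites that agree only
  by associativity must be rebracketed. This is why most facts are phrased with \<open>hom1\<close>
  and \<open>hom2\<close>.\<close>

context two_category
begin

lemma arr_hom1: "f \<in> arr K \<longleftrightarrow> f \<in> hom1 K (dom1 K f) (cod1 K f)"
  by (simp add: hom1_def)

lemma cell_hom2: "\<alpha> \<in> cell K \<longleftrightarrow> \<alpha> \<in> hom2 K (dom2 K \<alpha>) (cod2 K \<alpha>)"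
  by (simp add: hom2_def)

lemma hom1_obj:
  assumes "f \<in> hom1 K x y"
  shows "x \<in> obj K" "y \<in> obj K"
  using assms dom1_obj cod1_obj by (auto simp: hom1_def)

lemma hom2_arr:
  assumes "\<alpha> \<in> hom2 K f g"
  shows "f \<in> arr K" "g \<in> arr K"
  using assms dom2_arr cod2_arr by (auto simp: hom2_def)

lemma hom2_parallel:
  assumes "\<alpha> \<in> hom2 K f g"
  shows "f \<in> hom1 K x y \<longleftrightarrow> g \<in> hom1 K x y"
  using assms dom2_arr cod2_arr dom1_parallel cod1_parallel by (auto simp: hom1_def hom2_def)

text \<open>The axioms express composability by an equation \<open>cod1 K f = dom1 K g\<close>. The
  primed variants take it from the types of the 1-cells, so that they chain with \<open>OF\<close>
  and the typing facts of 2-functors.\<close>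

lemma hcomp_hom':
  assumes "\<alpha> \<in> hom2 K f f'" "\<beta> \<in> hom2 K g g'" "f \<in> hom1 K x y" "g \<in> hom1 K y z"
  shows "\<beta> \<star> \<alpha> \<in> hom2 K (g \<cdot> f) (g' \<cdot> f')"
  using assms by (intro hcomp_hom) (auto simp: hom1_def)

lemma hcomp_assoc':
  assumes "\<alpha> \<in> hom2 K f f'" "\<beta> \<in> hom2 K g g'" "\<gamma> \<in> hom2 K h h'"
    and "f \<in> hom1 K x y" "g \<in> hom1 K y z" "h \<in> hom1 K z w"
  shows "\<gamma> \<star> (\<beta> \<star> \<alpha>) = \<gamma> \<star> \<beta> \<star> \<alpha>"
  using assms by (intro hcomp_assoc) (auto simp: hom1_def)

lemma id2_hom': "f \<in> hom1 K x y \<Longrightarrow> id2 K f \<in> hom2 K f f"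
  by (auto simp: hom1_def intro: id2_hom)

lemma whisker_left_hom:
  assumes "g \<in> hom1 K y z" "f \<in> hom1 K x y" "\<alpha> \<in> hom2 K f f'"
  shows "id2 K g \<star> \<alpha> \<in> hom2 K (g \<cdot> f) (g \<cdot> f')"
  using hcomp_hom' id2_hom' assms by blast

lemma whisker_right_hom:
  assumes "f \<in> hom1 K x y" "g \<in> hom1 K y z" "\<beta> \<in> hom2 K g g'"
  shows "\<beta> \<star> id2 K f \<in> hom2 K (g \<cdot> f) (g' \<cdot> f)"
  using hcomp_hom' id2_hom' assms by blast

lemma interchange':
  assumes "\<alpha> \<in> hom2 K f f'" "\<alpha>' \<in> hom2 K f' f''" "\<beta> \<in> hom2 K g g'" "\<beta>' \<in> hom2 K g' g''"
    and "f \<in> hom1 K x y" "g \<in> hom1 K y z"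
  shows "(\<beta>' \<bullet> \<beta>) \<star> (\<alpha>' \<bullet> \<alpha>) = (\<beta>' \<star> \<alpha>') \<bullet> (\<beta> \<star> \<alpha>)"
  using assms by (intro interchange) (auto simp: hom1_def)

text \<open>Interchange, with \<open>id2 K g\<close> written as its own vertical composite with
  itself.\<close>

lemma whisker_left_vcomp:
  assumes "g \<in> hom1 K y z" "f \<in> hom1 K x y" "\<alpha> \<in> hom2 K f f'" "\<alpha>' \<in> hom2 K f' f''"
  shows "id2 K g \<star> (\<alpha>' \<bullet> \<alpha>) = (id2 K g \<star> \<alpha>') \<bullet> (id2 K g \<star> \<alpha>)"
  using interchange'[OF assms(3,4) id2_hom' id2_hom' assms(2,1), OF assms(1) assms(1)]
    vcomp_id_left[OF id2_hom'[OF assms(1)]] by simp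

lemma whisker_right_vcomp:
  assumes "f \<in> hom1 K x y" "g \<in> hom1 K y z" "\<beta> \<in> hom2 K g g'" "\<beta>' \<in> hom2 K g' g''"
  shows "(\<beta>' \<bullet> \<beta>) \<star> id2 K f = (\<beta>' \<star> id2 K f) \<bullet> (\<beta> \<star> id2 K f)"
  using interchange'[OF id2_hom' id2_hom' assms(3,4) assms(1,2), OF assms(1) assms(1)]
    vcomp_id_left[OF id2_hom'[OF assms(1)]] by simp

lemma whisker_left_comp:
  assumes "f \<in> hom1 K x y" "g \<in> hom1 K y z" "h \<in> hom1 K z w" "\<alpha> \<in> hom2 K f f'"
  shows "id2 K h \<star> (id2 K g \<star> \<alpha>) = id2 K (h \<cdot> g) \<star> \<alpha>"
  using hcomp_assoc'[OF assms(4) id2_hom' id2_hom' assms(1,2,3)] assms hcomp_id2 by metis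

lemma whisker_right_comp:
  assumes "f \<in> hom1 K x y" "g \<in> hom1 K y z" "h \<in> hom1 K z w" "\<alpha> \<in> hom2 K h h'"
  shows "\<alpha> \<star> id2 K g \<star> id2 K f = \<alpha> \<star> id2 K (g \<cdot> f)"
  using hcomp_assoc'[OF id2_hom' id2_hom' assms(4) assms(1,2,3)] assms hcomp_id2 by metis

lemma whisker_both:
  assumes "f \<in> hom1 K x y" "g \<in> hom1 K y z" "h \<in> hom1 K z w" "\<alpha> \<in> hom2 K g g'"
  shows "id2 K h \<star> (\<alpha> \<star> id2 K f) = id2 K h \<star> \<alpha> \<star> id2 K f"
  using hcomp_assoc'[OF id2_hom' assms(4) id2_hom' assms(1,2,3)] assms by blast

text \<open>Two lax squares side by side: \<open>f\<close>, \<open>g\<close>, \<open>e\<close> are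
  the three parallel sides, \<open>h\<close>, \<open>h'\<close> run along the source side and
  \<open>k\<close>, \<open>k'\<close> along the target side. The outer endpoints are bracketed as
  \<open>(k' \<cdot> k) \<cdot> f\<close> and \<open>e \<cdot> (h' \<cdot> h)\<close>, so that the
  pasting can again be read as one square.\<close>

lemma paste_parts_hom:
  assumes "f \<in> hom1 K x y" "g \<in> hom1 K x' y'" "e \<in> hom1 K x'' y''"
    and "h \<in> hom1 K x x'" "h' \<in> hom1 K x' x''" "k \<in> hom1 K y y'" "k' \<in> hom1 K y' y''"
    and \<alpha>: "\<alpha> \<in> hom2 K (k \<cdot> f) (g \<cdot> h)" and \<beta>: "\<beta> \<in> hom2 K (k' \<cdot> g) (e \<cdot> h')"
  shows "id2 K k' \<star> \<alpha> \<in> hom2 K (k' \<cdot> k \<cdot> f) (k' \<cdot> g \<cdot> h)"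
    and "\<beta> \<star> id2 K h \<in> hom2 K (k' \<cdot> g \<cdot> h) (e \<cdot> (h' \<cdot> h))"
proof -
  have "id2 K k' \<star> \<alpha> \<in> hom2 K (k' \<cdot> (k \<cdot> f)) (k' \<cdot> (g \<cdot> h))"
    using assms whisker_left_hom comp1_hom by metis
  moreover have "\<beta> \<star> id2 K h \<in> hom2 K (k' \<cdot> g \<cdot> h) (e \<cdot> h' \<cdot> h)"
    using assms whisker_right_hom comp1_hom by metis
  moreover have "k' \<cdot> (k \<cdot> f) = k' \<cdot> k \<cdot> f" "k' \<cdot> (g \<cdot> h) = k' \<cdot> g \<cdot> h"
    "e \<cdot> h' \<cdot> h = e \<cdot> (h' \<cdot> h)"
    using assms comp1_assoc by metis+
  ultimately show "id2 K k' \<star> \<alpha> \<in> hom2 K (k' \<cdot> k \<cdot> f) (k' \<cdot> g \<cdot> h)"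
    "\<beta> \<star> id2 K h \<in> hom2 K (k' \<cdot> g \<cdot> h) (e \<cdot> (h' \<cdot> h))"
    by simp_all
qed

lemma paste_hom:
  assumes "f \<in> hom1 K x y" "g \<in> hom1 K x' y'" "e \<in> hom1 K x'' y''"
    and "h \<in> hom1 K x x'" "h' \<in> hom1 K x' x''" "k \<in> hom1 K y y'" "k' \<in> hom1 K y' y''"
    and "\<alpha> \<in> hom2 K (k \<cdot> f) (g \<cdot> h)" and "\<beta> \<in> hom2 K (k' \<cdot> g) (e \<cdot> h')"
  shows "(\<beta> \<star> id2 K h) \<bullet> (id2 K k' \<star> \<alpha>) \<in> hom2 K (k' \<cdot> k \<cdot> f) (e \<cdot> (h' \<cdot> h))"
  using paste_parts_hom[OF assms] by (rule vcomp_hom)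

text \<open>Vertical associativity in the form that links composites of lax transformations with
  composites of comma arrows: \<open>lax_comp\<close> groups the first two factors, whereas the
  2-cell of a comma composite is the pasting of the last two. \<open>paste_vcomp_assoc\<close> is
  the mirror image.\<close>

lemma vcomp_paste_assoc:
  assumes homs: "f \<in> hom1 K x y" "g \<in> hom1 K x' y'" "e \<in> hom1 K x'' y''"
    "h \<in> hom1 K x x'" "h' \<in> hom1 K x' x''" "k \<in> hom1 K y y'" "k' \<in> hom1 K y' y''"
    and cells: "\<alpha> \<in> hom2 K (k \<cdot> f) (g \<cdot> h)" "\<beta> \<in> hom2 K (k' \<cdot> g) (e \<cdot> h')"
    and \<gamma>: "\<gamma> \<in> hom2 K (h' \<cdot> h) r"
  shows "(id2 K e \<star> \<gamma>) \<bullet> ((\<beta> \<star> id2 K h) \<bullet> (id2 K k' \<star> \<alpha>))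
    = (id2 K e \<star> \<gamma>) \<bullet> (\<beta> \<star> id2 K h) \<bullet> (id2 K k' \<star> \<alpha>)"
  using vcomp_assoc[OF paste_parts_hom[OF homs cells]
      whisker_left_hom[OF homs(3) comp1_hom[OF homs(4,5)] \<gamma>]] .

lemma paste_vcomp_assoc:
  assumes homs: "f \<in> hom1 K x y" "g \<in> hom1 K x' y'" "e \<in> hom1 K x'' y''"
    "h \<in> hom1 K x x'" "h' \<in> hom1 K x' x''" "k \<in> hom1 K y y'" "k' \<in> hom1 K y' y''"
    and cells: "\<alpha> \<in> hom2 K (k \<cdot> f) (g \<cdot> h)" "\<beta> \<in> hom2 K (k' \<cdot> g) (e \<cdot> h')"
    and \<delta>: "\<delta> \<in> hom2 K r (k' \<cdot> k)"
  shows "(\<beta> \<star> id2 K h) \<bullet> ((id2 K k' \<star> \<alpha>) \<bullet> (\<delta> \<star> id2 K f))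
    = (\<beta> \<star> id2 K h) \<bullet> (id2 K k' \<star> \<alpha>) \<bullet> (\<delta> \<star> id2 K f)"
proof -
  have "r \<in> hom1 K y y''" using hom2_parallel[OF \<delta>] comp1_hom[OF homs(6,7)] by blast
  then show ?thesis
    using vcomp_assoc[OF whisker_right_hom[OF homs(1) _ \<delta>] paste_parts_hom[OF homs cells]] by blast
qed

text \<open>Whiskering distributes over vertical composition, and left and right whiskering of the
  middle square commute (\<open>whisker_both\<close>). Both sides then consist of the same three
  vertical factors, one for each square, and differ only by \<open>vcomp_assoc\<close>.\<close>

lemma paste_assoc:
  assumes homs: "f \<in> hom1 K x y" "g \<in> hom1 K x' y'" "e \<in> hom1 K x'' y''" "r \<in> hom1 K x''' y'''"
    "h \<in> hom1 K x x'" "h' \<in> hom1 K x' x''" "h'' \<in> hom1 K x'' x'''"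
    "k \<in> hom1 K y y'" "k' \<in> hom1 K y' y''" "k'' \<in> hom1 K y'' y'''"
    and \<alpha>: "\<alpha> \<in> hom2 K (k \<cdot> f) (g \<cdot> h)" and \<beta>: "\<beta> \<in> hom2 K (k' \<cdot> g) (e \<cdot> h')"
    and \<gamma>: "\<gamma> \<in> hom2 K (k'' \<cdot> e) (r \<cdot> h'')"
  shows "(\<gamma> \<star> id2 K (h' \<cdot> h)) \<bullet> (id2 K k'' \<star> ((\<beta> \<star> id2 K h) \<bullet> (id2 K k' \<star> \<alpha>)))
    = (((\<gamma> \<star> id2 K h') \<bullet> (id2 K k'' \<star> \<beta>)) \<star> id2 K h) \<bullet> (id2 K (k'' \<cdot> k') \<star> \<alpha>)"
proof -
  note c = comp1_hom comp1_assoc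
  have comps: "k \<cdot> f \<in> hom1 K x y'" "g \<cdot> h \<in> hom1 K x y'" "k' \<cdot> g \<in> hom1 K x' y''"
    "e \<cdot> h' \<in> hom1 K x' y''" "k'' \<cdot> e \<in> hom1 K x'' y'''" "k'' \<cdot> k' \<in> hom1 K y' y'''"
    "k'' \<cdot> (k' \<cdot> g) \<in> hom1 K x' y'''" "k' \<cdot> (k \<cdot> f) \<in> hom1 K x y''" "h' \<cdot> h \<in> hom1 K x x''"
    using homs c by metis+
  have 1: "id2 K k' \<star> \<alpha> \<in> hom2 K (k' \<cdot> (k \<cdot> f)) (k' \<cdot> g \<cdot> h)"
    using whisker_left_hom[OF homs(9) comps(1) \<alpha>] homs c by metis
  have 2: "\<beta> \<star> id2 K h \<in> hom2 K (k' \<cdot> g \<cdot> h) (e \<cdot> h' \<cdot> h)"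
    using whisker_right_hom[OF homs(5) comps(3) \<beta>] .
  have 3: "id2 K k'' \<star> \<beta> \<in> hom2 K (k'' \<cdot> (k' \<cdot> g)) (k'' \<cdot> e \<cdot> h')"
    using whisker_left_hom[OF homs(10) comps(3) \<beta>] homs c by metis
  have 4: "\<gamma> \<star> id2 K h' \<in> hom2 K (k'' \<cdot> e \<cdot> h') (r \<cdot> h'' \<cdot> h')"
    using whisker_right_hom[OF homs(6) comps(5) \<gamma>] .
  \<comment> \<open>Facts 5 to 7 are the three factors in their final form; adjacent endpoints must
    be bracketed alike for \<open>vcomp_assoc\<close> to apply.\<close>
  have 5: "id2 K k'' \<star> (id2 K k' \<star> \<alpha>) \<in> hom2 K (k'' \<cdot> (k' \<cdot> (k \<cdot> f))) (k'' \<cdot> (k' \<cdot> g) \<cdot> h)"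
    using whisker_left_hom[OF homs(10) comps(8) 1] homs comps c by metis
  have 6: "id2 K k'' \<star> \<beta> \<star> id2 K h \<in> hom2 K (k'' \<cdot> (k' \<cdot> g) \<cdot> h) (k'' \<cdot> e \<cdot> h' \<cdot> h)"
    using whisker_right_hom[OF homs(5) comps(7) 3] .
  have 7: "\<gamma> \<star> id2 K h' \<star> id2 K h \<in> hom2 K (k'' \<cdot> e \<cdot> h' \<cdot> h) (r \<cdot> h'' \<cdot> h' \<cdot> h)"
    using whisker_right_hom[OF homs(5) _ 4] homs comps c by metis
  have "id2 K k'' \<star> ((\<beta> \<star> id2 K h) \<bullet> (id2 K k' \<star> \<alpha>))
      = (id2 K k'' \<star> \<beta> \<star> id2 K h) \<bullet> (id2 K k'' \<star> (id2 K k' \<star> \<alpha>))"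
    using whisker_left_vcomp[OF homs(10) comps(8) 1 2] whisker_both[OF homs(5) comps(3) homs(10) \<beta>]
    by simp
  moreover have "\<gamma> \<star> id2 K (h' \<cdot> h) = \<gamma> \<star> id2 K h' \<star> id2 K h"
    using whisker_right_comp[OF homs(5,6) comps(5) \<gamma>] by simp
  moreover have "((\<gamma> \<star> id2 K h') \<bullet> (id2 K k'' \<star> \<beta>)) \<star> id2 K h
      = (\<gamma> \<star> id2 K h' \<star> id2 K h) \<bullet> (id2 K k'' \<star> \<beta> \<star> id2 K h)"
    using whisker_right_vcomp[OF homs(5) comps(7) 3 4] .
  moreover have "id2 K (k'' \<cdot> k') \<star> \<alpha> = id2 K k'' \<star> (id2 K k' \<star> \<alpha>)"
    using whisker_left_comp[OF comps(1) homs(9,10) \<alpha>] by simp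
  ultimately show ?thesis using vcomp_assoc[OF 5 6 7] by simp
qed

text \<open>\<open>id2 K g\<close> is the 2-cell of the identity comma arrow at an object with
  1-cell \<open>g\<close>; whiskered by \<open>h\<close> it becomes an identity 2-cell and
  cancels.\<close>

lemma paste_id_left:
  assumes "f \<in> hom1 K x y" "g \<in> hom1 K x' y'" "h \<in> hom1 K x x'" "k \<in> hom1 K y y'"
    and "\<alpha> \<in> hom2 K (k \<cdot> f) (g \<cdot> h)"
  shows "(id2 K g \<star> id2 K h) \<bullet> (id2 K (id1 K y') \<star> \<alpha>) = \<alpha>"
  using assms hcomp_id2 hcomp_id_left vcomp_id_left comp1_hom by metis

lemma paste_id_right:
  assumes "f \<in> hom1 K x y" "g \<in> hom1 K x' y'" "h \<in> hom1 K x x'" "k \<in> hom1 K y y'"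
    and "\<alpha> \<in> hom2 K (k \<cdot> f) (g \<cdot> h)"
  shows "(\<alpha> \<star> id2 K (id1 K x)) \<bullet> (id2 K k \<star> id2 K f) = \<alpha>"
  using assms hcomp_id2 hcomp_id_right vcomp_id_right comp1_hom by metis

text \<open>\<open>eq\<close> and \<open>eq'\<close> are the defining condition of comma 2-cells,
  with \<open>fun2 F\<close> and \<open>fun2 G\<close> already applied. Once whiskering is
  distributed, each in turn carries its own 2-cells across the square.\<close>

lemma paste_vcomp:
  assumes homs: "f \<in> hom1 K x y" "g \<in> hom1 K x' y'" "h \<in> hom1 K x x'" "k \<in> hom1 K y y'"
    and cells: "\<gamma> \<in> hom2 K h h'" "\<gamma>' \<in> hom2 K h' h''" "\<delta> \<in> hom2 K k k'" "\<delta>' \<in> hom2 K k' k''"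
    "\<alpha> \<in> hom2 K (k \<cdot> f) (g \<cdot> h)" "\<alpha>' \<in> hom2 K (k' \<cdot> f) (g \<cdot> h')"
    "\<alpha>'' \<in> hom2 K (k'' \<cdot> f) (g \<cdot> h'')"
    and eq: "(id2 K g \<star> \<gamma>) \<bullet> \<alpha> = \<alpha>' \<bullet> (\<delta> \<star> id2 K f)"
    and eq': "(id2 K g \<star> \<gamma>') \<bullet> \<alpha>' = \<alpha>'' \<bullet> (\<delta>' \<star> id2 K f)"
  shows "(id2 K g \<star> (\<gamma>' \<bullet> \<gamma>)) \<bullet> \<alpha> = \<alpha>'' \<bullet> ((\<delta>' \<bullet> \<delta>) \<star> id2 K f)"
proof -
  have h': "h' \<in> hom1 K x x'" and k': "k' \<in> hom1 K y y'"
    using homs cells hom2_parallel by blast+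
  have 1: "id2 K g \<star> \<gamma> \<in> hom2 K (g \<cdot> h) (g \<cdot> h')" "id2 K g \<star> \<gamma>' \<in> hom2 K (g \<cdot> h') (g \<cdot> h'')"
    "\<delta> \<star> id2 K f \<in> hom2 K (k \<cdot> f) (k' \<cdot> f)" "\<delta>' \<star> id2 K f \<in> hom2 K (k' \<cdot> f) (k'' \<cdot> f)"
    using homs cells h' k' whisker_left_hom whisker_right_hom by blast+
  have "(id2 K g \<star> (\<gamma>' \<bullet> \<gamma>)) \<bullet> \<alpha> = (id2 K g \<star> \<gamma>') \<bullet> ((id2 K g \<star> \<gamma>) \<bullet> \<alpha>)"
    using whisker_left_vcomp[OF homs(2,3) cells(1,2)] vcomp_assoc[OF cells(5) 1(1,2)] by simp
  also have "\<dots> = (id2 K g \<star> \<gamma>') \<bullet> \<alpha>' \<bullet> (\<delta> \<star> id2 K f)"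
    unfolding eq using vcomp_assoc[OF 1(3) cells(6) 1(2)] by simp
  also have "\<dots> = \<alpha>'' \<bullet> ((\<delta>' \<star> id2 K f) \<bullet> (\<delta> \<star> id2 K f))"
    unfolding eq' using vcomp_assoc[OF 1(3,4) cells(7)] by simp
  also have "\<dots> = \<alpha>'' \<bullet> ((\<delta>' \<bullet> \<delta>) \<star> id2 K f)"
    using whisker_right_vcomp[OF homs(1,4) cells(3,4)] by simp
  finally show ?thesis .
qed

text \<open>This is the closure of the comma condition under horizontal composition. Neither
  \<open>eq'\<close> nor \<open>eq\<close> occurs literally in the pasting: interchange first
  gathers \<gamma>' and \<alpha>' into the left factor of a horizontal composite with \<gamma>,
  where \<open>eq'\<close> applies, and after redistribution gathers \<gamma> and \<alpha> into the
  right factor of one with \<delta>', where \<open>eq\<close> applies.\<close>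

lemma paste_hcomp:
  assumes homs: "f \<in> hom1 K x y" "g \<in> hom1 K x' y'" "e \<in> hom1 K x'' y''"
    "h \<in> hom1 K x x'" "h' \<in> hom1 K x' x''" "k \<in> hom1 K y y'" "k' \<in> hom1 K y' y''"
    and cells: "\<gamma> \<in> hom2 K h m" "\<gamma>' \<in> hom2 K h' m'" "\<delta> \<in> hom2 K k n" "\<delta>' \<in> hom2 K k' n'"
    "\<alpha> \<in> hom2 K (k \<cdot> f) (g \<cdot> h)" "\<beta> \<in> hom2 K (n \<cdot> f) (g \<cdot> m)"
    "\<alpha>' \<in> hom2 K (k' \<cdot> g) (e \<cdot> h')" "\<beta>' \<in> hom2 K (n' \<cdot> g) (e \<cdot> m')"
    and eq: "(id2 K g \<star> \<gamma>) \<bullet> \<alpha> = \<beta> \<bullet> (\<delta> \<star> id2 K f)"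
    and eq': "(id2 K e \<star> \<gamma>') \<bullet> \<alpha>' = \<beta>' \<bullet> (\<delta>' \<star> id2 K g)"
  shows "(id2 K e \<star> (\<gamma>' \<star> \<gamma>)) \<bullet> ((\<alpha>' \<star> id2 K h) \<bullet> (id2 K k' \<star> \<alpha>))
    = (\<beta>' \<star> id2 K m) \<bullet> (id2 K n' \<star> \<beta>) \<bullet> (\<delta>' \<star> \<delta> \<star> id2 K f)"
proof -
  note c = comp1_hom comp1_assoc
  have m: "m \<in> hom1 K x x'" "m' \<in> hom1 K x' x''" and n: "n \<in> hom1 K y y'" "n' \<in> hom1 K y' y''"
    using homs cells hom2_parallel by blast+
  have comps: "k \<cdot> f \<in> hom1 K x y'" "g \<cdot> h \<in> hom1 K x y'" "k' \<cdot> g \<in> hom1 K x' y''"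
    "e \<cdot> h' \<in> hom1 K x' y''" "n \<cdot> f \<in> hom1 K x y'" "h' \<cdot> h \<in> hom1 K x x''" "k' \<cdot> k \<in> hom1 K y y''"
    "g \<cdot> m \<in> hom1 K x y'" "n' \<cdot> g \<in> hom1 K x' y''"
    using homs m n c by metis+
  have e\<gamma>': "id2 K e \<star> \<gamma>' \<in> hom2 K (e \<cdot> h') (e \<cdot> m')"
    using whisker_left_hom[OF homs(3,5) cells(2)] .
  have \<delta>'g: "\<delta>' \<star> id2 K g \<in> hom2 K (k' \<cdot> g) (n' \<cdot> g)"
    using whisker_right_hom[OF homs(2,7) cells(4)] .
  have g\<gamma>: "id2 K g \<star> \<gamma> \<in> hom2 K (g \<cdot> h) (g \<cdot> m)"
    using whisker_left_hom[OF homs(2,4) cells(1)] .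
  have \<delta>f: "\<delta> \<star> id2 K f \<in> hom2 K (k \<cdot> f) (n \<cdot> f)"
    using whisker_right_hom[OF homs(1,6) cells(3)] .
  have \<alpha>'h: "\<alpha>' \<star> id2 K h \<in> hom2 K (k' \<cdot> g \<cdot> h) (e \<cdot> h' \<cdot> h)"
    using whisker_right_hom[OF homs(4) comps(3) cells(7)] .
  have k'\<alpha>: "id2 K k' \<star> \<alpha> \<in> hom2 K (k' \<cdot> (k \<cdot> f)) (k' \<cdot> g \<cdot> h)"
    using whisker_left_hom[OF homs(7) comps(1) cells(5)] homs c by metis
  have e\<gamma>'\<gamma>: "id2 K e \<star> \<gamma>' \<star> \<gamma> \<in> hom2 K (e \<cdot> h' \<cdot> h) (e \<cdot> m' \<cdot> m)"
    using hcomp_hom'[OF cells(1) e\<gamma>' homs(4) comps(4)] .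
  have "id2 K e \<star> (\<gamma>' \<star> \<gamma>) = id2 K e \<star> \<gamma>' \<star> \<gamma>"
    using hcomp_assoc'[OF cells(1,2) id2_hom' homs(4,5,3)] homs by blast
  then have "(id2 K e \<star> (\<gamma>' \<star> \<gamma>)) \<bullet> ((\<alpha>' \<star> id2 K h) \<bullet> (id2 K k' \<star> \<alpha>))
      = (id2 K e \<star> \<gamma>' \<star> \<gamma>) \<bullet> (\<alpha>' \<star> id2 K h) \<bullet> (id2 K k' \<star> \<alpha>)"
    using vcomp_assoc[OF k'\<alpha> \<alpha>'h e\<gamma>'\<gamma>] by simp
  also have "(id2 K e \<star> \<gamma>' \<star> \<gamma>) \<bullet> (\<alpha>' \<star> id2 K h) = ((id2 K e \<star> \<gamma>') \<bullet> \<alpha>') \<star> \<gamma>"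
    using interchange'[OF id2_hom' cells(1) cells(7) e\<gamma>' homs(4) comps(3)]
      vcomp_id_right[OF cells(1)] homs by simp
  also have "\<dots> = (\<beta>' \<bullet> (\<delta>' \<star> id2 K g)) \<star> \<gamma>" by (simp add: eq')
  \<comment> \<open>Interchange in the opposite direction: \<beta>' takes \<open>id2 K m\<close>,
    and \<gamma> goes with \<delta>', which frees \<open>id2 K g \<star> \<gamma>\<close> for
    \<open>eq\<close>.\<close>
  also have "\<dots> = (\<beta>' \<star> id2 K m) \<bullet> (\<delta>' \<star> id2 K g \<star> \<gamma>)"
    using interchange'[OF cells(1) id2_hom' \<delta>'g cells(8) homs(4) comps(3)]
      vcomp_id_left[OF cells(1)] m by simp
  also have "\<delta>' \<star> id2 K g \<star> \<gamma> = \<delta>' \<star> (id2 K g \<star> \<gamma>)"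
    using hcomp_assoc'[OF cells(1) id2_hom' cells(4) homs(4,2,7)] homs by simp
  also have "(\<beta>' \<star> id2 K m) \<bullet> (\<delta>' \<star> (id2 K g \<star> \<gamma>)) \<bullet> (id2 K k' \<star> \<alpha>)
      = (\<beta>' \<star> id2 K m) \<bullet> ((\<delta>' \<star> (id2 K g \<star> \<gamma>)) \<bullet> (id2 K k' \<star> \<alpha>))"
  proof -
    have "\<beta>' \<star> id2 K m \<in> hom2 K (n' \<cdot> (g \<cdot> m)) (e \<cdot> m' \<cdot> m)"
      using whisker_right_hom[OF m(1) comps(9) cells(8)] homs m n c by metis
    moreover have "\<delta>' \<star> (id2 K g \<star> \<gamma>) \<in> hom2 K (k' \<cdot> g \<cdot> h) (n' \<cdot> (g \<cdot> m))"
      using hcomp_hom'[OF g\<gamma> cells(4) comps(2) homs(7)] homs c by metis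
    ultimately show ?thesis using vcomp_assoc[OF k'\<alpha>] by simp
  qed
  also have "(\<delta>' \<star> (id2 K g \<star> \<gamma>)) \<bullet> (id2 K k' \<star> \<alpha>) = \<delta>' \<star> ((id2 K g \<star> \<gamma>) \<bullet> \<alpha>)"
    using interchange'[OF cells(5) g\<gamma> id2_hom' cells(4) comps(1) homs(7)]
      vcomp_id_right[OF cells(4)] homs by simp
  also have "\<dots> = \<delta>' \<star> (\<beta> \<bullet> (\<delta> \<star> id2 K f))" unfolding eq ..
  also have "\<dots> = (id2 K n' \<star> \<beta>) \<bullet> (\<delta>' \<star> (\<delta> \<star> id2 K f))"
    using interchange'[OF \<delta>f cells(6) cells(4) id2_hom' comps(1) homs(7)]
      vcomp_id_left[OF cells(4)] n by simp
  also have "\<delta>' \<star> (\<delta> \<star> id2 K f) = \<delta>' \<star> \<delta> \<star> id2 K f"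
    using hcomp_assoc'[OF id2_hom' cells(3,4) homs(1,6,7)] homs by simp
  finally have "(id2 K e \<star> (\<gamma>' \<star> \<gamma>)) \<bullet> ((\<alpha>' \<star> id2 K h) \<bullet> (id2 K k' \<star> \<alpha>))
    = (\<beta>' \<star> id2 K m) \<bullet> ((id2 K n' \<star> \<beta>) \<bullet> (\<delta>' \<star> \<delta> \<star> id2 K f))" .
  moreover have "\<delta>' \<star> \<delta> \<star> id2 K f \<in> hom2 K (k' \<cdot> k \<cdot> f) (n' \<cdot> n \<cdot> f)"
    using whisker_right_hom[OF homs(1) comps(7)] hcomp_hom'[OF cells(3,4) homs(6,7)] by simp
  moreover have "id2 K n' \<star> \<beta> \<in> hom2 K (n' \<cdot> n \<cdot> f) (n' \<cdot> (g \<cdot> m))"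
    using whisker_left_hom[OF n(2) comps(5) cells(6)] homs m n c by metis
  moreover have "\<beta>' \<star> id2 K m \<in> hom2 K (n' \<cdot> (g \<cdot> m)) (e \<cdot> m' \<cdot> m)"
    using whisker_right_hom[OF m(1) comps(9) cells(8)] homs m n c by metis
  ultimately show ?thesis using vcomp_assoc by simp
qed

end

section \<open>Composition of 2-functors\<close>

context two_functor
begin

lemma fun0_obj: "x \<in> obj K \<Longrightarrow> fun0 F x \<in> obj L"
  using fun0_maps by auto

lemma fun1_arr: "f \<in> arr K \<Longrightarrow> fun1 F f \<in> arr L"
  using fun1_maps by auto

lemma fun2_cell: "\<sigma> \<in> cell K \<Longrightarrow> fun2 F \<sigma> \<in> cell L"
  using fun2_maps by auto

end

lemma two_functor_eqI:
  assumes "two_functor K L F" "two_functor K L F'"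
    and "\<And>x. x \<in> obj K \<Longrightarrow> fun0 F x = fun0 F' x"
    and "\<And>f. f \<in> arr K \<Longrightarrow> fun1 F f = fun1 F' f"
    and "\<And>\<sigma>. \<sigma> \<in> cell K \<Longrightarrow> fun2 F \<sigma> = fun2 F' \<sigma>"
  shows "F = F'"
proof -
  interpret F: two_functor K L F by fact
  interpret F': two_functor K L F' by fact
  have "fun0 F = fun0 F'" "fun1 F = fun1 F'" "fun2 F = fun2 F'"
    using PiE_ext[OF F.fun0_maps F'.fun0_maps] PiE_ext[OF F.fun1_maps F'.fun1_maps]
      PiE_ext[OF F.fun2_maps F'.fun2_maps] assms(3-5) by blast+
  then show ?thesis by simp
qed

lemma fun_comp_simps [simp]:
  "x \<in> obj D \<Longrightarrow> fun0 (fun_comp D G F) x = fun0 G (fun0 F x)"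
  "f \<in> arr D \<Longrightarrow> fun1 (fun_comp D G F) f = fun1 G (fun1 F f)"
  "\<sigma> \<in> cell D \<Longrightarrow> fun2 (fun_comp D G F) \<sigma> = fun2 G (fun2 F \<sigma>)"
  by (simp_all add: fun_comp_def compose_def)

lemma lax_fun_simps [simp]:
  "x \<in> obj D \<Longrightarrow> component (lax_fun D \<alpha> U) x = component \<alpha> (fun0 U x)"
  "f \<in> arr D \<Longrightarrow> laxity (lax_fun D \<alpha> U) f = laxity \<alpha> (fun1 U f)"
  by (simp_all add: lax_fun_def compose_def)

lemma fun_lax_simps [simp]:
  "x \<in> obj D \<Longrightarrow> component (fun_lax D H \<alpha>) x = fun1 H (component \<alpha> x)"
  "f \<in> arr D \<Longrightarrow> laxity (fun_lax D H \<alpha>) f = fun2 H (laxity \<alpha> f)"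
  by (simp_all add: fun_lax_def compose_def)

lemma two_functor_fun_comp:
  assumes "two_functor K L F" "two_functor L M G"
  shows "two_functor K M (fun_comp K G F)"
proof -
  interpret F: two_functor K L F by fact
  interpret G: two_functor L M G by fact
  have ext: "fun0 (fun_comp K G F) \<in> obj K \<rightarrow>\<^sub>E obj M" "fun1 (fun_comp K G F) \<in> arr K \<rightarrow>\<^sub>E arr M"
    "fun2 (fun_comp K G F) \<in> cell K \<rightarrow>\<^sub>E cell M"
    by (auto simp: fun_comp_def compose_def F.fun0_obj F.fun1_arr F.fun2_cell
        G.fun0_obj G.fun1_arr G.fun2_cell)
  have 0: "x \<in> obj K" "y \<in> obj K" "f \<in> arr K" if "f \<in> hom1 K x y" for f x y
    using that F.source.hom1_obj by (auto simp: hom1_def)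
  have 2: "f \<in> arr K" "g \<in> arr K" "\<sigma> \<in> cell K" if "\<sigma> \<in> hom2 K f g" for f g \<sigma>
    using that F.source.hom2_arr by (auto simp: hom2_def)
  have 3: "cod1 L (fun1 F f) = fun0 F (cod1 K f)" "dom1 L (fun1 F f) = fun0 F (dom1 K f)"
    if "f \<in> arr K" for f
    using F.fun1_hom[of f "dom1 K f" "cod1 K f"] that by (auto simp: hom1_def)
  show ?thesis
  proof (unfold_locales, goal_cases)
    case (4 f x y)
    then show ?case using 0 F.fun1_hom G.fun1_hom by simp
  next
    case (5 \<sigma> f g)
    then show ?case using 2 F.fun2_hom G.fun2_hom by simp
  next
    case (6 x)
    then show ?case using 0[OF F.source.id1_hom[OF 6]] F.fun_id1 G.fun_id1 F.fun0_obj by simp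
  next
    case (7 f x y g z)
    then show ?case
      using 0[OF F.source.comp1_hom[OF 7]] 0[OF 7(1)] 0[OF 7(2)]
        F.fun_comp1[OF 7] G.fun_comp1[OF F.fun1_hom[OF 7(1)] F.fun1_hom[OF 7(2)]] by simp
  next
    case (8 f)
    then show ?case using 2[OF F.source.id2_hom[OF 8]] F.fun_id2 G.fun_id2 F.fun1_arr by simp
  next
    case (9 \<sigma> f g \<tau> h)
    then show ?case
      using 2[OF F.source.vcomp_hom[OF 9]] 2[OF 9(1)] 2[OF 9(2)]
        F.fun_vcomp[OF 9] G.fun_vcomp[OF F.fun2_hom[OF 9(1)] F.fun2_hom[OF 9(2)]] by simp
  next
    case (10 \<sigma> f f' \<tau> g g')
    have "cod1 L (fun1 F f) = dom1 L (fun1 F g)" using 10(3) 2[OF 10(1)] 2[OF 10(2)] 3 by simp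
    then show ?case
      using 2[OF F.source.hcomp_hom[OF 10]] 2[OF 10(1)] 2[OF 10(2)]
        F.fun_hcomp[OF 10] G.fun_hcomp[OF F.fun2_hom[OF 10(1)] F.fun2_hom[OF 10(2)]] by simp
  qed (use ext in auto)
qed

text \<open>Both sides are restricted to the carriers of \<open>D\<close>; since \<open>F\<close>
  maps these into the carriers of \<open>K\<close>, the inner restriction to \<open>K\<close> has no
  effect there.\<close>

lemma fun_comp_assoc:
  assumes "two_functor D K F"
  shows "fun_comp D (fun_comp K H G) F = fun_comp D H (fun_comp D G F)"
proof -
  interpret F: two_functor D K F by fact
  show ?thesis
    using F.fun0_obj F.fun1_arr F.fun2_cell
    by (auto simp: fun_comp_def compose_def intro!: restrict_ext)
qed

lemma lax_fun_fun_comp: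
  assumes "two_functor D K F"
  shows "lax_fun D (lax_fun K \<mu> G) F = lax_fun D \<mu> (fun_comp D G F)"
proof -
  interpret F: two_functor D K F by fact
  show ?thesis
    using F.fun0_obj F.fun1_arr
    by (auto simp: fun_comp_def lax_fun_def compose_def intro!: restrict_ext)
qed

lemma two_functor_fun_id:
  assumes "two_category K"
  shows "two_functor K K (fun_id K)"
proof -
  interpret two_category K by fact
  show ?thesis
  proof (unfold_locales, goal_cases)
    case (4 f x y)
    then show ?case using hom1_obj[OF 4] by (auto simp: fun_id_def hom1_def)
  next
    case (5 \<sigma> f g)
    then show ?case by (simp add: fun_id_def hom2_arr hom2_def dom2_arr cod2_arr)
  next
    case (6 x)
    then show ?case using id1_hom[OF 6] by (simp add: fun_id_def hom1_def)
  next
    case (7 f x y g z)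
    then show ?case using comp1_hom[OF 7] by (simp add: fun_id_def hom1_def)
  next
    case (8 f)
    then show ?case using id2_hom[OF 8] by (simp add: fun_id_def hom2_def)
  next
    case (9 \<sigma> f g \<tau> h)
    then show ?case using vcomp_hom[OF 9] by (simp add: fun_id_def hom2_def)
  next
    case (10 \<sigma> f f' \<tau> g g')
    then show ?case using hcomp_hom[OF 10] by (simp add: fun_id_def hom2_def)
  qed (auto simp: fun_id_def)
qed

lemma fun_comp_id_right:
  assumes "two_functor K L F"
  shows "fun_comp K F (fun_id K) = F"
proof -
  interpret two_functor K L F by fact
  show ?thesis
    using two_functor_fun_comp[OF two_functor_fun_id[OF source.two_category_axioms] assms] assms
    by (rule two_functor_eqI) (auto simp: fun_id_def)
qed

lemma lax_fun_id:
  assumes "lax_transformation K L F G \<mu>"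
  shows "lax_fun K \<mu> (fun_id K) = \<mu>"
proof -
  interpret lax_transformation K L F G \<mu> by fact
  have "component (lax_fun K \<mu> (fun_id K)) = component \<mu>"
    "laxity (lax_fun K \<mu> (fun_id K)) = laxity \<mu>"
    using component_ext laxity_ext
    by (auto simp: lax_fun_def fun_id_def compose_def restrict_def extensional_def)
  then show ?thesis by simp
qed

section \<open>The lax comma 2-category\<close>

locale comma_base = F: two_functor A B F + G: two_functor C B G
  for A :: "('a0, 'a1, 'a2) two_cat" and B :: "('b0, 'b1, 'b2) two_cat"
    and C :: "('c0, 'c1, 'c2) two_cat"
    and F :: "('a0, 'a1, 'a2, 'b0, 'b1, 'b2) two_fun"
    and G :: "('c0, 'c1, 'c2, 'b0, 'b1, 'b2) two_fun"
begin

abbreviation "FG \<equiv> lax_comma A B C F G"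
abbreviation "src \<equiv> comma_src A B C F G"
abbreviation "tgt \<equiv> comma_tgt A B C F G"
abbreviation "lam \<equiv> comma_lambda A B C F G"

section \<open>Unfolding the tuples, and closure of the hom-sets of the comma\<close>

lemma comma_dom_cod [simp]:
  "dom1 FG (X, t, Y) = X" "cod1 FG (X, t, Y) = Y"
  "dom2 FG (p, u, q) = p" "cod2 FG (p, u, q) = q"
  by (simp_all add: lax_comma_def)

lemma comma_ops [simp]:
  "id1 FG (a, f, c) = ((a, f, c), (id1 A a, id1 C c, id2 B f), (a, f, c))"
  "(Y', (h', k', \<beta>), Z) \<cdot>\<^bsub>FG\<^esub> (X, (h, k, \<alpha>), Y) =
    (X, (h' \<cdot>\<^bsub>A\<^esub> h, k' \<cdot>\<^bsub>C\<^esub> k,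
      (\<beta> \<star>\<^bsub>B\<^esub> id2 B (fun1 F h)) \<bullet>\<^bsub>B\<^esub> (id2 B (fun1 G k') \<star>\<^bsub>B\<^esub> \<alpha>)), Z)"
  "id2 FG (X, (h, k, \<alpha>), Y) = ((X, (h, k, \<alpha>), Y), (id2 A h, id2 C k), (X, (h, k, \<alpha>), Y))"
  "(q', (\<gamma>', \<delta>'), r) \<bullet>\<^bsub>FG\<^esub> (p, (\<gamma>, \<delta>), q) = (p, (\<gamma>' \<bullet>\<^bsub>A\<^esub> \<gamma>, \<delta>' \<bullet>\<^bsub>C\<^esub> \<delta>), r)"
  by (simp_all add: lax_comma_def comma_comp_def)

lemma comma_hcomp [simp]:
  "(p', (\<gamma>', \<delta>'), q') \<star>\<^bsub>FG\<^esub> (p, (\<gamma>, \<delta>), q) =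
    (p' \<cdot>\<^bsub>FG\<^esub> p, (\<gamma>' \<star>\<^bsub>A\<^esub> \<gamma>, \<delta>' \<star>\<^bsub>C\<^esub> \<delta>), q' \<cdot>\<^bsub>FG\<^esub> q)"
  by (simp add: lax_comma_def)

lemma comma_carriers:
  "obj FG = comma_objects A B C F G" "arr FG = comma_arrows A B C F G"
  "cell FG = comma_cells A B C F G"
  by (simp_all add: lax_comma_def)

lemma comma_obj_iff:
  "(a, f, c) \<in> obj FG \<longleftrightarrow> a \<in> obj A \<and> c \<in> obj C \<and> f \<in> hom1 B (fun0 F a) (fun0 G c)"
  by (simp add: comma_carriers comma_objects_def)

text \<open>The types of \<open>h\<close> and \<open>k\<close> already force \<open>a\<close>,
  \<open>b\<close> into \<open>obj A\<close> and \<open>c\<close>, \<open>d\<close> into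
  \<open>obj C\<close>, which leaves from the two end objects only the types of \<open>f\<close> and
  \<open>g\<close>.\<close>

lemma comma_hom1_iff:
  "p \<in> hom1 FG (a, f, c) (b, g, d) \<longleftrightarrow>
    (\<exists>h k \<alpha>. p = ((a, f, c), (h, k, \<alpha>), (b, g, d)) \<and>
      f \<in> hom1 B (fun0 F a) (fun0 G c) \<and> g \<in> hom1 B (fun0 F b) (fun0 G d) \<and>
      h \<in> hom1 A a b \<and> k \<in> hom1 C c d \<and>
      \<alpha> \<in> hom2 B (fun1 G k \<cdot>\<^bsub>B\<^esub> f) (g \<cdot>\<^bsub>B\<^esub> fun1 F h))"
  using F.source.hom1_obj G.source.hom1_obj
  by (cases p) (auto simp: hom1_def[of FG] comma_carriers comma_arrows_def comma_objects_def)

text \<open>\<open>fst (snd X)\<close> is the 1-cell of \<open>B\<close> in the object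
  \<open>X\<close>. Parallelism of the end arrows is built into the 2-cells of the comma and comes
  out as equality of the stored end objects.\<close>

lemma comma_hom2_iff:
  "\<sigma> \<in> hom2 FG (X, (h, k, \<alpha>), Y) (X', (m, n, \<beta>), Y') \<longleftrightarrow> X' = X \<and> Y' = Y \<and>
    (X, (h, k, \<alpha>), Y) \<in> hom1 FG X Y \<and> (X, (m, n, \<beta>), Y) \<in> hom1 FG X Y \<and>
    (\<exists>\<gamma> \<delta>. \<sigma> = ((X, (h, k, \<alpha>), Y), (\<gamma>, \<delta>), (X, (m, n, \<beta>), Y)) \<and>
      \<gamma> \<in> hom2 A h m \<and> \<delta> \<in> hom2 C k n \<and>
      (id2 B (fst (snd Y)) \<star>\<^bsub>B\<^esub> fun2 F \<gamma>) \<bullet>\<^bsub>B\<^esub> \<alpha> =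
        \<beta> \<bullet>\<^bsub>B\<^esub> (fun2 G \<delta> \<star>\<^bsub>B\<^esub> id2 B (fst (snd X))))"
  by (cases \<sigma>; cases X; cases Y)
    (auto simp: hom2_def[of FG] hom1_def[of FG] comma_carriers comma_cells_def comma_arrows_def)

lemma comma_hom1E:
  assumes "p \<in> hom1 FG X Y"
  obtains a f c b g d h k \<alpha> where "X = (a, f, c)" "Y = (b, g, d)" "p = (X, (h, k, \<alpha>), Y)"
    "f \<in> hom1 B (fun0 F a) (fun0 G c)" "g \<in> hom1 B (fun0 F b) (fun0 G d)"
    "h \<in> hom1 A a b" "k \<in> hom1 C c d" "\<alpha> \<in> hom2 B (fun1 G k \<cdot>\<^bsub>B\<^esub> f) (g \<cdot>\<^bsub>B\<^esub> fun1 F h)"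
  using assms by (cases X; cases Y) (auto simp: comma_hom1_iff)

lemma comma_hom2E:
  assumes "\<sigma> \<in> hom2 FG p q"
  obtains a f c b g d h k \<alpha> m n \<beta> \<gamma> \<delta> where
    "p = ((a, f, c), (h, k, \<alpha>), (b, g, d))" "q = ((a, f, c), (m, n, \<beta>), (b, g, d))"
    "\<sigma> = (p, (\<gamma>, \<delta>), q)"
    "f \<in> hom1 B (fun0 F a) (fun0 G c)" "g \<in> hom1 B (fun0 F b) (fun0 G d)"
    "h \<in> hom1 A a b" "k \<in> hom1 C c d" "\<alpha> \<in> hom2 B (fun1 G k \<cdot>\<^bsub>B\<^esub> f) (g \<cdot>\<^bsub>B\<^esub> fun1 F h)"
    "m \<in> hom1 A a b" "n \<in> hom1 C c d" "\<beta> \<in> hom2 B (fun1 G n \<cdot>\<^bsub>B\<^esub> f) (g \<cdot>\<^bsub>B\<^esub> fun1 F m)"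
    "\<gamma> \<in> hom2 A h m" "\<delta> \<in> hom2 C k n"
    "(id2 B g \<star>\<^bsub>B\<^esub> fun2 F \<gamma>) \<bullet>\<^bsub>B\<^esub> \<alpha> = \<beta> \<bullet>\<^bsub>B\<^esub> (fun2 G \<delta> \<star>\<^bsub>B\<^esub> id2 B f)"
  using assms by (cases p; cases q) (auto simp: comma_hom2_iff comma_hom1_iff)

lemma comma_hom2I:
  assumes "((a, f, c), (h, k, \<alpha>), (b, g, d)) \<in> hom1 FG (a, f, c) (b, g, d)"
    and "((a, f, c), (m, n, \<beta>), (b, g, d)) \<in> hom1 FG (a, f, c) (b, g, d)"
    and "\<gamma> \<in> hom2 A h m" "\<delta> \<in> hom2 C k n"
    and "(id2 B g \<star>\<^bsub>B\<^esub> fun2 F \<gamma>) \<bullet>\<^bsub>B\<^esub> \<alpha> = \<beta> \<bullet>\<^bsub>B\<^esub> (fun2 G \<delta> \<star>\<^bsub>B\<^esub> id2 B f)"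
  shows "(((a, f, c), (h, k, \<alpha>), (b, g, d)), (\<gamma>, \<delta>), ((a, f, c), (m, n, \<beta>), (b, g, d)))
    \<in> hom2 FG ((a, f, c), (h, k, \<alpha>), (b, g, d)) ((a, f, c), (m, n, \<beta>), (b, g, d))"
  using assms by (auto simp: comma_hom2_iff)

lemma comma_arr_hom1:
  assumes "p \<in> arr FG"
  shows "p \<in> hom1 FG (dom1 FG p) (cod1 FG p)"
  using assms by (simp add: hom1_def)

lemma comma_hom1_obj:
  assumes "p \<in> hom1 FG X Y"
  shows "X \<in> obj FG" "Y \<in> obj FG"
  using assms F.source.hom1_obj G.source.hom1_obj
  by (auto elim!: comma_hom1E simp: comma_obj_iff)

lemma comma_id1_hom: "X \<in> obj FG \<Longrightarrow> id1 FG X \<in> hom1 FG X X"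
proof (cases X)
  case (fields a f c)
  assume "X \<in> obj FG"
  then have *: "a \<in> obj A" "c \<in> obj C" "f \<in> hom1 B (fun0 F a) (fun0 G c)"
    by (auto simp: fields comma_obj_iff)
  have "id2 B f \<in> hom2 B f f" using F.target.id2_hom' *(3) .
  \<comment> \<open>Strict preservation of identities by \<open>F\<close> and \<open>G\<close> is
    what gives \<open>id2 B f\<close> the endpoints of a lax square.\<close>
  then have "id2 B f \<in> hom2 B (fun1 G (id1 C c) \<cdot>\<^bsub>B\<^esub> f) (f \<cdot>\<^bsub>B\<^esub> fun1 F (id1 A a))"
    using * F.fun_id1 G.fun_id1 F.target.comp1_id_left F.target.comp1_id_right by metis
  with * show ?thesis
    using F.source.id1_hom G.source.id1_hom by (simp add: fields comma_hom1_iff)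
qed

lemma comma_comp_hom:
  assumes "p \<in> hom1 FG X Y" "q \<in> hom1 FG Y Z"
  shows "q \<cdot>\<^bsub>FG\<^esub> p \<in> hom1 FG X Z"
  using assms(1)
proof (cases rule: comma_hom1E)
  case 1: (1 a f c b g d h k \<alpha>)
  from assms(2) show ?thesis
  proof (cases rule: comma_hom1E)
    case 2: (1 b' g' d' e r i h' k' \<beta>)
    have eqs: "b' = b" "g' = g" "d' = d" using 1(2) 2(1) by auto
    note 2 = 2[unfolded eqs]
    have "(\<beta> \<star>\<^bsub>B\<^esub> id2 B (fun1 F h)) \<bullet>\<^bsub>B\<^esub> (id2 B (fun1 G k') \<star>\<^bsub>B\<^esub> \<alpha>)
        \<in> hom2 B (fun1 G k' \<cdot>\<^bsub>B\<^esub> fun1 G k \<cdot>\<^bsub>B\<^esub> f) (r \<cdot>\<^bsub>B\<^esub> (fun1 F h' \<cdot>\<^bsub>B\<^esub> fun1 F h))"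
      by (rule F.target.paste_hom[OF 1(4,5) 2(5) F.fun1_hom F.fun1_hom G.fun1_hom G.fun1_hom
            1(8) 2(8)]) (use 1 2 in blast)+
    \<comment> \<open>Strict preservation of composites turns the boundary of the pasting into the
      one prescribed for an arrow over the composites in \<open>A\<close> and
      \<open>C\<close>.\<close>
    moreover have "fun1 G k' \<cdot>\<^bsub>B\<^esub> fun1 G k = fun1 G (k' \<cdot>\<^bsub>C\<^esub> k)"
      "fun1 F h' \<cdot>\<^bsub>B\<^esub> fun1 F h = fun1 F (h' \<cdot>\<^bsub>A\<^esub> h)"
      using F.fun_comp1 G.fun_comp1 1 2 by metis+
    moreover have "h' \<cdot>\<^bsub>A\<^esub> h \<in> hom1 A a e" "k' \<cdot>\<^bsub>C\<^esub> k \<in> hom1 C c i"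
      using F.source.comp1_hom G.source.comp1_hom 1 2 by blast+
    ultimately show ?thesis using 1 2 by (simp add: comma_hom1_iff)
  qed
qed

lemma comma_comp_assoc:
  assumes "p \<in> hom1 FG X Y" "q \<in> hom1 FG Y Z" "r \<in> hom1 FG Z W"
  shows "r \<cdot>\<^bsub>FG\<^esub> (q \<cdot>\<^bsub>FG\<^esub> p) = r \<cdot>\<^bsub>FG\<^esub> q \<cdot>\<^bsub>FG\<^esub> p"
proof -
  obtain a f c b g d h k \<alpha> where p: "X = (a, f, c)" "Y = (b, g, d)" "p = (X, (h, k, \<alpha>), Y)"
    "f \<in> hom1 B (fun0 F a) (fun0 G c)" "g \<in> hom1 B (fun0 F b) (fun0 G d)"
    "h \<in> hom1 A a b" "k \<in> hom1 C c d" "\<alpha> \<in> hom2 B (fun1 G k \<cdot>\<^bsub>B\<^esub> f) (g \<cdot>\<^bsub>B\<^esub> fun1 F h)"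
    using assms(1) by (rule comma_hom1E)
  obtain a' e c' h' k' \<beta> where q: "Z = (a', e, c')" "q = (Y, (h', k', \<beta>), Z)"
    "e \<in> hom1 B (fun0 F a') (fun0 G c')"
    "h' \<in> hom1 A b a'" "k' \<in> hom1 C d c'" "\<beta> \<in> hom2 B (fun1 G k' \<cdot>\<^bsub>B\<^esub> g) (e \<cdot>\<^bsub>B\<^esub> fun1 F h')"
    using assms(2) p(2) by (auto elim: comma_hom1E)
  obtain b' i d' h'' k'' \<gamma> where r: "W = (b', i, d')" "r = (Z, (h'', k'', \<gamma>), W)"
    "i \<in> hom1 B (fun0 F b') (fun0 G d')"
    "h'' \<in> hom1 A a' b'" "k'' \<in> hom1 C c' d'"
    "\<gamma> \<in> hom2 B (fun1 G k'' \<cdot>\<^bsub>B\<^esub> e) (i \<cdot>\<^bsub>B\<^esub> fun1 F h'')"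
    using assms(3) q(1) by (auto elim: comma_hom1E)
  note h = p(6) q(4) r(4) note k = p(7) q(5) r(5)
  have "h'' \<cdot>\<^bsub>A\<^esub> (h' \<cdot>\<^bsub>A\<^esub> h) = h'' \<cdot>\<^bsub>A\<^esub> h' \<cdot>\<^bsub>A\<^esub> h"
    "k'' \<cdot>\<^bsub>C\<^esub> (k' \<cdot>\<^bsub>C\<^esub> k) = k'' \<cdot>\<^bsub>C\<^esub> k' \<cdot>\<^bsub>C\<^esub> k"
    using F.source.comp1_assoc[OF h] G.source.comp1_assoc[OF k] .
  moreover have "fun1 F (h' \<cdot>\<^bsub>A\<^esub> h) = fun1 F h' \<cdot>\<^bsub>B\<^esub> fun1 F h"
    "fun1 G (k'' \<cdot>\<^bsub>C\<^esub> k') = fun1 G k'' \<cdot>\<^bsub>B\<^esub> fun1 G k'"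
    using F.fun_comp1[OF h(1,2)] G.fun_comp1[OF k(2,3)] .
  ultimately show ?thesis
    using F.target.paste_assoc[OF p(4,5) q(3) r(3) h[THEN F.fun1_hom] k[THEN G.fun1_hom]
        p(8) q(6) r(6)]
    by (simp add: p(3) q(2) r(2))
qed

lemma comma_comp_id:
  assumes "p \<in> hom1 FG X Y"
  shows "id1 FG Y \<cdot>\<^bsub>FG\<^esub> p = p" "p \<cdot>\<^bsub>FG\<^esub> id1 FG X = p"
proof -
  obtain a f c b g d h k \<alpha> where p: "X = (a, f, c)" "Y = (b, g, d)" "p = (X, (h, k, \<alpha>), Y)"
    "f \<in> hom1 B (fun0 F a) (fun0 G c)" "g \<in> hom1 B (fun0 F b) (fun0 G d)"
    "h \<in> hom1 A a b" "k \<in> hom1 C c d" "\<alpha> \<in> hom2 B (fun1 G k \<cdot>\<^bsub>B\<^esub> f) (g \<cdot>\<^bsub>B\<^esub> fun1 F h)"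
    using assms by (rule comma_hom1E)
  note o = F.source.hom1_obj[OF p(6)] G.source.hom1_obj[OF p(7)]
  show "id1 FG Y \<cdot>\<^bsub>FG\<^esub> p = p"
    using F.target.paste_id_left[OF p(4,5) F.fun1_hom[OF p(6)] G.fun1_hom[OF p(7)] p(8)]
      F.source.comp1_id_left[OF p(6)] G.source.comp1_id_left[OF p(7)] G.fun_id1 o
    by (simp add: p(1-3))
  show "p \<cdot>\<^bsub>FG\<^esub> id1 FG X = p"
    using F.target.paste_id_right[OF p(4,5) F.fun1_hom[OF p(6)] G.fun1_hom[OF p(7)] p(8)]
      F.source.comp1_id_right[OF p(6)] G.source.comp1_id_right[OF p(7)] F.fun_id1 o
    by (simp add: p(1-3))
qed

lemma comma_id2_hom:
  assumes "p \<in> hom1 FG X Y"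
  shows "id2 FG p \<in> hom2 FG p p"
proof -
  obtain a f c b g d h k \<alpha> where p: "X = (a, f, c)" "Y = (b, g, d)" "p = (X, (h, k, \<alpha>), Y)"
    "f \<in> hom1 B (fun0 F a) (fun0 G c)" "g \<in> hom1 B (fun0 F b) (fun0 G d)"
    "h \<in> hom1 A a b" "k \<in> hom1 C c d" "\<alpha> \<in> hom2 B (fun1 G k \<cdot>\<^bsub>B\<^esub> f) (g \<cdot>\<^bsub>B\<^esub> fun1 F h)"
    using assms by (rule comma_hom1E)
  have "fun2 F (id2 A h) = id2 B (fun1 F h)" "fun2 G (id2 C k) = id2 B (fun1 G k)"
    using p F.fun_id2 G.fun_id2 by (auto simp: hom1_def)
  then have "(id2 B g \<star>\<^bsub>B\<^esub> fun2 F (id2 A h)) \<bullet>\<^bsub>B\<^esub> \<alpha> = \<alpha> \<bullet>\<^bsub>B\<^esub> (fun2 G (id2 C k) \<star>\<^bsub>B\<^esub> id2 B f)"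
    using F.target.hcomp_id2[OF F.fun1_hom[OF p(6)] p(5)] F.target.vcomp_id_left[OF p(8)]
      F.target.hcomp_id2[OF p(4) G.fun1_hom[OF p(7)]] F.target.vcomp_id_right[OF p(8)]
    by simp
  then show ?thesis
    using assms F.source.id2_hom' G.source.id2_hom' p by (auto intro!: comma_hom2I)
qed

lemma comma_vcomp_hom:
  assumes "\<sigma> \<in> hom2 FG p q" "\<tau> \<in> hom2 FG q r"
  shows "\<tau> \<bullet>\<^bsub>FG\<^esub> \<sigma> \<in> hom2 FG p r"
proof -
  obtain a f c b g d h k \<alpha> m n \<beta> \<gamma> \<delta> where
    p: "p = ((a, f, c), (h, k, \<alpha>), (b, g, d))" "q = ((a, f, c), (m, n, \<beta>), (b, g, d))"
    "\<sigma> = (p, (\<gamma>, \<delta>), q)"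
    "f \<in> hom1 B (fun0 F a) (fun0 G c)" "g \<in> hom1 B (fun0 F b) (fun0 G d)"
    "h \<in> hom1 A a b" "k \<in> hom1 C c d" "\<alpha> \<in> hom2 B (fun1 G k \<cdot>\<^bsub>B\<^esub> f) (g \<cdot>\<^bsub>B\<^esub> fun1 F h)"
    "m \<in> hom1 A a b" "n \<in> hom1 C c d" "\<beta> \<in> hom2 B (fun1 G n \<cdot>\<^bsub>B\<^esub> f) (g \<cdot>\<^bsub>B\<^esub> fun1 F m)"
    "\<gamma> \<in> hom2 A h m" "\<delta> \<in> hom2 C k n"
    "(id2 B g \<star>\<^bsub>B\<^esub> fun2 F \<gamma>) \<bullet>\<^bsub>B\<^esub> \<alpha> = \<beta> \<bullet>\<^bsub>B\<^esub> (fun2 G \<delta> \<star>\<^bsub>B\<^esub> id2 B f)"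
    using assms(1) by (rule comma_hom2E)
  obtain m' n' \<beta>' \<gamma>' \<delta>' where
    q: "r = ((a, f, c), (m', n', \<beta>'), (b, g, d))" "\<tau> = (q, (\<gamma>', \<delta>'), r)"
    "m' \<in> hom1 A a b" "n' \<in> hom1 C c d" "\<beta>' \<in> hom2 B (fun1 G n' \<cdot>\<^bsub>B\<^esub> f) (g \<cdot>\<^bsub>B\<^esub> fun1 F m')"
    "\<gamma>' \<in> hom2 A m m'" "\<delta>' \<in> hom2 C n n'"
    "(id2 B g \<star>\<^bsub>B\<^esub> fun2 F \<gamma>') \<bullet>\<^bsub>B\<^esub> \<beta> = \<beta>' \<bullet>\<^bsub>B\<^esub> (fun2 G \<delta>' \<star>\<^bsub>B\<^esub> id2 B f)"
    using assms(2) p(2) by (auto elim: comma_hom2E)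
  have "(id2 B g \<star>\<^bsub>B\<^esub> fun2 F (\<gamma>' \<bullet>\<^bsub>A\<^esub> \<gamma>)) \<bullet>\<^bsub>B\<^esub> \<alpha>
      = \<beta>' \<bullet>\<^bsub>B\<^esub> (fun2 G (\<delta>' \<bullet>\<^bsub>C\<^esub> \<delta>) \<star>\<^bsub>B\<^esub> id2 B f)"
    using F.target.paste_vcomp[OF p(4,5) F.fun1_hom[OF p(6)] G.fun1_hom[OF p(7)]
        F.fun2_hom[OF p(12)] F.fun2_hom[OF q(6)] G.fun2_hom[OF p(13)] G.fun2_hom[OF q(7)]
        p(8,11) q(5) p(14) q(8)]
      F.fun_vcomp[OF p(12) q(6)] G.fun_vcomp[OF p(13) q(7)] by simp
  then show ?thesis
    using p q F.source.vcomp_hom G.source.vcomp_hom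
    by (auto intro!: comma_hom2I simp: comma_hom1_iff)
qed

lemma comma_hcomp_hom:
  assumes "\<sigma> \<in> hom2 FG p q" "\<tau> \<in> hom2 FG p' q'" "cod1 FG p = dom1 FG p'"
  shows "\<tau> \<star>\<^bsub>FG\<^esub> \<sigma> \<in> hom2 FG (p' \<cdot>\<^bsub>FG\<^esub> p) (q' \<cdot>\<^bsub>FG\<^esub> q)"
proof -
  obtain a f c b g d h k \<alpha> m n \<beta> \<gamma> \<delta> where
    p: "p = ((a, f, c), (h, k, \<alpha>), (b, g, d))" "q = ((a, f, c), (m, n, \<beta>), (b, g, d))"
    "\<sigma> = (p, (\<gamma>, \<delta>), q)"
    "f \<in> hom1 B (fun0 F a) (fun0 G c)" "g \<in> hom1 B (fun0 F b) (fun0 G d)"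
    "h \<in> hom1 A a b" "k \<in> hom1 C c d" "\<alpha> \<in> hom2 B (fun1 G k \<cdot>\<^bsub>B\<^esub> f) (g \<cdot>\<^bsub>B\<^esub> fun1 F h)"
    "m \<in> hom1 A a b" "n \<in> hom1 C c d" "\<beta> \<in> hom2 B (fun1 G n \<cdot>\<^bsub>B\<^esub> f) (g \<cdot>\<^bsub>B\<^esub> fun1 F m)"
    "\<gamma> \<in> hom2 A h m" "\<delta> \<in> hom2 C k n"
    "(id2 B g \<star>\<^bsub>B\<^esub> fun2 F \<gamma>) \<bullet>\<^bsub>B\<^esub> \<alpha> = \<beta> \<bullet>\<^bsub>B\<^esub> (fun2 G \<delta> \<star>\<^bsub>B\<^esub> id2 B f)"
    using assms(1) by (rule comma_hom2E)
  \<comment> \<open>Elimination of \<tau> yields end objects of its own; composability identifies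
    its source object with the target \<open>(b, g, d)\<close> of \<sigma>. The existential packs
    the result without the duplicate names.\<close>
  have "\<exists>b' e d' h' k' \<alpha>' m' n' \<beta>' \<gamma>' \<delta>'.
    p' = ((b, g, d), (h', k', \<alpha>'), (b', e, d')) \<and> q' = ((b, g, d), (m', n', \<beta>'), (b', e, d')) \<and>
    \<tau> = (p', (\<gamma>', \<delta>'), q') \<and> e \<in> hom1 B (fun0 F b') (fun0 G d') \<and>
    h' \<in> hom1 A b b' \<and> k' \<in> hom1 C d d' \<and>
    \<alpha>' \<in> hom2 B (fun1 G k' \<cdot>\<^bsub>B\<^esub> g) (e \<cdot>\<^bsub>B\<^esub> fun1 F h') \<and>
    \<beta>' \<in> hom2 B (fun1 G n' \<cdot>\<^bsub>B\<^esub> g) (e \<cdot>\<^bsub>B\<^esub> fun1 F m') \<and>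
    \<gamma>' \<in> hom2 A h' m' \<and> \<delta>' \<in> hom2 C k' n' \<and>
    (id2 B e \<star>\<^bsub>B\<^esub> fun2 F \<gamma>') \<bullet>\<^bsub>B\<^esub> \<alpha>' = \<beta>' \<bullet>\<^bsub>B\<^esub> (fun2 G \<delta>' \<star>\<^bsub>B\<^esub> id2 B g)"
    using assms(2)
  proof (cases rule: comma_hom2E)
    case (1 a0 f0 c0)
    moreover from 1 p(1) assms(3) have "a0 = b" "f0 = g" "c0 = d" by auto
    ultimately show ?thesis by blast
  qed
  then obtain b' e d' h' k' \<alpha>' m' n' \<beta>' \<gamma>' \<delta>' where
    q: "p' = ((b, g, d), (h', k', \<alpha>'), (b', e, d'))" "q' = ((b, g, d), (m', n', \<beta>'), (b', e, d'))"
    "\<tau> = (p', (\<gamma>', \<delta>'), q')" "e \<in> hom1 B (fun0 F b') (fun0 G d')"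
    "h' \<in> hom1 A b b'" "k' \<in> hom1 C d d'"
    "\<alpha>' \<in> hom2 B (fun1 G k' \<cdot>\<^bsub>B\<^esub> g) (e \<cdot>\<^bsub>B\<^esub> fun1 F h')"
    "\<beta>' \<in> hom2 B (fun1 G n' \<cdot>\<^bsub>B\<^esub> g) (e \<cdot>\<^bsub>B\<^esub> fun1 F m')"
    "\<gamma>' \<in> hom2 A h' m'" "\<delta>' \<in> hom2 C k' n'"
    "(id2 B e \<star>\<^bsub>B\<^esub> fun2 F \<gamma>') \<bullet>\<^bsub>B\<^esub> \<alpha>' = \<beta>' \<bullet>\<^bsub>B\<^esub> (fun2 G \<delta>' \<star>\<^bsub>B\<^esub> id2 B g)"
    by blast
  have mn': "m' \<in> hom1 A b b'" "n' \<in> hom1 C d d'"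
    using q F.source.hom2_parallel G.source.hom2_parallel by blast+
  have homs: "p \<in> hom1 FG (a, f, c) (b, g, d)" "q \<in> hom1 FG (a, f, c) (b, g, d)"
    "p' \<in> hom1 FG (b, g, d) (b', e, d')" "q' \<in> hom1 FG (b, g, d) (b', e, d')"
    using p q mn' by (simp_all add: comma_hom1_iff)
  have "(id2 B e \<star>\<^bsub>B\<^esub> fun2 F (\<gamma>' \<star>\<^bsub>A\<^esub> \<gamma>)) \<bullet>\<^bsub>B\<^esub>
      ((\<alpha>' \<star>\<^bsub>B\<^esub> id2 B (fun1 F h)) \<bullet>\<^bsub>B\<^esub> (id2 B (fun1 G k') \<star>\<^bsub>B\<^esub> \<alpha>))
    = (\<beta>' \<star>\<^bsub>B\<^esub> id2 B (fun1 F m)) \<bullet>\<^bsub>B\<^esub> (id2 B (fun1 G n') \<star>\<^bsub>B\<^esub> \<beta>)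
      \<bullet>\<^bsub>B\<^esub> (fun2 G (\<delta>' \<star>\<^bsub>C\<^esub> \<delta>) \<star>\<^bsub>B\<^esub> id2 B f)"
  proof -
    have "fun2 F (\<gamma>' \<star>\<^bsub>A\<^esub> \<gamma>) = fun2 F \<gamma>' \<star>\<^bsub>B\<^esub> fun2 F \<gamma>"
      "fun2 G (\<delta>' \<star>\<^bsub>C\<^esub> \<delta>) = fun2 G \<delta>' \<star>\<^bsub>B\<^esub> fun2 G \<delta>"
      using F.fun_hcomp[OF p(12) q(9)] G.fun_hcomp[OF p(13) q(10)] p q by (auto simp: hom1_def)
    then show ?thesis
      using F.target.paste_hcomp[OF p(4,5) q(4) F.fun1_hom[OF p(6)] F.fun1_hom[OF q(5)]
          G.fun1_hom[OF p(7)] G.fun1_hom[OF q(6)] F.fun2_hom[OF p(12)] F.fun2_hom[OF q(9)]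
          G.fun2_hom[OF p(13)] G.fun2_hom[OF q(10)] p(8,11) q(7,8) p(14) q(11)] by simp
  qed
  moreover have "\<gamma>' \<star>\<^bsub>A\<^esub> \<gamma> \<in> hom2 A (h' \<cdot>\<^bsub>A\<^esub> h) (m' \<cdot>\<^bsub>A\<^esub> m)"
    using F.source.hcomp_hom' p q by blast
  moreover have "\<delta>' \<star>\<^bsub>C\<^esub> \<delta> \<in> hom2 C (k' \<cdot>\<^bsub>C\<^esub> k) (n' \<cdot>\<^bsub>C\<^esub> n)"
    using G.source.hcomp_hom' p q by blast
  ultimately show ?thesis
    using comma_comp_hom[OF homs(1,3)] comma_comp_hom[OF homs(2,4)] p(1-3) q(1-3)
    by (auto intro!: comma_hom2I)
qed

section \<open>The 2-category axioms\<close>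

abbreviation "arr_src p \<equiv> fst (fst (snd p))"
abbreviation "arr_tgt p \<equiv> fst (snd (fst (snd p)))"

lemma comma_id2: "id2 FG p = (p, (id2 A (arr_src p), id2 C (arr_tgt p)), p)"
  by (cases p) auto

lemma comma_comp_src_tgt:
  "arr_src (q \<cdot>\<^bsub>FG\<^esub> p) = arr_src q \<cdot>\<^bsub>A\<^esub> arr_src p"
  "arr_tgt (q \<cdot>\<^bsub>FG\<^esub> p) = arr_tgt q \<cdot>\<^bsub>C\<^esub> arr_tgt p"
  by (cases p; cases q; auto)+

lemma comma_hom1_src_tgt:
  assumes "p \<in> hom1 FG X Y"
  shows "arr_src p \<in> hom1 A (fst X) (fst Y)" "arr_tgt p \<in> hom1 C (snd (snd X)) (snd (snd Y))"
  using assms by (auto elim!: comma_hom1E)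

text \<open>A coarser elimination than \<open>comma_hom2E\<close>: the end arrows stay opaque and
  the condition in \<open>B\<close> is dropped, since equality of 2-cells depends only on the end
  arrows and the parts in \<open>A\<close> and \<open>C\<close>. \<open>arr_src\<close> and
  \<open>arr_tgt\<close> read the tuples directly, without the membership conditions under which
  \<open>src\<close> and \<open>tgt\<close> can be evaluated.\<close>

lemma comma_hom2_cases:
  assumes "\<sigma> \<in> hom2 FG p q"
  obtains X Y \<gamma> \<delta> where "\<sigma> = (p, (\<gamma>, \<delta>), q)" "p \<in> hom1 FG X Y" "q \<in> hom1 FG X Y"
    "\<gamma> \<in> hom2 A (arr_src p) (arr_src q)" "\<delta> \<in> hom2 C (arr_tgt p) (arr_tgt q)"
  using assms by (elim comma_hom2E) (auto simp: comma_hom1_iff)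

lemma comma_arr_dom_cod:
  assumes "p \<in> hom1 FG X Y"
  shows "p \<in> arr FG" "dom1 FG p = X" "cod1 FG p = Y"
  using assms by (auto simp: hom1_def)

lemma comma_cell_hom2: "\<sigma> \<in> cell FG \<Longrightarrow> \<sigma> \<in> hom2 FG (dom2 FG \<sigma>) (cod2 FG \<sigma>)"
  by (simp add: hom2_def)

text \<open>Closure and the laws for arrows are settled above. The remaining laws for 2-cells are
  those of \<open>A\<close> and \<open>C\<close>, joined for horizontal units and associativity with
  the corresponding law for the end arrows.\<close>

lemma two_category_comma: "two_category FG"
proof (unfold_locales, goal_cases)
  case (1 p)
  then show ?case using comma_hom1_obj comma_arr_hom1 by blast
next
  case (2 p)
  then show ?case using comma_hom1_obj comma_arr_hom1 by blast
next
  case (3 X)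
  then show ?case by (rule comma_id1_hom)
next
  case 4
  then show ?case by (rule comma_comp_hom)
next
  case 5
  then show ?case by (rule comma_comp_id)
next
  case 6
  then show ?case by (rule comma_comp_id)
next
  case 7
  then show ?case by (rule comma_comp_assoc)
next
  case (8 \<sigma>)
  from comma_cell_hom2[OF 8] show ?case
    by (rule comma_hom2_cases) (auto simp: comma_arr_dom_cod)
next
  case (9 \<sigma>)
  from comma_cell_hom2[OF 9] show ?case
    by (rule comma_hom2_cases) (auto simp: comma_arr_dom_cod)
next
  case (10 \<sigma>)
  from comma_cell_hom2[OF 10] show ?case
    by (rule comma_hom2_cases) (auto simp: comma_arr_dom_cod)
next
  case (11 \<sigma>)
  from comma_cell_hom2[OF 11] show ?case
    by (rule comma_hom2_cases) (auto simp: comma_arr_dom_cod)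
next
  case (12 p)
  then show ?case using comma_id2_hom comma_arr_hom1 by blast
next
  case 13
  then show ?case by (rule comma_vcomp_hom)
next
  case (14 \<sigma> p q)
  then show ?case
    by (auto elim!: comma_hom2_cases simp: comma_id2 F.source.vcomp_id_left G.source.vcomp_id_left)
next
  case (15 \<sigma> p q)
  then show ?case
    by (auto elim!: comma_hom2_cases simp: comma_id2 F.source.vcomp_id_right
      G.source.vcomp_id_right)
next
  case (16 \<sigma> p q \<tau> r \<upsilon> s)
  from 16(1) show ?case
  proof (rule comma_hom2_cases)
    fix X Y \<gamma> \<delta> assume 1: "\<sigma> = (p, (\<gamma>, \<delta>), q)" "\<gamma> \<in> hom2 A (arr_src p) (arr_src q)"
      "\<delta> \<in> hom2 C (arr_tgt p) (arr_tgt q)"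
    from 16(2) show ?case
    proof (rule comma_hom2_cases)
      fix X Y \<gamma>' \<delta>' assume 2: "\<tau> = (q, (\<gamma>', \<delta>'), r)" "\<gamma>' \<in> hom2 A (arr_src q) (arr_src r)"
        "\<delta>' \<in> hom2 C (arr_tgt q) (arr_tgt r)"
      from 16(3) show ?case
        by (rule comma_hom2_cases)
          (simp add: 1(1) 2(1) F.source.vcomp_assoc[OF 1(2) 2(2)]
            G.source.vcomp_assoc[OF 1(3) 2(3)])
    qed
  qed
next
  case 17
  then show ?case by (rule comma_hcomp_hom)
next
  case (18 \<sigma> p q X Y)
  from 18(1) show ?case
  proof (rule comma_hom2_cases)
    fix X' Y' \<gamma> \<delta> assume 1: "\<sigma> = (p, (\<gamma>, \<delta>), q)" "p \<in> hom1 FG X' Y'" "q \<in> hom1 FG X' Y'"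
      "\<gamma> \<in> hom2 A (arr_src p) (arr_src q)" "\<delta> \<in> hom2 C (arr_tgt p) (arr_tgt q)"
    \<comment> \<open>The elimination rule names the end objects anew; \<open>dom1\<close> and
      \<open>cod1\<close> of \<open>p\<close> identify them with the given ones.\<close>
    have eqs: "X' = X" "Y' = Y" using 18(2) 1(2) by (auto simp: hom1_def)
    note h = comma_hom1_src_tgt[OF 18(2)]
    have "arr_src (id1 FG Y) = id1 A (fst Y)" "arr_tgt (id1 FG Y) = id1 C (snd (snd Y))"
      by (cases Y; simp)+
    then show ?case
      using comma_comp_id(1)[OF 1(2)] comma_comp_id(1)[OF 1(3)]
        F.source.hcomp_id_left[OF 1(4) h(1)] G.source.hcomp_id_left[OF 1(5) h(2)]
      by (simp add: 1(1) comma_id2 eqs)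
  qed
next
  case (19 \<sigma> p q X Y)
  from 19(1) show ?case
  proof (rule comma_hom2_cases)
    fix X' Y' \<gamma> \<delta> assume 1: "\<sigma> = (p, (\<gamma>, \<delta>), q)" "p \<in> hom1 FG X' Y'" "q \<in> hom1 FG X' Y'"
      "\<gamma> \<in> hom2 A (arr_src p) (arr_src q)" "\<delta> \<in> hom2 C (arr_tgt p) (arr_tgt q)"
    have eqs: "X' = X" "Y' = Y" using 19(2) 1(2) by (auto simp: hom1_def)
    note h = comma_hom1_src_tgt[OF 19(2)]
    have "arr_src (id1 FG X) = id1 A (fst X)" "arr_tgt (id1 FG X) = id1 C (snd (snd X))"
      by (cases X; simp)+
    then show ?case
      using comma_comp_id(2)[OF 1(2)] comma_comp_id(2)[OF 1(3)]
        F.source.hcomp_id_right[OF 1(4) h(1)] G.source.hcomp_id_right[OF 1(5) h(2)]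
      by (simp add: 1(1) comma_id2 eqs)
  qed
next
  case (20 \<sigma> p p' \<tau> q q' \<upsilon> r r')
  obtain X Y \<gamma> \<delta> where 1: "\<sigma> = (p, (\<gamma>, \<delta>), p')" "p \<in> hom1 FG X Y" "p' \<in> hom1 FG X Y"
    "\<gamma> \<in> hom2 A (arr_src p) (arr_src p')" "\<delta> \<in> hom2 C (arr_tgt p) (arr_tgt p')"
    using 20(1) by (rule comma_hom2_cases)
  obtain Z \<gamma>' \<delta>' where 2: "\<tau> = (q, (\<gamma>', \<delta>'), q')" "q \<in> hom1 FG Y Z" "q' \<in> hom1 FG Y Z"
    "\<gamma>' \<in> hom2 A (arr_src q) (arr_src q')" "\<delta>' \<in> hom2 C (arr_tgt q) (arr_tgt q')"
    using 20(2,4) 1(2) by (metis comma_hom2_cases comma_arr_dom_cod(2,3))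
  obtain W \<gamma>'' \<delta>'' where 3: "\<upsilon> = (r, (\<gamma>'', \<delta>''), r')" "r \<in> hom1 FG Z W" "r' \<in> hom1 FG Z W"
    "\<gamma>'' \<in> hom2 A (arr_src r) (arr_src r')" "\<delta>'' \<in> hom2 C (arr_tgt r) (arr_tgt r')"
    using 20(3,5) 2(2) by (metis comma_hom2_cases comma_arr_dom_cod(2,3))
  show ?case
    using comma_comp_assoc[OF 1(2) 2(2) 3(2)] comma_comp_assoc[OF 1(3) 2(3) 3(3)]
      F.source.hcomp_assoc'[OF 1(4) 2(4) 3(4) 1(2)[THEN comma_hom1_src_tgt(1)]
        2(2)[THEN comma_hom1_src_tgt(1)] 3(2)[THEN comma_hom1_src_tgt(1)]]
      G.source.hcomp_assoc'[OF 1(5) 2(5) 3(5) 1(2)[THEN comma_hom1_src_tgt(2)]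
        2(2)[THEN comma_hom1_src_tgt(2)] 3(2)[THEN comma_hom1_src_tgt(2)]]
    by (simp add: 1(1) 2(1) 3(1))
next
  case (21 p X Y q Z)
  show ?case
    using F.source.hcomp_id2[OF 21[THEN comma_hom1_src_tgt(1)]]
      G.source.hcomp_id2[OF 21[THEN comma_hom1_src_tgt(2)]]
    by (simp add: comma_id2 comma_comp_src_tgt)
next
  case (22 \<sigma> p p' \<sigma>' p'' \<tau> q q' \<tau>' q'')
  obtain X Y \<gamma> \<delta> where 1: "\<sigma> = (p, (\<gamma>, \<delta>), p')" "p \<in> hom1 FG X Y"
    "\<gamma> \<in> hom2 A (arr_src p) (arr_src p')" "\<delta> \<in> hom2 C (arr_tgt p) (arr_tgt p')"
    using 22(1) by (rule comma_hom2_cases)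
  obtain \<gamma>' \<delta>' where 2: "\<sigma>' = (p', (\<gamma>', \<delta>'), p'')"
    "\<gamma>' \<in> hom2 A (arr_src p') (arr_src p'')" "\<delta>' \<in> hom2 C (arr_tgt p') (arr_tgt p'')"
    using 22(2) by (rule comma_hom2_cases)
  obtain Z \<phi> \<psi> where 3: "\<tau> = (q, (\<phi>, \<psi>), q')" "q \<in> hom1 FG Y Z"
    "\<phi> \<in> hom2 A (arr_src q) (arr_src q')" "\<psi> \<in> hom2 C (arr_tgt q) (arr_tgt q')"
    using 22(3,5) 1(2) by (metis comma_hom2_cases comma_arr_dom_cod(2,3))
  obtain \<phi>' \<psi>' where 4: "\<tau>' = (q', (\<phi>', \<psi>'), q'')"
    "\<phi>' \<in> hom2 A (arr_src q') (arr_src q'')" "\<psi>' \<in> hom2 C (arr_tgt q') (arr_tgt q'')"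
    using 22(4) by (rule comma_hom2_cases)
  show ?case
    using F.source.interchange'[OF 1(3) 2(2) 3(3) 4(2) 1(2)[THEN comma_hom1_src_tgt(1)]
        3(2)[THEN comma_hom1_src_tgt(1)]]
      G.source.interchange'[OF 1(4) 2(3) 3(4) 4(3) 1(2)[THEN comma_hom1_src_tgt(2)]
        3(2)[THEN comma_hom1_src_tgt(2)]]
    by (simp add: 1(1) 2(1) 3(1) 4(1))
qed

sublocale comma: two_category FG
  by (rule two_category_comma)

section \<open>\<open>src\<close>, \<open>tgt\<close> and \<open>lam\<close> as coordinates on the
  comma\<close>

lemma fun0_src_tgt:
  "(a, f, c) \<in> obj FG \<Longrightarrow> fun0 src (a, f, c) = a"
  "(a, f, c) \<in> obj FG \<Longrightarrow> fun0 tgt (a, f, c) = c"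
  "(a, f, c) \<in> obj FG \<Longrightarrow> component lam (a, f, c) = f"
  by (simp_all add: comma_src_def comma_tgt_def comma_lambda_def comma_carriers)

lemma fun1_src_tgt:
  "(X, (h, k, \<alpha>), Y) \<in> arr FG \<Longrightarrow> fun1 src (X, (h, k, \<alpha>), Y) = h"
  "(X, (h, k, \<alpha>), Y) \<in> arr FG \<Longrightarrow> fun1 tgt (X, (h, k, \<alpha>), Y) = k"
  "(X, (h, k, \<alpha>), Y) \<in> arr FG \<Longrightarrow> laxity lam (X, (h, k, \<alpha>), Y) = \<alpha>"
  by (simp_all add: comma_src_def comma_tgt_def comma_lambda_def comma_carriers)

lemma fun2_src_tgt:
  "(p, (\<gamma>, \<delta>), q) \<in> cell FG \<Longrightarrow> fun2 src (p, (\<gamma>, \<delta>), q) = \<gamma>"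
  "(p, (\<gamma>, \<delta>), q) \<in> cell FG \<Longrightarrow> fun2 tgt (p, (\<gamma>, \<delta>), q) = \<delta>"
  by (simp_all add: comma_src_def comma_tgt_def comma_carriers)

lemma comma_obj_eqI:
  assumes "X \<in> obj FG" "X' \<in> obj FG" "fun0 src X = fun0 src X'" "fun0 tgt X = fun0 tgt X'"
    and "component lam X = component lam X'"
  shows "X = X'"
  using assms by (cases X; cases X') (simp add: fun0_src_tgt)

lemma comma_hom1_eqI:
  assumes "p \<in> hom1 FG X Y" "p' \<in> hom1 FG X Y" "fun1 src p = fun1 src p'"
    and "fun1 tgt p = fun1 tgt p'" "laxity lam p = laxity lam p'"
  shows "p = p'"
  using assms by (cases p; cases p') (auto simp: fun1_src_tgt hom1_def)

text \<open>No value of \<open>lam\<close> is compared: at a 2-cell it imposes a condition but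
  contributes no data.\<close>

lemma comma_hom2_eqI:
  assumes "\<sigma> \<in> hom2 FG p q" "\<sigma>' \<in> hom2 FG p q" "fun2 src \<sigma> = fun2 src \<sigma>'"
    and "fun2 tgt \<sigma> = fun2 tgt \<sigma>'"
  shows "\<sigma> = \<sigma>'"
  using assms by (cases \<sigma>; cases \<sigma>') (auto simp: fun2_src_tgt hom2_def)

lemma comma_objI:
  assumes "a \<in> obj A" "c \<in> obj C" "f \<in> hom1 B (fun0 F a) (fun0 G c)"
  shows "(a, f, c) \<in> obj FG" "fun0 src (a, f, c) = a" "fun0 tgt (a, f, c) = c"
    "component lam (a, f, c) = f"
  using assms fun0_src_tgt by (auto simp: comma_obj_iff)

lemma comma_arrI:
  assumes "X \<in> obj FG" "Y \<in> obj FG" "h \<in> hom1 A (fun0 src X) (fun0 src Y)"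
    and "k \<in> hom1 C (fun0 tgt X) (fun0 tgt Y)"
    and "\<alpha> \<in> hom2 B (fun1 G k \<cdot>\<^bsub>B\<^esub> component lam X) (component lam Y \<cdot>\<^bsub>B\<^esub> fun1 F h)"
  shows "(X, (h, k, \<alpha>), Y) \<in> hom1 FG X Y" "fun1 src (X, (h, k, \<alpha>), Y) = h"
    "fun1 tgt (X, (h, k, \<alpha>), Y) = k" "laxity lam (X, (h, k, \<alpha>), Y) = \<alpha>"
proof -
  show "(X, (h, k, \<alpha>), Y) \<in> hom1 FG X Y"
    using assms by (cases X; cases Y) (simp add: fun0_src_tgt comma_hom1_iff comma_obj_iff)
  then have "(X, (h, k, \<alpha>), Y) \<in> arr FG" by (rule comma_arr_dom_cod)
  then show "fun1 src (X, (h, k, \<alpha>), Y) = h" "fun1 tgt (X, (h, k, \<alpha>), Y) = k"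
    "laxity lam (X, (h, k, \<alpha>), Y) = \<alpha>" by (rule fun1_src_tgt)+
qed

text \<open>The condition on 2-cells is rephrased in the coordinates, the form in which naturality
  of a lax transformation or the equation in (3) supplies it.\<close>

lemma comma_cellI:
  assumes "p \<in> hom1 FG X Y" "q \<in> hom1 FG X Y" "\<gamma> \<in> hom2 A (fun1 src p) (fun1 src q)"
    and "\<delta> \<in> hom2 C (fun1 tgt p) (fun1 tgt q)"
    and "(id2 B (component lam Y) \<star>\<^bsub>B\<^esub> fun2 F \<gamma>) \<bullet>\<^bsub>B\<^esub> laxity lam p =
      laxity lam q \<bullet>\<^bsub>B\<^esub> (fun2 G \<delta> \<star>\<^bsub>B\<^esub> id2 B (component lam X))"
  shows "(p, (\<gamma>, \<delta>), q) \<in> hom2 FG p q" "fun2 src (p, (\<gamma>, \<delta>), q) = \<gamma>"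
    "fun2 tgt (p, (\<gamma>, \<delta>), q) = \<delta>"
proof -
  show "(p, (\<gamma>, \<delta>), q) \<in> hom2 FG p q"
    using assms comma_hom1_obj[OF assms(1)] comma_arr_dom_cod[OF assms(1)]
      comma_arr_dom_cod[OF assms(2)]
    by (cases p; cases q; cases X; cases Y)
      (auto simp: fun0_src_tgt fun1_src_tgt intro!: comma_hom2I)
  then have "(p, (\<gamma>, \<delta>), q) \<in> cell FG" by (simp add: hom2_def)
  then show "fun2 src (p, (\<gamma>, \<delta>), q) = \<gamma>" "fun2 tgt (p, (\<gamma>, \<delta>), q) = \<delta>"
    by (rule fun2_src_tgt)+
qed

lemma component_lam: "X \<in> obj FG
  \<Longrightarrow> component lam X \<in> hom1 B (fun0 F (fun0 src X)) (fun0 G (fun0 tgt X))"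
  by (cases X) (simp add: comma_obj_iff fun0_src_tgt)

lemma laxity_lam:
  assumes "p \<in> hom1 FG X Y"
  shows "laxity lam p \<in> hom2 B (fun1 G (fun1 tgt p) \<cdot>\<^bsub>B\<^esub> component lam X)
    (component lam Y \<cdot>\<^bsub>B\<^esub> fun1 F (fun1 src p))"
  using assms comma_hom1_obj[OF assms] comma_arr_dom_cod[OF assms]
  by (auto elim!: comma_hom1E simp: fun0_src_tgt fun1_src_tgt)

text \<open>In the coordinates, the defining condition of a 2-cell of the comma is the naturality of
  \<open>lam\<close> at that 2-cell.\<close>

lemma comma_cell_eq:
  assumes "p \<in> hom1 FG X Y" "\<sigma> \<in> hom2 FG p q"
  shows "(id2 B (component lam Y) \<star>\<^bsub>B\<^esub> fun2 F (fun2 src \<sigma>)) \<bullet>\<^bsub>B\<^esub> laxity lam p =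
      laxity lam q \<bullet>\<^bsub>B\<^esub> (fun2 G (fun2 tgt \<sigma>) \<star>\<^bsub>B\<^esub> id2 B (component lam X))"
proof -
  have "\<sigma> \<in> cell FG" "p \<in> arr FG" "q \<in> arr FG" "X \<in> obj FG" "Y \<in> obj FG"
    using assms(2) comma.hom2_arr[OF assms(2)] comma_hom1_obj[OF assms(1)] by (auto simp: hom2_def)
  then show ?thesis
    using comma_hom2E[OF assms(2)] comma_arr_dom_cod(2,3)[OF assms(1)]
    by (smt (verit) comma_dom_cod(1,2) fun0_src_tgt(3) fun1_src_tgt(3) fun2_src_tgt)
qed

section \<open>The projections are 2-functors and \<open>lam\<close> is lax natural\<close>

lemma two_functor_src: "two_functor FG A src"
proof -
  have ext: "fun0 src \<in> obj FG \<rightarrow>\<^sub>E obj A" "fun1 src \<in> arr FG \<rightarrow>\<^sub>E arr A"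
    "fun2 src \<in> cell FG \<rightarrow>\<^sub>E cell A"
    by (auto simp: comma_src_def comma_carriers comma_objects_def comma_arrows_def
        comma_cells_def hom1_def hom2_def)
  have src1: "fun1 src p = arr_src p" if "p \<in> hom1 FG X Y" for p X Y
    using comma_arr_dom_cod[OF that] by (cases p) (auto simp: fun1_src_tgt)
  \<comment> \<open>\<open>arr_src\<close> also reads the part in \<open>A\<close> of a 2-cell,
    since in both kinds of tuple it is the first entry of the middle component.\<close>
  have src2: "fun2 src \<sigma> = arr_src \<sigma>" if "\<sigma> \<in> hom2 FG p q" for \<sigma> p q
    using that by (cases \<sigma>) (auto simp: fun2_src_tgt hom2_def)
  have src0: "fun0 src X = fst X" if "X \<in> obj FG" for X
    using that by (cases X) (auto simp: fun0_src_tgt)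
  show ?thesis
  proof (unfold_locales, goal_cases)
    case (4 p X Y)
    then show ?case using comma_hom1_src_tgt[OF 4] src1[OF 4] comma_hom1_obj[OF 4] src0 by simp
  next
    case (5 \<sigma> p q)
    from 5 show ?case by (rule comma_hom2_cases) (use src1 src2[OF 5] in auto)
  next
    case (6 X)
    then show ?case using src1[OF comma_id1_hom[OF 6]] src0[OF 6] by (cases X) simp
  next
    case (7 p X Y q Z)
    then show ?case
      using src1[OF comma_comp_hom[OF 7]] src1[OF 7(1)] src1[OF 7(2)] by
        (simp add: comma_comp_src_tgt)
  next
    case (8 p)
    then show ?case
      using src1[OF comma_arr_hom1[OF 8]] src2[OF comma.id2_hom[OF 8]] by (simp add: comma_id2)
  next
    case (9 \<sigma> p q \<tau> r)
    then show ?case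
      using src2[OF comma_vcomp_hom[OF 9]] src2[OF 9(1)] src2[OF 9(2)]
      by (cases \<sigma>; cases \<tau>) auto
  next
    case (10 \<sigma> p p' \<tau> q q')
    then show ?case
      using src2[OF comma_hcomp_hom[OF 10]] src2[OF 10(1)] src2[OF 10(2)]
      by (cases \<sigma>; cases \<tau>) auto
  qed (use ext in auto)
qed

lemma two_functor_tgt: "two_functor FG C tgt"
proof -
  have ext: "fun0 tgt \<in> obj FG \<rightarrow>\<^sub>E obj C" "fun1 tgt \<in> arr FG \<rightarrow>\<^sub>E arr C"
    "fun2 tgt \<in> cell FG \<rightarrow>\<^sub>E cell C"
    by (auto simp: comma_tgt_def comma_carriers comma_objects_def comma_arrows_def
        comma_cells_def hom1_def hom2_def)
  have tgt1: "fun1 tgt p = arr_tgt p" if "p \<in> hom1 FG X Y" for p X Y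
    using comma_arr_dom_cod[OF that] by (cases p) (auto simp: fun1_src_tgt)
  \<comment> \<open>\<open>arr_tgt\<close> does not fit here: the middle component of a 2-cell is a
    pair and not a triple.\<close>
  have tgt2: "fun2 tgt \<sigma> = snd (fst (snd \<sigma>))" if "\<sigma> \<in> hom2 FG p q" for \<sigma> p q
    using that by (cases \<sigma>) (auto simp: fun2_src_tgt hom2_def)
  have tgt0: "fun0 tgt X = snd (snd X)" if "X \<in> obj FG" for X
    using that by (cases X) (auto simp: fun0_src_tgt)
  show ?thesis
  proof (unfold_locales, goal_cases)
    case (4 p X Y)
    then show ?case using comma_hom1_src_tgt[OF 4] tgt1[OF 4] comma_hom1_obj[OF 4] tgt0 by simp
  next
    case (5 \<sigma> p q)
    from 5 show ?case by (rule comma_hom2_cases) (use tgt1 tgt2[OF 5] in auto)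
  next
    case (6 X)
    then show ?case using tgt1[OF comma_id1_hom[OF 6]] tgt0[OF 6] by (cases X) simp
  next
    case (7 p X Y q Z)
    then show ?case
      using tgt1[OF comma_comp_hom[OF 7]] tgt1[OF 7(1)] tgt1[OF 7(2)] by
        (simp add: comma_comp_src_tgt)
  next
    case (8 p)
    then show ?case
      using tgt1[OF comma_arr_hom1[OF 8]] tgt2[OF comma.id2_hom[OF 8]] by (simp add: comma_id2)
  next
    case (9 \<sigma> p q \<tau> r)
    then show ?case
      using tgt2[OF comma_vcomp_hom[OF 9]] tgt2[OF 9(1)] tgt2[OF 9(2)]
      by (cases \<sigma>; cases \<tau>) auto
  next
    case (10 \<sigma> p p' \<tau> q q')
    then show ?case
      using tgt2[OF comma_hcomp_hom[OF 10]] tgt2[OF 10(1)] tgt2[OF 10(2)]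
      by (cases \<sigma>; cases \<tau>) auto
  qed (use ext in auto)
qed

sublocale src: two_functor FG A src by (rule two_functor_src)
sublocale tgt: two_functor FG C tgt by (rule two_functor_tgt)

lemma laxity_lam_id1: "X \<in> obj FG \<Longrightarrow> laxity lam (id1 FG X) = id2 B (component lam X)"
  using comma_id1_hom[of X] by (cases X) (auto simp: fun0_src_tgt hom1_def fun1_src_tgt)

text \<open>Composition in the comma is defined as the very pasting that a lax transformation must
  assign to a composite, so \<open>lam\<close> is functorial by construction.\<close>

lemma laxity_lam_comp1:
  assumes "p \<in> hom1 FG X Y" "q \<in> hom1 FG Y Z"
  shows "laxity lam (q \<cdot>\<^bsub>FG\<^esub> p) = (laxity lam q \<star>\<^bsub>B\<^esub> id2 B (fun1 F (fun1 src p))) \<bullet>\<^bsub>B\<^esub>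
    (id2 B (fun1 G (fun1 tgt q)) \<star>\<^bsub>B\<^esub> laxity lam p)"
  using assms comma_comp_hom[OF assms]
  by (cases p; cases q) (auto simp: hom1_def fun1_src_tgt)

lemma lax_transformation_lam:
  "lax_transformation FG B (fun_comp FG F src) (fun_comp FG G tgt) lam"
proof -
  interpret Fs: two_functor FG B "fun_comp FG F src"
    using two_functor_fun_comp[OF two_functor_src F.two_functor_axioms] .
  interpret Gt: two_functor FG B "fun_comp FG G tgt"
    using two_functor_fun_comp[OF two_functor_tgt G.two_functor_axioms] .
  show ?thesis
  proof (unfold_locales, goal_cases)
    case 1
    then show ?case by (auto simp: comma_lambda_def comma_carriers)
  next
    case 2
    then show ?case by (auto simp: comma_lambda_def comma_carriers)
  next
    case (3 X)
    then show ?case using component_lam by simp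
  next
    case (4 p X Y)
    then show ?case using laxity_lam[OF 4] comma_arr_dom_cod[OF 4] by simp
  next
    case (5 X)
    then show ?case by (rule laxity_lam_id1)
  next
    case (6 p X Y q Z)
    then show ?case
      using laxity_lam_comp1[OF 6] comma_arr_dom_cod[OF 6(1)] comma_arr_dom_cod[OF 6(2)] by simp
  next
    case (7 p X Y \<sigma> q)
    then show ?case using comma_cell_eq[OF 7] by (simp add: hom2_def)
  qed
qed

section \<open>Universality\<close>

text \<open>Agreement propagates upwards: equal values on objects put the two images of an arrow
  into one hom-set, where the coordinates decide, and equal values on arrows do the same for
  2-cells.\<close>

lemma comma_functor_eqI:
  assumes "two_functor D FG U" "two_functor D FG V"
    and "fun_comp D src U = fun_comp D src V" "fun_comp D tgt U = fun_comp D tgt V"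
    and "lax_fun D lam U = lax_fun D lam V"
  shows "U = V"
proof -
  interpret U: two_functor D FG U by fact
  interpret V: two_functor D FG V by fact
  have 0: "fun0 U x = fun0 V x" if "x \<in> obj D" for x
  proof (rule comma_obj_eqI)
    show "fun0 src (fun0 U x) = fun0 src (fun0 V x)" "fun0 tgt (fun0 U x) = fun0 tgt (fun0 V x)"
      "component lam (fun0 U x) = component lam (fun0 V x)"
      using assms(3-5) that by (metis fun_comp_simps(1) lax_fun_simps(1))+
  qed (use that U.fun0_obj V.fun0_obj in auto)
  have 1: "fun1 U f = fun1 V f" if "f \<in> arr D" for f
  proof (rule comma_hom1_eqI)
    have f: "f \<in> hom1 D (dom1 D f) (cod1 D f)" using that by (simp add: hom1_def)
    show "fun1 U f \<in> hom1 FG (fun0 U (dom1 D f)) (fun0 U (cod1 D f))" by (rule U.fun1_hom[OF f])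
    show "fun1 V f \<in> hom1 FG (fun0 U (dom1 D f)) (fun0 U (cod1 D f))"
      using V.fun1_hom[OF f] 0 U.source.hom1_obj[OF f] by simp
    show "fun1 src (fun1 U f) = fun1 src (fun1 V f)" "fun1 tgt (fun1 U f) = fun1 tgt (fun1 V f)"
      "laxity lam (fun1 U f) = laxity lam (fun1 V f)"
      using assms(3-5) that by (metis fun_comp_simps(2) lax_fun_simps(2))+
  qed
  have 2: "fun2 U \<sigma> = fun2 V \<sigma>" if "\<sigma> \<in> cell D" for \<sigma>
  proof (rule comma_hom2_eqI)
    have \<sigma>: "\<sigma> \<in> hom2 D (dom2 D \<sigma>) (cod2 D \<sigma>)" using that by (simp add: hom2_def)
    show "fun2 U \<sigma> \<in> hom2 FG (fun1 U (dom2 D \<sigma>)) (fun1 U (cod2 D \<sigma>))" by (rule U.fun2_hom[OF \<sigma>])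
    show "fun2 V \<sigma> \<in> hom2 FG (fun1 U (dom2 D \<sigma>)) (fun1 U (cod2 D \<sigma>))"
      using V.fun2_hom[OF \<sigma>] 1 U.source.hom2_arr[OF \<sigma>] by simp
    show "fun2 src (fun2 U \<sigma>) = fun2 src (fun2 V \<sigma>)" "fun2 tgt (fun2 U \<sigma>) = fun2 tgt (fun2 V \<sigma>)"
      using assms(3-4) that by (metis fun_comp_simps(3))+
  qed
  show ?thesis using assms(1,2) 0 1 2 by (rule two_functor_eqI)
qed

text \<open>Each equation required of \<open>U\<close> is tested on \<open>src\<close>,
  \<open>tgt\<close> and, for arrows, \<open>lam\<close>: the first two give the axioms of
  \<open>H\<close> and \<open>K\<close>, the last gives \<open>laxity_id1\<close> and
  \<open>laxity_comp1\<close> of \<theta>. The nullary law is what makes \<open>U\<close> preserve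
  identities.\<close>

lemma comma_functor_exists:
  assumes "two_functor D A H" "two_functor D C K"
    and "lax_transformation D B (fun_comp D F H) (fun_comp D G K) \<theta>"
  obtains U where "two_functor D FG U" "fun_comp D src U = H" "fun_comp D tgt U = K"
    "lax_fun D lam U = \<theta>"
proof -
  interpret H: two_functor D A H by fact
  interpret K: two_functor D C K by fact
  interpret \<theta>: lax_transformation D B "fun_comp D F H" "fun_comp D G K" \<theta> by fact
  note hom1_arr = H.source.arr_hom1[THEN iffD1] and hom2_cell = H.source.cell_hom2[THEN iffD1]
  \<comment> \<open>The calculations use these total maps; restriction to the carriers enters only
    in \<open>U\<close>, where extensionality demands it.\<close>
  define U0 where "U0 x = (fun0 H x, component \<theta> x, fun0 K x)" for x
  define U1 where "U1 f = (U0 (dom1 D f), (fun1 H f, fun1 K f, laxity \<theta> f), U0 (cod1 D f))" for f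
  define U2 where "U2 \<sigma> = (U1 (dom2 D \<sigma>), (fun2 H \<sigma>, fun2 K \<sigma>), U1 (cod2 D \<sigma>))" for \<sigma>
  define U where "U = \<lparr>fun0 = restrict U0 (obj D), fun1 = restrict U1 (arr D),
    fun2 = restrict U2 (cell D)\<rparr>"
  have dc: "f \<in> arr D" "dom1 D f = x" "cod1 D f = y" "x \<in> obj D" "y \<in> obj D"
    if "f \<in> hom1 D x y" for f x y
    using that H.source.hom1_obj[OF that] by (auto simp: hom1_def)
  have dc2: "\<sigma> \<in> cell D" "dom2 D \<sigma> = f" "cod2 D \<sigma> = g" "f \<in> arr D" "g \<in> arr D"
    if "\<sigma> \<in> hom2 D f g" for \<sigma> f g
    using that H.source.hom2_arr[OF that] by (auto simp: hom2_def)
  have U0: "U0 x \<in> obj FG" "fun0 src (U0 x) = fun0 H x" "fun0 tgt (U0 x) = fun0 K x"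
    "component lam (U0 x) = component \<theta> x" if "x \<in> obj D" for x
    unfolding U0_def
    using comma_objI[of "fun0 H x" "fun0 K x" "component \<theta> x"] H.fun0_obj[OF that]
      K.fun0_obj[OF that] \<theta>.component_hom[OF that] that by simp_all
  have U1: "U1 f \<in> hom1 FG (U0 x) (U0 y)" "fun1 src (U1 f) = fun1 H f" "fun1 tgt (U1 f) = fun1 K f"
    "laxity lam (U1 f) = laxity \<theta> f" if "f \<in> hom1 D x y" for f x y
    unfolding U1_def dc[OF that]
    using comma_arrI[of "U0 x" "U0 y" "fun1 H f" "fun1 K f" "laxity \<theta> f"]
      U0[OF dc(4)[OF that]] U0[OF dc(5)[OF that]] H.fun1_hom[OF that] K.fun1_hom[OF that]
      \<theta>.laxity_hom[OF that] dc[OF that] by simp_all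
  have U2: "U2 \<sigma> \<in> hom2 FG (U1 f) (U1 g)" "fun2 src (U2 \<sigma>) = fun2 H \<sigma>"
    "fun2 tgt (U2 \<sigma>) = fun2 K \<sigma>" if "\<sigma> \<in> hom2 D f g" for \<sigma> f g
  proof -
    note fD = dc2(4)[OF that]
    obtain x y where f: "f \<in> hom1 D x y" using hom1_arr[OF fD] by blast
    have g: "g \<in> hom1 D x y" using H.source.hom2_parallel[OF that] f by blast
    note xy = dc(4,5)[OF f]
    have "(id2 B (component lam (U0 y)) \<star>\<^bsub>B\<^esub> fun2 F (fun2 H \<sigma>)) \<bullet>\<^bsub>B\<^esub> laxity lam (U1 f) =
      laxity lam (U1 g) \<bullet>\<^bsub>B\<^esub> (fun2 G (fun2 K \<sigma>) \<star>\<^bsub>B\<^esub> id2 B (component lam (U0 x)))"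
      using \<theta>.laxity_natural[OF f that] U1[OF f] U1[OF g] U0[OF xy(1)] U0[OF xy(2)] dc2[OF that]
      by simp
    then show "U2 \<sigma> \<in> hom2 FG (U1 f) (U1 g)" "fun2 src (U2 \<sigma>) = fun2 H \<sigma>"
      "fun2 tgt (U2 \<sigma>) = fun2 K \<sigma>"
      unfolding U2_def dc2[OF that]
      using comma_cellI[OF U1(1)[OF f] U1(1)[OF g], of "fun2 H \<sigma>" "fun2 K \<sigma>"]
        U1[OF f] U1[OF g] H.fun2_hom[OF that] K.fun2_hom[OF that] by simp_all
  qed
  \<comment> \<open>Stated ahead of the 2-functor axioms because preservation of horizontal
    composites of 2-cells uses it as well, for the end arrows.\<close>
  have U1_comp: "U1 (g \<cdot>\<^bsub>D\<^esub> f) = U1 g \<cdot>\<^bsub>FG\<^esub> U1 f" "cod1 FG (U1 f) = dom1 FG (U1 g)"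
    if f: "f \<in> hom1 D x y" and g: "g \<in> hom1 D y z" for f g x y z
  proof -
    note c = H.source.comp1_hom[OF f g] and U1f = U1[OF f] and U1g = U1[OF g]
    show "U1 (g \<cdot>\<^bsub>D\<^esub> f) = U1 g \<cdot>\<^bsub>FG\<^esub> U1 f"
      using U1(1)[OF c] comma_comp_hom[OF U1f(1) U1g(1)]
      by (rule comma_hom1_eqI)
        (use dc[OF f] dc[OF g] in \<open>simp_all add: U1[OF c] U1f U1g
          src.fun_comp1[OF U1f(1) U1g(1)] tgt.fun_comp1[OF U1f(1) U1g(1)]
          laxity_lam_comp1[OF U1f(1) U1g(1)] H.fun_comp1[OF f g] K.fun_comp1[OF f g]
          \<theta>.laxity_comp1[OF f g]\<close>)
    show "cod1 FG (U1 f) = dom1 FG (U1 g)"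
      using comma_arr_dom_cod[OF U1f(1)] comma_arr_dom_cod[OF U1g(1)] by simp
  qed
  have "two_functor D FG U"
  proof (unfold_locales, goal_cases)
    case 1
    then show ?case by (simp add: U_def U0)
  next
    case 2
    then show ?case using U1(1)[OF hom1_arr, THEN comma_arr_dom_cod(1)] by (simp add: U_def)
  next
    case 3
    then show ?case using U2(1)[OF hom2_cell] by (simp add: U_def hom2_def)
  next
    case (4 f x y)
    then show ?case using U1(1)[OF 4] dc[OF 4] by (simp add: U_def)
  next
    case (5 \<sigma> f g)
    then show ?case using U2(1)[OF 5] dc2[OF 5] by (simp add: U_def)
  next
    case (6 x)
    note i = H.source.id1_hom[OF 6]
    have "U1 (id1 D x) = id1 FG (U0 x)"
      using U1(1)[OF i] comma_id1_hom[OF U0(1)[OF 6]]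
      by (rule comma_hom1_eqI)
        (simp_all add: U1[OF i] U0[OF 6] src.fun_id1 tgt.fun_id1 laxity_lam_id1 H.fun_id1[OF 6]
          K.fun_id1[OF 6] \<theta>.laxity_id1[OF 6])
    then show ?case using 6 dc[OF i] by (simp add: U_def)
  next
    case (7 f x y g z)
    show ?case
      using U1_comp(1)[OF 7] dc[OF 7(1)] dc[OF 7(2)] dc[OF H.source.comp1_hom[OF 7]]
      by (simp add: U_def)
  next
    case (8 f)
    note i = H.source.id2_hom[OF 8] and U1f = U1[OF hom1_arr[OF 8]]
    note p = U1f(1)[THEN comma_arr_dom_cod(1)]
    have "U2 (id2 D f) = id2 FG (U1 f)"
      using U2(1)[OF i] comma.id2_hom[OF p]
      by (rule comma_hom2_eqI)
        (simp_all add: U2[OF i] U1f src.fun_id2[OF p] tgt.fun_id2[OF p] H.fun_id2[OF 8]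
          K.fun_id2[OF 8])
    then show ?case using 8 dc2[OF i] by (simp add: U_def)
  next
    case (9 \<sigma> f g \<tau> h)
    note c = H.source.vcomp_hom[OF 9] and U2\<sigma> = U2[OF 9(1)] and U2\<tau> = U2[OF 9(2)]
    have "U2 (\<tau> \<bullet>\<^bsub>D\<^esub> \<sigma>) = U2 \<tau> \<bullet>\<^bsub>FG\<^esub> U2 \<sigma>"
      using U2(1)[OF c] comma_vcomp_hom[OF U2\<sigma>(1) U2\<tau>(1)]
      by (rule comma_hom2_eqI)
        (simp_all add: U2[OF c] U2\<sigma> U2\<tau> src.fun_vcomp[OF U2\<sigma>(1) U2\<tau>(1)]
          tgt.fun_vcomp[OF U2\<sigma>(1) U2\<tau>(1)] H.fun_vcomp[OF 9] K.fun_vcomp[OF 9])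
    then show ?case using dc2[OF 9(1)] dc2[OF 9(2)] dc2[OF c] by (simp add: U_def)
  next
    case (10 \<sigma> f f' \<tau> g g')
    note c = H.source.hcomp_hom[OF 10] and U2\<sigma> = U2[OF 10(1)] and U2\<tau> = U2[OF 10(2)]
    \<comment> \<open>The end arrows of a 2-cell are parallel, so composability passes from
      \<open>f\<close>, \<open>g\<close> to \<open>f'\<close>, \<open>g'\<close>;
      \<open>U1_comp\<close> is needed for both pairs.\<close>
    have par: "cod1 D f' = dom1 D g'"
      using 10 dc2[OF 10(1)] dc2[OF 10(2)] H.source.dom1_parallel H.source.cod1_parallel by metis
    have fg: "f \<in> hom1 D (dom1 D f) (cod1 D f)" "g \<in> hom1 D (cod1 D f) (cod1 D g)"
      "f' \<in> hom1 D (dom1 D f') (cod1 D f')" "g' \<in> hom1 D (cod1 D f') (cod1 D g')"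
      using 10(3) par dc2[OF 10(1)] dc2[OF 10(2)] by (auto simp: hom1_def)
    note comp1 = U1_comp[OF fg(1,2)] and comp2 = U1_comp[OF fg(3,4)]
    note hc = comma_hcomp_hom[OF U2\<sigma>(1) U2\<tau>(1) comp1(2)]
    have "U2 (\<tau> \<star>\<^bsub>D\<^esub> \<sigma>) = U2 \<tau> \<star>\<^bsub>FG\<^esub> U2 \<sigma>"
      \<comment> \<open>Folding replaces the composites of end arrows by \<open>U1\<close> of
        composites, so that both 2-cells lie in one hom-set.\<close>
      using U2(1)[OF c] hc[folded comp1(1) comp2(1)]
      by (rule comma_hom2_eqI)
        (simp_all add: U2[OF c] U2\<sigma> U2\<tau> src.fun_hcomp[OF U2\<sigma>(1) U2\<tau>(1) comp1(2)]
          tgt.fun_hcomp[OF U2\<sigma>(1) U2\<tau>(1) comp1(2)] H.fun_hcomp[OF 10] K.fun_hcomp[OF 10])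
    then show ?case using dc2[OF 10(1)] dc2[OF 10(2)] dc2[OF c] by (simp add: U_def)
  qed
  moreover have "fun_comp D src U = H"
    using two_functor_fun_comp[OF \<open>two_functor D FG U\<close> two_functor_src] assms(1)
  proof (rule two_functor_eqI)
    fix f assume "f \<in> arr D"
    then show "fun1 (fun_comp D src U) f = fun1 H f" by (simp add: U_def U1(2)[OF hom1_arr])
  next
    fix \<sigma> assume "\<sigma> \<in> cell D"
    then show "fun2 (fun_comp D src U) \<sigma> = fun2 H \<sigma>" by (simp add: U_def U2(2)[OF hom2_cell])
  qed (simp add: U_def U0)
  moreover have "fun_comp D tgt U = K"
    using two_functor_fun_comp[OF \<open>two_functor D FG U\<close> two_functor_tgt] assms(2)
  proof (rule two_functor_eqI)
    fix f assume "f \<in> arr D"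
    then show "fun1 (fun_comp D tgt U) f = fun1 K f" by (simp add: U_def U1(3)[OF hom1_arr])
  next
    fix \<sigma> assume "\<sigma> \<in> cell D"
    then show "fun2 (fun_comp D tgt U) \<sigma> = fun2 K \<sigma>" by (simp add: U_def U2(3)[OF hom2_cell])
  qed (simp add: U_def U0)
  moreover have "lax_fun D lam U = \<theta>"
  proof -
    have "component (lax_fun D lam U) = component \<theta>"
      using \<theta>.component_ext
      by (intro extensionalityI[of _ "obj D"]) (auto simp: lax_fun_def U0 U_def compose_def)
    moreover have "laxity (lax_fun D lam U) = laxity \<theta>"
      using \<theta>.laxity_ext
      by (intro extensionalityI[of _ "arr D"])
        (auto simp: lax_fun_def U_def compose_def U1(4)[OF hom1_arr])
    ultimately show ?thesis by simp
  qed
  ultimately show thesis by (rule that)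
qed

lemma universal_1_comma: "universal_1 A B C F G FG src tgt lam D"
  unfolding universal_1_def
proof (intro allI impI)
  fix H K \<theta>
  assume "two_functor D A H" "two_functor D C K"
    "lax_transformation D B (fun_comp D F H) (fun_comp D G K) \<theta>"
  then obtain U where U: "two_functor D FG U" "fun_comp D src U = H" "fun_comp D tgt U = K"
    "lax_fun D lam U = \<theta>"
    by (rule comma_functor_exists)
  then show "\<exists>!U. two_functor D FG U \<and> fun_comp D src U = H \<and> fun_comp D tgt U = K \<and>
      \<theta> = lax_fun D lam U"
  proof (intro ex1I[of _ U] conjI, goal_cases)
    case (5 V)
    then show ?case using U by (intro comma_functor_eqI[of D]) auto
  qed (use U in simp_all)
qed

text \<open>\<open>m\<close> has two uses: its values complete the components of \<zeta> and \<xi>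
  to arrows of the comma, and its naturality makes the pairs of their laxities 2-cells. The laws for
  \<omega> are then tested on \<open>src\<close> and \<open>tgt\<close>, where they are those of
  \<zeta> and \<xi>.\<close>

lemma universal_2_comma: "universal_2 A B C F G FG src tgt lam D"
  unfolding universal_2_def
proof (intro allI impI)
  fix U V \<xi> \<zeta> m
  assume U: "two_functor D FG U" and V: "two_functor D FG V"
    and \<xi>: "lax_transformation D C (fun_comp D tgt U) (fun_comp D tgt V) \<xi>"
    and \<zeta>: "lax_transformation D A (fun_comp D src U) (fun_comp D src V) \<zeta>"
    and m: "modification D B (fun_comp D F (fun_comp D src U)) (fun_comp D G (fun_comp D tgt V))
        (lax_comp D B (fun_lax D G \<xi>) (lax_fun D lam U))
        (lax_comp D B (lax_fun D lam V) (fun_lax D F \<zeta>)) m"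
  interpret U: two_functor D FG U by fact
  interpret V: two_functor D FG V by fact
  interpret \<xi>: lax_transformation D C "fun_comp D tgt U" "fun_comp D tgt V" \<xi> by fact
  interpret \<zeta>: lax_transformation D A "fun_comp D src U" "fun_comp D src V" \<zeta> by fact
  interpret m: modification D B "fun_comp D F (fun_comp D src U)" "fun_comp D G (fun_comp D tgt V)"
    "lax_comp D B (fun_lax D G \<xi>) (lax_fun D lam U)"
    "lax_comp D B (lax_fun D lam V) (fun_lax D F \<zeta>)" m by fact
  note hom1_arr = U.source.arr_hom1[THEN iffD1]
  have dc: "f \<in> arr D" "dom1 D f = x" "cod1 D f = y" "x \<in> obj D" "y \<in> obj D"
    if "f \<in> hom1 D x y" for f x y
    using that U.source.hom1_obj[OF that] by (auto simp: hom1_def)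
  \<comment> \<open>\<open>m x\<close> runs from \<open>G \<xi>\<^sub>x\<close> after
    \<open>lam\<close> at \<open>U x\<close> to \<open>lam\<close> at \<open>V x\<close> after
    \<open>F \<zeta>\<^sub>x\<close>, which is the type demanded of the 2-cell in an arrow from
    \<open>U x\<close> to \<open>V x\<close> over these components.\<close>
  define W where "W x = (fun0 U x, (component \<zeta> x, component \<xi> x, m x), fun0 V x)" for x
  define \<Omega> where "\<Omega> f = (fun1 V f \<cdot>\<^bsub>FG\<^esub> W (dom1 D f), (laxity \<zeta> f, laxity \<xi> f),
    W (cod1 D f) \<cdot>\<^bsub>FG\<^esub> fun1 U f)" for f
  define \<omega> where "\<omega> = \<lparr>component = restrict W (obj D), laxity = restrict \<Omega> (arr D)\<rparr>"
  have W: "W x \<in> hom1 FG (fun0 U x) (fun0 V x)" "fun1 src (W x) = component \<zeta> x"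
    "fun1 tgt (W x) = component \<xi> x" "laxity lam (W x) = m x" if "x \<in> obj D" for x
    unfolding W_def
    using comma_arrI[of "fun0 U x" "fun0 V x" "component \<zeta> x" "component \<xi> x" "m x"]
      U.fun0_obj[OF that] V.fun0_obj[OF that] \<zeta>.component_hom[OF that] \<xi>.component_hom[OF that]
      m.modification_hom[OF that] that by (simp_all add: lax_comp_def)
  have \<Omega>: "\<Omega> f \<in> hom2 FG (fun1 V f \<cdot>\<^bsub>FG\<^esub> W x) (W y \<cdot>\<^bsub>FG\<^esub> fun1 U f)"
    "fun2 src (\<Omega> f) = laxity \<zeta> f" "fun2 tgt (\<Omega> f) = laxity \<xi> f" if f: "f \<in> hom1 D x y" for f x y
  proof -
    note Wx = W[OF dc(4)[OF f]] and Wy = W[OF dc(5)[OF f]]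
      and Uf = U.fun1_hom[OF f] and Vf = V.fun1_hom[OF f] and dcf = dc[OF f]
    note VW = comma_comp_hom[OF Wx(1) Vf] and WU = comma_comp_hom[OF Uf Wy(1)]
    note srcs = src.fun_comp1[OF Wx(1) Vf] src.fun_comp1[OF Uf Wy(1)]
      tgt.fun_comp1[OF Wx(1) Vf] tgt.fun_comp1[OF Uf Wy(1)]
    have z: "laxity \<zeta> f \<in> hom2 A (fun1 src (fun1 V f \<cdot>\<^bsub>FG\<^esub> W x)) (fun1 src (W y \<cdot>\<^bsub>FG\<^esub> fun1 U f))"
      using \<zeta>.laxity_hom[OF f] dcf by (simp add: srcs Wx Wy)
    have x: "laxity \<xi> f \<in> hom2 C (fun1 tgt (fun1 V f \<cdot>\<^bsub>FG\<^esub> W x)) (fun1 tgt (W y \<cdot>\<^bsub>FG\<^esub> fun1 U f))"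
      using \<xi>.laxity_hom[OF f] dcf by (simp add: srcs Wx Wy)
    let ?lU = "\<lambda>x. component lam (fun0 U x)" and ?lV = "\<lambda>x. component lam (fun0 V x)"
    let ?mU = "m y \<star>\<^bsub>B\<^esub> id2 B (fun1 F (fun1 src (fun1 U f)))"
      and ?Gm = "id2 B (fun1 G (fun1 tgt (fun1 V f))) \<star>\<^bsub>B\<^esub> m x"
      and ?a = "id2 B (fun1 G (component \<xi> y)) \<star>\<^bsub>B\<^esub> laxity lam (fun1 U f)"
      and ?b = "fun2 G (laxity \<xi> f) \<star>\<^bsub>B\<^esub> id2 B (?lU x)"
      and ?c = "id2 B (?lV y) \<star>\<^bsub>B\<^esub> fun2 F (laxity \<zeta> f)"
      and ?d = "laxity lam (fun1 V f) \<star>\<^bsub>B\<^esub> id2 B (fun1 F (component \<zeta> x))"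
    \<comment> \<open>Here \<open>?a\<close>, \<open>?b\<close> and \<open>?c\<close>,
      \<open>?d\<close> are bracketed together, being laxities of composite transformations. The
      comma condition brackets \<open>?mU\<close>, \<open>?a\<close> and \<open>?d\<close>,
      \<open>?Gm\<close> instead, the pastings that belong to \<open>W y \<cdot> fun1 U f\<close>
      and \<open>fun1 V f \<cdot> W x\<close>.\<close>
    have nat: "?mU \<bullet>\<^bsub>B\<^esub> (?a \<bullet>\<^bsub>B\<^esub> ?b) = ?c \<bullet>\<^bsub>B\<^esub> ?d \<bullet>\<^bsub>B\<^esub> ?Gm"
      using m.modification_natural[OF f] dcf by (simp add: lax_comp_def)
    note comps = dcf(4,5)[THEN U.fun0_obj, THEN component_lam]
      dcf(4,5)[THEN V.fun0_obj, THEN component_lam]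
    note Fs = F.fun1_hom[OF src.fun1_hom[OF Uf]] F.fun1_hom[OF src.fun1_hom[OF Vf]]
      F.fun1_hom[OF src.fun1_hom[OF Wx(1)], unfolded Wx]
      F.fun1_hom[OF src.fun1_hom[OF Wy(1)], unfolded Wy]
    note Gs = G.fun1_hom[OF tgt.fun1_hom[OF Uf]] G.fun1_hom[OF tgt.fun1_hom[OF Vf]]
      G.fun1_hom[OF tgt.fun1_hom[OF Wx(1)], unfolded Wx]
      G.fun1_hom[OF tgt.fun1_hom[OF Wy(1)], unfolded Wy]
    have F\<zeta>: "fun2 F (laxity \<zeta> f)
      \<in> hom2 B (fun1 F (fun1 src (fun1 V f)) \<cdot>\<^bsub>B\<^esub> fun1 F (component \<zeta> x))
        (fun1 F (component \<zeta> y) \<cdot>\<^bsub>B\<^esub> fun1 F (fun1 src (fun1 U f)))"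
      using F.fun2_hom[OF z] F.fun_comp1[OF src.fun1_hom[OF Uf] src.fun1_hom[OF Wy(1)]]
        F.fun_comp1[OF src.fun1_hom[OF Wx(1)] src.fun1_hom[OF Vf]] by (simp add: srcs Wx Wy)
    have G\<xi>: "fun2 G (laxity \<xi> f)
      \<in> hom2 B (fun1 G (fun1 tgt (fun1 V f)) \<cdot>\<^bsub>B\<^esub> fun1 G (component \<xi> x))
        (fun1 G (component \<xi> y) \<cdot>\<^bsub>B\<^esub> fun1 G (fun1 tgt (fun1 U f)))"
      using G.fun2_hom[OF x] G.fun_comp1[OF tgt.fun1_hom[OF Uf] tgt.fun1_hom[OF Wy(1)]]
        G.fun_comp1[OF tgt.fun1_hom[OF Wx(1)] tgt.fun1_hom[OF Vf]] by (simp add: srcs Wx Wy)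
    have "?c \<bullet>\<^bsub>B\<^esub> (?d \<bullet>\<^bsub>B\<^esub> ?Gm) = ?mU \<bullet>\<^bsub>B\<^esub> ?a \<bullet>\<^bsub>B\<^esub> ?b"
      using nat
        F.target.vcomp_paste_assoc[OF comps(1,3,4) Fs(3,2) Gs(3,2)
          laxity_lam[OF Wx(1), unfolded Wx] laxity_lam[OF Vf] F\<zeta>]
        F.target.paste_vcomp_assoc[OF comps(1,2,4) Fs(1,4) Gs(1,4)
          laxity_lam[OF Uf] laxity_lam[OF Wy(1), unfolded Wy] G\<xi>] by simp
    then have eq: "(id2 B (?lV y) \<star>\<^bsub>B\<^esub> fun2 F (laxity \<zeta> f)) \<bullet>\<^bsub>B\<^esub> laxity lam (fun1 V f \<cdot>\<^bsub>FG\<^esub> W x) =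
      laxity lam (W y \<cdot>\<^bsub>FG\<^esub> fun1 U f) \<bullet>\<^bsub>B\<^esub> (fun2 G (laxity \<xi> f) \<star>\<^bsub>B\<^esub> id2 B (?lU x))"
      by (simp add: laxity_lam_comp1[OF Wx(1) Vf] laxity_lam_comp1[OF Uf Wy(1)] Wx Wy)
    show "\<Omega> f \<in> hom2 FG (fun1 V f \<cdot>\<^bsub>FG\<^esub> W x) (W y \<cdot>\<^bsub>FG\<^esub> fun1 U f)"
      "fun2 src (\<Omega> f) = laxity \<zeta> f" "fun2 tgt (\<Omega> f) = laxity \<xi> f"
      unfolding \<Omega>_def dcf by (rule comma_cellI[OF VW WU z x eq])+
  qed
  have "lax_transformation D FG U V \<omega>"
  proof (unfold_locales, goal_cases)
    case 1
    then show ?case by (simp add: \<omega>_def)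
  next
    case 2
    then show ?case by (simp add: \<omega>_def)
  next
    case (3 x)
    then show ?case by (simp add: \<omega>_def W)
  next
    case (4 f x y)
    then show ?case using \<Omega>(1)[OF 4] dc[OF 4] by (simp add: \<omega>_def)
  next
    case (5 x)
    note i = U.source.id1_hom[OF 5] and Wx = W[OF 5]
    have p: "W x \<in> arr FG" using Wx(1) by (simp add: hom1_def)
    \<comment> \<open>\<open>U\<close> and \<open>V\<close> preserve identities and the units of the
      comma are strict, so both end arrows collapse to \<open>W x\<close>.\<close>
    have "\<Omega> (id1 D x) \<in> hom2 FG (W x) (W x)"
      using \<Omega>(1)[OF i] U.fun_id1[OF 5] V.fun_id1[OF 5] comma_comp_id[OF Wx(1)] by simp
    then have "\<Omega> (id1 D x) = id2 FG (W x)"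
      using comma_id2_hom[OF Wx(1)]
      by (rule comma_hom2_eqI)
        (simp_all add: \<Omega>[OF i] \<zeta>.laxity_id1[OF 5] \<xi>.laxity_id1[OF 5] src.fun_id2[OF p]
          tgt.fun_id2[OF p] Wx)
    then show ?case using 5 dc[OF i] by (simp add: \<omega>_def)
  next
    case (6 f x y g z)
    note c = U.source.comp1_hom[OF 6] and f = 6(1) and g = 6(2)
    note Wx = W[OF dc(4)[OF f]] and Wy = W[OF dc(5)[OF f]] and Wz = W[OF dc(5)[OF g]]
    note U1 = U.fun1_hom[OF f] U.fun1_hom[OF g] and V1 = V.fun1_hom[OF f] V.fun1_hom[OF g]
    note \<Omega>f = \<Omega>[OF f] and \<Omega>g = \<Omega>[OF g]
    have arrs: "fun1 U f \<in> arr FG" "fun1 V g \<in> arr FG" using U1 V1 by (auto simp: hom1_def)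
    have h1: "\<Omega> g \<star>\<^bsub>FG\<^esub> id2 FG (fun1 U f)
        \<in> hom2 FG (fun1 V g \<cdot>\<^bsub>FG\<^esub> W y \<cdot>\<^bsub>FG\<^esub> fun1 U f) (W z \<cdot>\<^bsub>FG\<^esub> fun1 U g \<cdot>\<^bsub>FG\<^esub> fun1 U f)"
      using comma.whisker_right_hom[OF U1(1) comma_comp_hom[OF Wy(1) V1(2)] \<Omega>g(1)] .
    \<comment> \<open>The codomain is rebracketed so that \<open>h2\<close> can be followed by
      \<open>h1\<close>.\<close>
    have h2: "id2 FG (fun1 V g) \<star>\<^bsub>FG\<^esub> \<Omega> f
        \<in> hom2 FG (fun1 V g \<cdot>\<^bsub>FG\<^esub> (fun1 V f \<cdot>\<^bsub>FG\<^esub> W x)) (fun1 V g \<cdot>\<^bsub>FG\<^esub> W y \<cdot>\<^bsub>FG\<^esub> fun1 U f)"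
      using comma.whisker_left_hom[OF V1(2) comma_comp_hom[OF Wx(1) V1(1)] \<Omega>f(1)]
        comma_comp_assoc[OF U1(1) Wy(1) V1(2)] by simp
    have "\<Omega> (g \<cdot>\<^bsub>D\<^esub> f) = (\<Omega> g \<star>\<^bsub>FG\<^esub> id2 FG (fun1 U f)) \<bullet>\<^bsub>FG\<^esub> (id2 FG (fun1 V g) \<star>\<^bsub>FG\<^esub> \<Omega> f)"
    proof (rule comma_hom2_eqI)
      show "\<Omega> (g \<cdot>\<^bsub>D\<^esub> f) \<in> hom2 FG (fun1 V g \<cdot>\<^bsub>FG\<^esub> (fun1 V f \<cdot>\<^bsub>FG\<^esub> W x))
          (W z \<cdot>\<^bsub>FG\<^esub> fun1 U g \<cdot>\<^bsub>FG\<^esub> fun1 U f)"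
        using \<Omega>(1)[OF c] comma_comp_assoc[OF U1 Wz(1)] comma_comp_assoc[OF Wx(1) V1]
        by (simp add: U.fun_comp1[OF 6] V.fun_comp1[OF 6])
      show "(\<Omega> g \<star>\<^bsub>FG\<^esub> id2 FG (fun1 U f)) \<bullet>\<^bsub>FG\<^esub> (id2 FG (fun1 V g) \<star>\<^bsub>FG\<^esub> \<Omega> f)
        \<in> hom2 FG (fun1 V g \<cdot>\<^bsub>FG\<^esub> (fun1 V f \<cdot>\<^bsub>FG\<^esub> W x)) (W z \<cdot>\<^bsub>FG\<^esub> fun1 U g \<cdot>\<^bsub>FG\<^esub> fun1 U f)"
        using comma_vcomp_hom[OF h2 h1] .
      have cd: "cod1 FG (fun1 U f) = dom1 FG (fun1 V g \<cdot>\<^bsub>FG\<^esub> W y)"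
        "cod1 FG (fun1 V f \<cdot>\<^bsub>FG\<^esub> W x) = dom1 FG (fun1 V g)"
        using U1 V1 comma_comp_hom[OF Wy(1) V1(2)] comma_comp_hom[OF Wx(1) V1(1)]
        by (auto simp: hom1_def)
      note i = comma.id2_hom[OF arrs(1)] comma.id2_hom[OF arrs(2)]
      show "fun2 src (\<Omega> (g \<cdot>\<^bsub>D\<^esub> f))
        = fun2 src ((\<Omega> g \<star>\<^bsub>FG\<^esub> id2 FG (fun1 U f)) \<bullet>\<^bsub>FG\<^esub> (id2 FG (fun1 V g) \<star>\<^bsub>FG\<^esub> \<Omega> f))"
        using dc[OF f] dc[OF g]
        by (simp add: src.fun_vcomp[OF h2 h1] src.fun_hcomp[OF i(1) \<Omega>g(1) cd(1)]
            src.fun_hcomp[OF \<Omega>f(1) i(2) cd(2)] src.fun_id2 arrs \<Omega>[OF c] \<Omega>f \<Omega>g \<zeta>.laxity_comp1[OF 6])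
      show "fun2 tgt (\<Omega> (g \<cdot>\<^bsub>D\<^esub> f))
        = fun2 tgt ((\<Omega> g \<star>\<^bsub>FG\<^esub> id2 FG (fun1 U f)) \<bullet>\<^bsub>FG\<^esub> (id2 FG (fun1 V g) \<star>\<^bsub>FG\<^esub> \<Omega> f))"
        using dc[OF f] dc[OF g]
        by (simp add: tgt.fun_vcomp[OF h2 h1] tgt.fun_hcomp[OF i(1) \<Omega>g(1) cd(1)]
            tgt.fun_hcomp[OF \<Omega>f(1) i(2) cd(2)] tgt.fun_id2 arrs \<Omega>[OF c] \<Omega>f \<Omega>g \<xi>.laxity_comp1[OF 6])
    qed
    then show ?case using dc[OF f] dc[OF g] dc[OF c] by (simp add: \<omega>_def)
  next
    case (7 f x y \<theta> g)
    note f = 7(1)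
    have g: "g \<in> hom1 D x y" using U.source.hom2_parallel[OF 7(2)] f by blast
    have \<theta>: "\<theta> \<in> cell D" using 7(2) by (simp add: hom2_def)
    note Wx = W[OF dc(4)[OF f]] and Wy = W[OF dc(5)[OF f]]
    note Uf = U.fun1_hom[OF f] and Vf = V.fun1_hom[OF f] and Vg = V.fun1_hom[OF g]
      and U\<theta> = U.fun2_hom[OF 7(2)] and V\<theta> = V.fun2_hom[OF 7(2)]
    note \<Omega>f = \<Omega>[OF f] and \<Omega>g = \<Omega>[OF g]
    have arrs: "W x \<in> arr FG" "W y \<in> arr FG" using Wx(1) Wy(1) by (auto simp: hom1_def)
    have cd: "cod1 FG (fun1 U f) = dom1 FG (W y)" "cod1 FG (W x) = dom1 FG (fun1 V f)"
      using Uf Vf Wx(1) Wy(1) by (auto simp: hom1_def)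
    note i = comma.id2_hom[OF arrs(1)] comma.id2_hom[OF arrs(2)]
    note h1 = comma.whisker_left_hom[OF Wy(1) Uf U\<theta>]
      and h2 = comma.whisker_right_hom[OF Wx(1) Vf V\<theta>]
    have "(id2 FG (W y) \<star>\<^bsub>FG\<^esub> fun2 U \<theta>) \<bullet>\<^bsub>FG\<^esub> \<Omega> f = \<Omega> g \<bullet>\<^bsub>FG\<^esub> (fun2 V \<theta> \<star>\<^bsub>FG\<^esub> id2 FG (W x))"
      using comma_vcomp_hom[OF \<Omega>f(1) h1] comma_vcomp_hom[OF h2 \<Omega>g(1)]
    proof (rule comma_hom2_eqI)
      show "fun2 src ((id2 FG (W y) \<star>\<^bsub>FG\<^esub> fun2 U \<theta>) \<bullet>\<^bsub>FG\<^esub> \<Omega> f) =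
          fun2 src (\<Omega> g \<bullet>\<^bsub>FG\<^esub> (fun2 V \<theta> \<star>\<^bsub>FG\<^esub> id2 FG (W x)))"
        using \<zeta>.laxity_natural[OF 7] \<theta>
        by (simp add: src.fun_vcomp[OF \<Omega>f(1) h1] src.fun_vcomp[OF h2 \<Omega>g(1)]
            src.fun_hcomp[OF U\<theta> i(2) cd(1)] src.fun_hcomp[OF i(1) V\<theta> cd(2)] src.fun_id2
              arrs \<Omega>f \<Omega>g Wx Wy)
      show "fun2 tgt ((id2 FG (W y) \<star>\<^bsub>FG\<^esub> fun2 U \<theta>) \<bullet>\<^bsub>FG\<^esub> \<Omega> f) =
          fun2 tgt (\<Omega> g \<bullet>\<^bsub>FG\<^esub> (fun2 V \<theta> \<star>\<^bsub>FG\<^esub> id2 FG (W x)))"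
        using \<xi>.laxity_natural[OF 7] \<theta>
        by (simp add: tgt.fun_vcomp[OF \<Omega>f(1) h1] tgt.fun_vcomp[OF h2 \<Omega>g(1)]
            tgt.fun_hcomp[OF U\<theta> i(2) cd(1)] tgt.fun_hcomp[OF i(1) V\<theta> cd(2)] tgt.fun_id2
              arrs \<Omega>f \<Omega>g Wx Wy)
    qed
    then show ?case using dc[OF f] dc[OF g] by (simp add: \<omega>_def)
  qed
  moreover have "fun_lax D tgt \<omega> = \<xi>"
  proof -
    have "component (fun_lax D tgt \<omega>) = component \<xi>"
      using \<xi>.component_ext
      by (intro extensionalityI[of _ "obj D"]) (auto simp: fun_lax_def W \<omega>_def compose_def)
    moreover have "laxity (fun_lax D tgt \<omega>) = laxity \<xi>"
      using \<xi>.laxity_ext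
      by (intro extensionalityI[of _ "arr D"])
        (auto simp: fun_lax_def \<omega>_def compose_def \<Omega>(3)[OF hom1_arr])
    ultimately show ?thesis by simp
  qed
  moreover have "fun_lax D src \<omega> = \<zeta>"
  proof -
    have "component (fun_lax D src \<omega>) = component \<zeta>"
      using \<zeta>.component_ext
      by (intro extensionalityI[of _ "obj D"]) (auto simp: fun_lax_def W \<omega>_def compose_def)
    moreover have "laxity (fun_lax D src \<omega>) = laxity \<zeta>"
      using \<zeta>.laxity_ext
      by (intro extensionalityI[of _ "arr D"])
        (auto simp: fun_lax_def \<omega>_def compose_def \<Omega>(2)[OF hom1_arr])
    ultimately show ?thesis by simp
  qed
  ultimately show "\<exists>\<omega>. lax_transformation D FG U V \<omega> \<and> fun_lax D tgt \<omega> = \<xi> \<and> fun_lax D src \<omega> = \<zeta>"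
    by blast
qed

lemma universal_3_comma: "universal_3 A B C F G FG src tgt lam D"
  unfolding universal_3_def
proof (intro allI impI)
  fix U V \<omega> \<chi> m n
  assume "lax_transformation D FG U V \<omega>" "lax_transformation D FG U V \<chi>"
    and m:
      "modification D A (fun_comp D src U) (fun_comp D src V) (fun_lax D src \<omega>) (fun_lax D src \<chi>) m"
    and n:
      "modification D C (fun_comp D tgt U) (fun_comp D tgt V) (fun_lax D tgt \<omega>) (fun_lax D tgt \<chi>) n"
    and eq:
      "mod_comp D B (lax_mod D B (lax_fun D lam V) (fun_mod D F m)) (lax_interchange D lam \<omega>) =
        mod_comp D B (lax_interchange D lam \<chi>) (mod_lax D B (fun_mod D G n) (lax_fun D lam U))"
  interpret \<omega>: lax_transformation D FG U V \<omega> by fact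
  interpret \<chi>: lax_transformation D FG U V \<chi> by fact
  interpret m: modification D A "fun_comp D src U" "fun_comp D src V" "fun_lax D src \<omega>"
    "fun_lax D src \<chi>" m
    by fact
  interpret n: modification D C "fun_comp D tgt U" "fun_comp D tgt V" "fun_lax D tgt \<omega>"
    "fun_lax D tgt \<chi>" n
    by fact
  define l where "l = (\<lambda>x\<in>obj D. (component \<omega> x, (m x, n x), component \<chi> x))"
  have l: "l x \<in> hom2 FG (component \<omega> x) (component \<chi> x)" "fun2 src (l x) = m x"
    "fun2 tgt (l x) = n x"
    if x: "x \<in> obj D" for x
  proof -
    have mx: "m x \<in> hom2 A (fun1 src (component \<omega> x)) (fun1 src (component \<chi> x))"
      using m.modification_hom[OF x] x by simp
    have nx: "n x \<in> hom2 C (fun1 tgt (component \<omega> x)) (fun1 tgt (component \<chi> x))"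
      using n.modification_hom[OF x] x by simp
    \<comment> \<open>At \<open>x\<close> the interchange modification of \<open>lam\<close> is the
      2-cell stored in the component of \<omega> or \<chi>, so the equation of pastings evaluates to
      the condition on a comma 2-cell.\<close>
    have eqx:
      "(id2 B (component lam (fun0 V x)) \<star>\<^bsub>B\<^esub> fun2 F (m x)) \<bullet>\<^bsub>B\<^esub> laxity lam (component \<omega> x) =
      laxity lam (component \<chi> x) \<bullet>\<^bsub>B\<^esub> (fun2 G (n x) \<star>\<^bsub>B\<^esub> id2 B (component lam (fun0 U x)))"
      using fun_cong[OF eq, of x] x
      by (simp add: mod_comp_def lax_mod_def mod_lax_def fun_mod_def lax_interchange_def
          compose_def)
    have lx: "l x = (component \<omega> x, (m x, n x), component \<chi> x)" using x by (simp add: l_def)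
    show "l x \<in> hom2 FG (component \<omega> x) (component \<chi> x)" "fun2 src (l x) = m x"
      "fun2 tgt (l x) = n x"
      unfolding lx
      by (rule comma_cellI[OF \<omega>.component_hom[OF x] \<chi>.component_hom[OF x] mx nx eqx])+
  qed
  have "modification D FG U V \<omega> \<chi> l"
  proof (unfold_locales, goal_cases)
    case 1
    then show ?case by (simp add: l_def)
  next
    case (2 x)
    then show ?case by (rule l)
  next
    case (3 f x y)
    have arrD: "f \<in> arr D" using 3 by (simp add: hom1_def)
    note xy = \<omega>.F.source.hom1_obj[OF 3]
    note lx = l[OF xy(1)] and ly = l[OF xy(2)]
    note Uf = \<omega>.F.fun1_hom[OF 3] and Vf = \<omega>.G.fun1_hom[OF 3]
    note \<omega>x = \<omega>.component_hom[OF xy(1)] and \<omega>y = \<omega>.component_hom[OF xy(2)]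
    have arrs: "fun1 U f \<in> arr FG" "fun1 V f \<in> arr FG" using Uf Vf by (auto simp: hom1_def)
    have cd: "cod1 FG (fun1 U f) = dom1 FG (component \<omega> y)"
      "cod1 FG (component \<omega> x) = dom1 FG (fun1 V f)"
      using Uf Vf \<omega>x \<omega>y by (auto simp: hom1_def)
    note i = comma.id2_hom[OF arrs(1)] comma.id2_hom[OF arrs(2)]
    note h1 = comma.whisker_right_hom[OF Uf \<omega>y ly(1)]
      and h2 = comma.whisker_left_hom[OF Vf \<omega>x lx(1)]
    note \<omega>f = \<omega>.laxity_hom[OF 3] and \<chi>f = \<chi>.laxity_hom[OF 3]
    show ?case
      \<comment> \<open>The two composites are parallel, and their projections are compared by the
        naturality of \<open>m\<close> and of \<open>n\<close>.\<close>
      using comma_vcomp_hom[OF \<omega>f h1] comma_vcomp_hom[OF h2 \<chi>f]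
    proof (rule comma_hom2_eqI)
      show "fun2 src ((l y \<star>\<^bsub>FG\<^esub> id2 FG (fun1 U f)) \<bullet>\<^bsub>FG\<^esub> laxity \<omega> f) =
          fun2 src (laxity \<chi> f \<bullet>\<^bsub>FG\<^esub> (id2 FG (fun1 V f) \<star>\<^bsub>FG\<^esub> l x))"
        using m.modification_natural[OF 3] arrD
        by (simp add: src.fun_vcomp[OF \<omega>f h1] src.fun_vcomp[OF h2 \<chi>f]
          src.fun_hcomp[OF i(1) ly(1) cd(1)]
            src.fun_hcomp[OF lx(1) i(2) cd(2)] src.fun_id2 arrs lx ly)
      show "fun2 tgt ((l y \<star>\<^bsub>FG\<^esub> id2 FG (fun1 U f)) \<bullet>\<^bsub>FG\<^esub> laxity \<omega> f) =
          fun2 tgt (laxity \<chi> f \<bullet>\<^bsub>FG\<^esub> (id2 FG (fun1 V f) \<star>\<^bsub>FG\<^esub> l x))"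
        using n.modification_natural[OF 3] arrD
        by (simp add: tgt.fun_vcomp[OF \<omega>f h1] tgt.fun_vcomp[OF h2 \<chi>f]
          tgt.fun_hcomp[OF i(1) ly(1) cd(1)]
            tgt.fun_hcomp[OF lx(1) i(2) cd(2)] tgt.fun_id2 arrs lx ly)
    qed
  qed
  moreover have "fun_mod D tgt l = n"
    using n.modification_ext
    by (intro extensionalityI[of _ "obj D"]) (auto simp: fun_mod_def compose_def l)
  moreover have "fun_mod D src l = m"
    using m.modification_ext
    by (intro extensionalityI[of _ "obj D"]) (auto simp: fun_mod_def compose_def l)
  \<comment> \<open>The end arrows at each object are prescribed by \<omega> and \<chi>, so the two
    projections determine the component there.\<close>
  moreover have "l' = l" if l': "modification D FG U V \<omega> \<chi> l'" "fun_mod D tgt l' = n"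
    "fun_mod D src l' = m" for l'
  proof -
    interpret l': modification D FG U V \<omega> \<chi> l' by fact
    show ?thesis
    proof (rule extensionalityI[of _ "obj D"])
      fix x assume x: "x \<in> obj D"
      have "fun2 src (l' x) = m x" "fun2 tgt (l' x) = n x"
        using x by (simp_all add: l'(2,3)[symmetric] fun_mod_def compose_def)
      then show "l' x = l x"
        using comma_hom2_eqI[OF l'.modification_hom[OF x] l(1)[OF x]] l[OF x] by simp
    qed (simp_all add: l'.modification_ext l_def)
  qed
  ultimately show "\<exists>!l. modification D FG U V \<omega> \<chi> l \<and> fun_mod D tgt l = n \<and> fun_mod D src l = m"
    by blast
qed

section \<open>Characterization up to isomorphism\<close>

lemma lax_square_comma: "lax_square A B C F G FG src tgt lam"
  using two_functor_src two_functor_tgt lax_transformation_lam by (simp add: lax_square_def)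

text \<open>\<Phi> comes from the universality of the comma tested on \<open>P\<close>, and \<Psi>
  from that of \<open>P\<close> tested on the comma. Both composites respect the projections and the
  lax transformations, as identities do. Uniqueness of maps into the comma makes \<Phi> after \<Psi>
  the identity; uniqueness for \<open>P\<close> tested on \<open>P\<close> itself settles the other
  composite.\<close>

lemma Lax_isomorphism_comma:
  assumes sq: "lax_square A B C F G P s t \<mu>"
    and univ_FG: "universal_1 A B C F G P s t \<mu> FG" and univ_P: "universal_1 A B C F G P s t \<mu> P"
  shows "\<exists>\<Phi>. Lax_isomorphism P FG \<Phi> \<and> fun_comp P src \<Phi> = s \<and> fun_comp P tgt \<Phi> = t \<and>
    lax_fun P lam \<Phi> = \<mu>"
proof -
  have s: "two_functor P A s" and t: "two_functor P C t"
    and \<mu>: "lax_transformation P B (fun_comp P F s) (fun_comp P G t) \<mu>"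
    using sq by (auto simp: lax_square_def)
  obtain \<Phi> where \<Phi>: "two_functor P FG \<Phi>" "fun_comp P src \<Phi> = s" "fun_comp P tgt \<Phi> = t"
    "lax_fun P lam \<Phi> = \<mu>"
    using s t \<mu> by (rule comma_functor_exists)
  obtain \<Psi> where \<Psi>: "two_functor FG P \<Psi>" "fun_comp FG s \<Psi> = src" "fun_comp FG t \<Psi> = tgt"
    "lax_fun FG \<mu> \<Psi> = lam"
    using univ_FG two_functor_src two_functor_tgt lax_transformation_lam unfolding universal_1_def
    by metis
  have "fun_comp FG \<Phi> \<Psi> = fun_id FG"
  proof (rule comma_functor_eqI[OF two_functor_fun_comp[OF \<Psi>(1) \<Phi>(1)]
        two_functor_fun_id[OF two_category_comma]])
    show "fun_comp FG src (fun_comp FG \<Phi> \<Psi>) = fun_comp FG src (fun_id FG)"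
      using fun_comp_assoc[OF \<Psi>(1), of src \<Phi>] fun_comp_id_right[OF two_functor_src] \<Phi> \<Psi> by simp
    show "fun_comp FG tgt (fun_comp FG \<Phi> \<Psi>) = fun_comp FG tgt (fun_id FG)"
      using fun_comp_assoc[OF \<Psi>(1), of tgt \<Phi>] fun_comp_id_right[OF two_functor_tgt] \<Phi> \<Psi> by simp
    show "lax_fun FG lam (fun_comp FG \<Phi> \<Psi>) = lax_fun FG lam (fun_id FG)"
      using lax_fun_fun_comp[OF \<Psi>(1), of lam \<Phi>] lax_fun_id[OF lax_transformation_lam] \<Phi> \<Psi> by simp
  qed
  moreover have "fun_comp P \<Psi> \<Phi> = fun_id P"
  proof -
    \<comment> \<open>The square of \<open>P\<close> is fed to its own universal property; the
      composite of \<Phi> and \<Psi> and the identity are two solutions.\<close>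
    have "\<exists>!U. two_functor P P U \<and> fun_comp P s U = s \<and> fun_comp P t U = t \<and> \<mu> = lax_fun P \<mu> U"
      using univ_P s t \<mu> unfolding universal_1_def by blast
    moreover have "two_functor P P (fun_comp P \<Psi> \<Phi>)" "fun_comp P s (fun_comp P \<Psi> \<Phi>) = s"
      "fun_comp P t (fun_comp P \<Psi> \<Phi>) = t" "\<mu> = lax_fun P \<mu> (fun_comp P \<Psi> \<Phi>)"
      using two_functor_fun_comp[OF \<Phi>(1) \<Psi>(1)] fun_comp_assoc[OF \<Phi>(1), of s \<Psi>]
        fun_comp_assoc[OF \<Phi>(1), of t \<Psi>] lax_fun_fun_comp[OF \<Phi>(1), of \<mu> \<Psi>] \<Phi> \<Psi> by simp_all
    moreover have "two_functor P P (fun_id P)" "fun_comp P s (fun_id P) = s"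
      "fun_comp P t (fun_id P) = t" "\<mu> = lax_fun P \<mu> (fun_id P)"
      using two_functor_fun_id[OF two_functor.axioms(1)[OF s]] fun_comp_id_right[OF s]
        fun_comp_id_right[OF t] lax_fun_id[OF \<mu>] by simp_all
    ultimately show ?thesis by blast
  qed
  ultimately have "Lax_isomorphism P FG \<Phi>"
    using \<Phi>(1) \<Psi>(1) unfolding Lax_isomorphism_def by blast
  with \<Phi> show ?thesis by blast
qed

end

text \<open>A HOL formula cannot quantify over the types of test 2-categories. The universality of
  the comma is polymorphic in the type of \<open>D\<close>, hence available at every instance. As a
  hypothesis on \<open>P\<close> it has fixed types, so it is assumed at the two at which the
  comparison tests it: those of the comma and of \<open>P\<close>.\<close>

theorem proposition2p24:
  fixes A :: "('a0, 'a1, 'a2) two_cat"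
    and B :: "('b0, 'b1, 'b2) two_cat"
    and C :: "('c0, 'c1, 'c2) two_cat"
    and F :: "('a0, 'a1, 'a2, 'b0, 'b1, 'b2) two_fun"
    and G :: "('c0, 'c1, 'c2, 'b0, 'b1, 'b2) two_fun"
  defines "FG \<equiv> lax_comma A B C F G"
    and "src \<equiv> comma_src A B C F G"
    and "tgt \<equiv> comma_tgt A B C F G"
    and "lam \<equiv> comma_lambda A B C F G"
  assumes "two_functor A B F" and "two_functor C B G"
  shows "lax_square A B C F G FG src tgt lam
    \<and> (\<forall>D :: ('d0, 'd1, 'd2) two_cat. two_category D \<longrightarrow>
          universal_1 A B C F G FG src tgt lam D \<and>
          universal_2 A B C F G FG src tgt lam D \<and>
          universal_3 A B C F G FG src tgt lam D)
    \<and> (\<forall>(P :: ('p0, 'p1, 'p2) two_cat) s t \<mu>.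
          lax_square A B C F G P s t \<mu> \<longrightarrow>
          (\<forall>D :: (('a0, 'b1, 'c0) comma_obj, ('a0, 'a1, 'b1, 'b2, 'c0, 'c1) comma_arr,
                  ('a0, 'a1, 'a2, 'b1, 'b2, 'c0, 'c1, 'c2) comma_cell) two_cat.
            two_category D \<longrightarrow>
              universal_1 A B C F G P s t \<mu> D \<and>
              universal_2 A B C F G P s t \<mu> D \<and>
              universal_3 A B C F G P s t \<mu> D) \<longrightarrow>
          (\<forall>D :: ('p0, 'p1, 'p2) two_cat.
            two_category D \<longrightarrow>
              universal_1 A B C F G P s t \<mu> D \<and>
              universal_2 A B C F G P s t \<mu> D \<and>
              universal_3 A B C F G P s t \<mu> D) \<longrightarrow>
          (\<exists>\<Phi>. Lax_isomorphism P FG \<Phi> \<and>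
            fun_comp P src \<Phi> = s \<and> fun_comp P tgt \<Phi> = t \<and> lax_fun P lam \<Phi> = \<mu>))"
proof -
  interpret comma_base A B C F G
    using assms(5,6) by (simp add: comma_base_def)
  show ?thesis
    unfolding FG_def src_def tgt_def lam_def
  proof (intro conjI allI impI)
    fix P :: "('p0, 'p1, 'p2) two_cat" and s t \<mu>
    assume sq: "lax_square A B C F G P s t \<mu>"
      and "\<forall>D :: (('a0, 'b1, 'c0) comma_obj, ('a0, 'a1, 'b1, 'b2, 'c0, 'c1) comma_arr,
          ('a0, 'a1, 'a2, 'b1, 'b2, 'c0, 'c1, 'c2) comma_cell) two_cat.
        two_category D \<longrightarrow> universal_1 A B C F G P s t \<mu> D \<and>
        universal_2 A B C F G P s t \<mu> D \<and> universal_3 A B C F G P s t \<mu> D"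
      and "\<forall>D :: ('p0, 'p1, 'p2) two_cat.
        two_category D \<longrightarrow> universal_1 A B C F G P s t \<mu> D \<and>
        universal_2 A B C F G P s t \<mu> D \<and> universal_3 A B C F G P s t \<mu> D"
    \<comment> \<open>The square contains a 2-functor out of \<open>P\<close>, which carries the
      axioms that let \<open>P\<close> serve as a test 2-category.\<close>
    moreover have "two_category P"
      using sq two_functor.axioms(1) by (auto simp: lax_square_def)
    ultimately show "\<exists>\<Phi>. Lax_isomorphism P (lax_comma A B C F G) \<Phi> \<and>
        fun_comp P (comma_src A B C F G) \<Phi> = s \<and> fun_comp P (comma_tgt A B C F G) \<Phi> = t \<and>
        lax_fun P (comma_lambda A B C F G) \<Phi> = \<mu>"
      using two_category_comma by (intro Lax_isomorphism_comma) blast+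
  qed (rule lax_square_comma universal_1_comma universal_2_comma universal_3_comma)+
qed

end
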